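(* Suppose $A$ is an exponentially distributed random variable, let $Z$ be a Poisson random variable with mean $\mu_A/\mu_S$, and let $Q_2(t)$ be the number in system at time $t$ in the FCFS $M/GI/n$ queue $\mathcal{Q}_2$ with the initial conditions described in the context. For all $x>0$ and $t\ge0$, $$P\bigl((Q_2(t)-n)^+>x\bigr)\ge P(Z\ge n)\,\sup_{0\le s\le t}P\Bigl(A(s)-\sum_{i=1}^nN_i(s)>x\Bigr).$$ If in addition $Q_2(t)$ converges weakly to a stationary distribution $Q(\infty)$ as $t\to\infty$, then for all $x>0$, $$P\bigl((Q(\infty)-n)^+>x\bigr)\ge P(Z\ge n)\,\sup_{t\ge0}P\Bigl(A(t)-\sum_{i=1}^nN_i(t)>x\Bigr).$$
   Context: $n\ge1$ is an integer. $A$ and $S$ are nonnegative random variables with $E[A]=\mu_A^{-1}<\infty$, $E[S]=\mu_S^{-1}<\infty$ and $P(A=0)=P(S=0)=0$. For a nonnegative random variable $X$ with finite mean $E[X]>0$, $R(X)$ denotes a random variable with the residual life distribution of $X$: $P(R(X)>z)=(E[X])^{-1}\int_z^\infty P(X>y)\,dy$ for $z\ge0$. An equilibrium renewal process with renewal distribution $X$ is a counting process whose first inter-event time is distributed as $R(X)$ and whose subsequent inter-event times are i.i.d. distributed as $X$ (all inter-event times independent). All processes are right-continuous with left limits. $x^+=\max(x,0)$. $N_1(t),\dots,N_n(t)$ are i.i.d. equilibrium renewal processes with renewal distribution $S$; $A(t)$ is an equilibrium renewal process with renewal distribution $A$ (here a Poisson process); $A(\cdot),N_1(\cdot),\dots,N_n(\cdot)$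 are mutually independent. $\mathcal{Q}_2$ is the first-come-first-served (FCFS) $M/GI/n$ queue ($n$ parallel servers) with inter-arrival times i.i.d. distributed as $A$, processing times i.i.d. distributed as $S$ (independent of the arrivals), and the following initial conditions: at time $0$ there are $Z$ jobs in system; these have initial processing times i.i.d. distributed as $R(S)$, independent of $Z$; if $Z\ge n$, a set of exactly $n$ initial jobs is selected uniformly at random to be processed initially and the remaining initial jobs queue for processing; the first inter-arrival time is distributed as $R(A)$ (also exponential), independent of both $Z$ and the initial processing times of the jobs initially in system. "Number in system" means number in service plus number waiting in queue. *)

theory Defs
  imports "HOL-Probability.Probability"
begin

definition same_law :: "'a measure \<Rightarrow> ('a \<Rightarrow> real) \<Rightarrow> 'p measure \<Rightarrow> ('p \<Rightarrow> real) \<Rightarrow> bool" where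
  "same_law M Y P X \<longleftrightarrow> Y \<in> borel_measurable M \<and> distr M borel Y = distr P borel X"

definition positive_rv_with_rate :: "'p measure \<Rightarrow> ('p \<Rightarrow> real) \<Rightarrow> real \<Rightarrow> bool" where
  "positive_rv_with_rate P X \<mu> \<longleftrightarrow>
     X \<in> borel_measurable P \<and> (AE \<omega> in P. 0 \<le> X \<omega>) \<and> (AE \<omega> in P. X \<omega> \<noteq> 0) \<and>
     integrable P X \<and> 0 < \<mu> \<and> (\<integral>\<omega>. X \<omega> \<partial>P) = inverse \<mu>"

text \<open>\<open>R\<close>, a random variable on \<open>M\<close>, has the residual life distribution of \<open>X\<close>, a random variable
  on \<open>P\<close>. The condition at \<open>z = 0\<close> forces \<open>R > 0\<close> almost surely, so the law of \<open>R\<close> is determined.\<close>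

definition residual_life :: "'a measure \<Rightarrow> ('a \<Rightarrow> real) \<Rightarrow> 'p measure \<Rightarrow> ('p \<Rightarrow> real) \<Rightarrow> bool" where
  "residual_life M R P X \<longleftrightarrow> R \<in> borel_measurable M \<and>
     (\<forall>z\<ge>0. measure M {\<omega> \<in> space M. z < R \<omega>} =
        inverse (\<integral>\<omega>. X \<omega> \<partial>P) * (LBINT y:{z<..}. measure P {\<omega> \<in> space P. y < X \<omega>}))"

text \<open>Number of events in \<open>[0, t]\<close> when the successive inter-event times are \<open>x 0, x 1, \<dots>\<close>; counting
  the event times \<open>\<le> t\<close> gives the right-continuous version. The set is almost surely finite for the
  sequences used below.\<close>

definition event_count :: "(nat \<Rightarrow> real) \<Rightarrow> real \<Rightarrow> nat" where
  "event_count x t = card {k. (\<Sum>j\<le>k. x j) \<le> t}"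

definition equilibrium_renewal ::
  "'b measure \<Rightarrow> (real \<Rightarrow> 'b \<Rightarrow> nat) \<Rightarrow> 'p measure \<Rightarrow> ('p \<Rightarrow> real) \<Rightarrow> bool" where
  "equilibrium_renewal M N P X \<longleftrightarrow>
     (\<forall>t\<ge>0. N t \<in> measurable M (count_space UNIV)) \<and>
     (\<exists>Y. residual_life M (Y 0) P X \<and> (\<forall>k. same_law M (Y (Suc k)) P X) \<and>
          prob_space.indep_vars M (\<lambda>_. borel) Y UNIV \<and>
          (AE \<omega> in M. \<forall>t\<ge>0. N t \<omega> = event_count (\<lambda>k. Y k \<omega>) t))"

definition path :: "(real \<Rightarrow> 'b \<Rightarrow> nat) \<Rightarrow> 'b \<Rightarrow> real \<Rightarrow> nat" where
  "path N \<omega> = (\<lambda>t\<in>{0..}. N t \<omega>)"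

definition indep_processes :: "'b measure \<Rightarrow> ('i \<Rightarrow> real \<Rightarrow> 'b \<Rightarrow> nat) \<Rightarrow> 'i set \<Rightarrow> bool" where
  "indep_processes M N I \<longleftrightarrow>
     prob_space.indep_vars M (\<lambda>_. PiM {0..} (\<lambda>_. count_space UNIV)) (\<lambda>i. path (N i)) I"

text \<open>FCFS service by \<open>n\<close> parallel servers of jobs \<open>0, 1, \<dots>\<close>, listed in order of priority, where job
  \<open>j\<close> arrives at time \<open>a j\<close> (nondecreasing in \<open>j\<close>) and needs processing time \<open>v j\<close>: job \<open>j\<close> enters
  service at the first time \<open>t \<ge> a j\<close> at which fewer than \<open>n\<close> of the jobs ahead of it have not yet
  departed.\<close>

context
  notes conj_cong [fundef_cong]
begin

fun service_start :: "nat \<Rightarrow> (nat \<Rightarrow> real) \<Rightarrow> (nat \<Rightarrow> real) \<Rightarrow> nat \<Rightarrow> real" where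
  "service_start n a v j =
     Inf {t. a j \<le> t \<and> card {i. i < j \<and> t < service_start n a v i + v i} < n}"

end

declare service_start.simps [simp del]

text \<open>Jobs in service or waiting at time \<open>t\<close>.\<close>

definition number_in_system :: "nat \<Rightarrow> (nat \<Rightarrow> real) \<Rightarrow> (nat \<Rightarrow> real) \<Rightarrow> real \<Rightarrow> nat" where
  "number_in_system n a v t = card {j. a j \<le> t \<and> t < service_start n a v j + v j}"

text \<open>With \<open>z\<close> initial jobs, labelled by \<open>{..<z}\<close> and listed in order of priority by \<open>l\<close>, the jobs at
  positions \<open>< z\<close> are the initial ones and position \<open>z + k\<close> is the \<open>k\<close>-th arriving job (from
  \<open>k = 0\<close>). Here \<open>u\<close> are the inter-arrival times, \<open>v\<close> the initial processing times by label, and \<open>w\<close>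
  the processing times of the arriving jobs.\<close>

definition job_arrival :: "nat \<Rightarrow> (nat \<Rightarrow> real) \<Rightarrow> nat \<Rightarrow> real" where
  "job_arrival z u p = (if p < z then 0 else (\<Sum>j\<le>p - z. u j))"

definition job_processing ::
  "nat \<Rightarrow> nat list \<Rightarrow> (nat \<Rightarrow> real) \<Rightarrow> (nat \<Rightarrow> real) \<Rightarrow> nat \<Rightarrow> real" where
  "job_processing z l v w p = (if p < z then v (l ! p) else w (p - z))"

definition queue_number ::
  "nat \<Rightarrow> ('a \<Rightarrow> nat) \<Rightarrow> ('a \<Rightarrow> nat list) \<Rightarrow> (nat \<Rightarrow> 'a \<Rightarrow> real) \<Rightarrow> (nat \<Rightarrow> 'a \<Rightarrow> real) \<Rightarrow>
   (nat \<Rightarrow> 'a \<Rightarrow> real) \<Rightarrow> real \<Rightarrow> 'a \<Rightarrow> nat" where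
  "queue_number n Z L U V W t \<omega> =
     number_in_system n (job_arrival (Z \<omega>) (\<lambda>k. U k \<omega>))
       (job_processing (Z \<omega>) (L \<omega>) (\<lambda>k. V k \<omega>) (\<lambda>k. W k \<omega>)) t"

datatype queue_input = Initial_State | Interarrival nat | Initial_Processing nat | Processing nat

fun input_sigma ::
  "'a measure \<Rightarrow> ('a \<Rightarrow> nat) \<Rightarrow> ('a \<Rightarrow> nat list) \<Rightarrow> (nat \<Rightarrow> 'a \<Rightarrow> real) \<Rightarrow> (nat \<Rightarrow> 'a \<Rightarrow> real) \<Rightarrow>
   (nat \<Rightarrow> 'a \<Rightarrow> real) \<Rightarrow> queue_input \<Rightarrow> 'a set set" where
  "input_sigma M Z L U V W Initial_State =
     sets (vimage_algebra (space M) (\<lambda>\<omega>. (Z \<omega>, L \<omega>)) (count_space UNIV))"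
| "input_sigma M Z L U V W (Interarrival k) = sets (vimage_algebra (space M) (U k) borel)"
| "input_sigma M Z L U V W (Initial_Processing k) = sets (vimage_algebra (space M) (V k) borel)"
| "input_sigma M Z L U V W (Processing k) = sets (vimage_algebra (space M) (W k) borel)"

text \<open>Primitive data of the queue with inter-arrival distribution \<open>A\<close> and processing distribution
  \<open>S\<close>. \<open>L\<close> lists the \<open>Z\<close> initial jobs: the first \<open>min n Z\<close> entries are in service at time \<open>0\<close> and
  the rest wait in list order, ahead of all arrivals. Given \<open>Z = k \<ge> n\<close>, the set of jobs served
  initially is uniform among the \<open>n\<close>-subsets of the initial jobs; the order of the waiting initial
  jobs is left arbitrary, except that, like the selection, it does not depend on the arrivals or on
  the processing times.\<close>

definition queue_inputs ::
  "'a measure \<Rightarrow> nat \<Rightarrow> 'p measure \<Rightarrow> ('p \<Rightarrow> real) \<Rightarrow> ('p \<Rightarrow> real) \<Rightarrow> ('a \<Rightarrow> nat) \<Rightarrow> ('a \<Rightarrow> nat list) \<Rightarrow>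
   (nat \<Rightarrow> 'a \<Rightarrow> real) \<Rightarrow> (nat \<Rightarrow> 'a \<Rightarrow> real) \<Rightarrow> (nat \<Rightarrow> 'a \<Rightarrow> real) \<Rightarrow> bool" where
  "queue_inputs M n P A S Z L U V W \<longleftrightarrow>
     Z \<in> measurable M (count_space UNIV) \<and>
     L \<in> measurable M (count_space UNIV) \<and>
     (AE \<omega> in M. distinct (L \<omega>) \<and> set (L \<omega>) = {..<Z \<omega>}) \<and>
     (\<forall>k\<ge>n. \<forall>B. B \<subseteq> {..<k} \<and> card B = n \<longrightarrow>
        measure M {\<omega> \<in> space M. Z \<omega> = k \<and> set (take n (L \<omega>)) = B} =
        measure M {\<omega> \<in> space M. Z \<omega> = k} / real (k choose n)) \<and>
     residual_life M (U 0) P A \<and> (\<forall>k. same_law M (U (Suc k)) P A) \<and>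
     (\<forall>k. residual_life M (V k) P S) \<and>
     (\<forall>k. same_law M (W k) P S) \<and>
     prob_space.indep_sets M (input_sigma M Z L U V W) UNIV"

text \<open>The library's \<open>weak_conv_m\<close> is for sequences; this is the same definition along \<open>t \<rightarrow> \<infinity>\<close> in the
  reals.\<close>

definition weak_conv_at_top :: "(real \<Rightarrow> real measure) \<Rightarrow> real measure \<Rightarrow> bool" where
  "weak_conv_at_top \<mu> \<nu> \<longleftrightarrow>
     (\<forall>x. isCont (cdf \<nu>) x \<longrightarrow> ((\<lambda>t. cdf (\<mu> t) x) \<longlongrightarrow> cdf \<nu> x) at_top)"

end

theory Submission
  imports
    Defs
    "HOL-Library.More_List"
    "HOL-Computational_Algebra.Formal_Power_Series"
begin

text \<open>
  Why the theorem holds. Fix \<open>0 \<le> s \<le> t\<close> and put \<open>T = t - s\<close>.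
  Compare the queue with the infinite-server queue that has the same jobs, each of which starts
  service when it arrives. If at least \<open>n\<close> jobs are still present there at time
  \<open>T\<close>, select \<open>n\<close> of them uniformly at random and delete the other
  jobs that arrived up to time \<open>T\<close>. FCFS is monotone: letting jobs start earlier
  and deleting jobs can only make every later start earlier. Hence the real queue holds at time
  \<open>t\<close> at least \<open>n\<close> jobs plus the arrivals during \<open>(T, t]\<close>
  minus the departures during \<open>(T, t]\<close> from \<open>n\<close> servers that start at
  \<open>T\<close> with the selected jobs and never idle. It remains to see that given at least
  \<open>n\<close> jobs, an event of probability \<open>P(Z \<ge> n)\<close>, these departures
  are distributed as \<open>n\<close> independent equilibrium renewal processes, independent of
  the arrivals.

  \<^item> The deletion matters. The jobs present at \<open>T\<close> have independent residual
    times only when they are listed in an order that ignores their arrival times, whereas FCFS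
    serves them in order of arrival. Once only \<open>n\<close> jobs are kept, the order among
    them is irrelevant, and averaging over all \<open>n\<close>-sublists replaces the random
    selection: an event that follows from each single choice has probability at least the mean.
    The pathwise part is \<open>number_in_system_ge\<close> and
    \<open>run_arrivals_le_queue\<close>.

  \<^item> The infinite-server queue started from \<open>Z\<close> jobs with residual service
    times is stationary. A job is a point \<open>(c, w)\<close>, its arrival time and its
    service time. A Poisson number of initial jobs with residual lives is the set of points with
    \<open>c \<le> 0 < c + w\<close> of a Poisson process with intensity \<open>l dc
    \<sigma>(dw)\<close>; the later arrivals supply the points with \<open>0 < c\<close>. The
    jobs present at \<open>T\<close> are the points with \<open>c \<le> T < c + w\<close>, and
    translation invariance of Lebesgue measure does the rest
    (\<open>poisson_points_stationary\<close>). The Poisson process enters only through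
    expectations of symmetric functionals of the list of departure times, which are exponential
    series of iterated integrals; independence of disjoint regions is the binomial theorem
    (\<open>poisson_points_Un\<close>), and the passage from exponential gaps to unordered
    points is \<open>insert_points_time_ordered\<close>.

  \<^item> In the system whose \<open>n\<close> servers never idle, the next service time is
    given to whichever server is free first, while in \<open>n\<close> separate renewal
    processes each server has its own sequence. Conditioning on the next service time gives the
    same recursion for both, so the numbers of departures have the same law. Generating
    functions express this: the departures of the system are counted by the product of the
    generating functions of the servers (\<open>nn_integral_all_busy\<close>).

  The bound for \<open>Q(\<infinity>)\<close> follows by passing to the limit at a continuity
  point slightly above \<open>n + x\<close>, because the queue lengths and the renewal counts
  are integers.
\<close>


section \<open>FCFS service on a sample path\<close>

text \<open>The set of times in the definition of the start of service is upward closed and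
  contains its infimum, so the start of service is described by a Galois connection. All later
  arguments, including measurability, use only this description.\<close>

lemma service_start_le_iff:
  assumes "1 \<le> n"
  shows "service_start n a v j \<le> \<tau> \<longleftrightarrow>
    a j \<le> \<tau> \<and> card {i. i < j \<and> \<tau> < service_start n a v i + v i} < n"
proof -
  define D where "D i = service_start n a v i + v i" for i
  define X where "X = {t. a j \<le> t \<and> card {i. i < j \<and> t < D i} < n}"
  have start: "service_start n a v j = Inf X"
    unfolding X_def D_def by (subst service_start.simps) (rule refl)
  have bdd: "bdd_below X"
    by (rule bdd_belowI[of _ "a j"]) (simp add: X_def)
  have up: "t' \<in> X" if "t \<in> X" "t \<le> t'" for t t'
  proof -
    have "card {i. i < j \<and> t' < D i} \<le> card {i. i < j \<and> t < D i}"
      using that by (intro card_mono) auto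
    with that show ?thesis
      by (auto simp: X_def)
  qed
  have ne: "X \<noteq> {}"
  proof -
    define b where "b = Max (insert (a j) (D ` {..<j}))"
    have "D i \<le> b" if "i < j" for i
      using that by (auto simp: b_def intro!: Max_ge)
    then have "card {i. i < j \<and> b < D i} = 0"
      by (force simp: card_eq_0_iff)
    then have "card {i. i < j \<and> b < D i} < n"
      using assms by linarith
    moreover have "a j \<le> b"
      by (simp add: b_def)
    ultimately have "b \<in> X"
      unfolding X_def by blast
    then show ?thesis
      by blast
  qed
  \<comment> \<open>The departure times are right end points of half-open intervals, so the infimum is attained.\<close>
  have closed: "t \<in> X" if gt: "\<And>t'. t < t' \<Longrightarrow> t' \<in> X" for t
  proof -
    define b where "b = Min (insert (t + 1) (D ` {i. i < j \<and> t < D i}))"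
    have fin: "finite (insert (t + 1) (D ` {i. i < j \<and> t < D i}))"
      by simp
    have "t < b"
      unfolding b_def using fin by (subst Min_gr_iff) auto
    then obtain t' where t': "t < t'" "t' < b"
      using dense by blast
    have "b \<le> D i" if "i < j" "t < D i" for i
      unfolding b_def using that by (intro Min_le) auto
    then have "{i. i < j \<and> t < D i} \<subseteq> {i. i < j \<and> t' < D i}"
      using t' by force
    then have "card {i. i < j \<and> t < D i} \<le> card {i. i < j \<and> t' < D i}"
      by (intro card_mono) auto
    moreover have "a j \<le> t"
    proof (rule dense_ge)
      fix t' assume "t < t'"
      with gt show "a j \<le> t'"
        by (auto simp: X_def)
    qed
    ultimately show ?thesis
      using gt[OF t'(1)] by (auto simp: X_def)
  qed
  have "Inf X \<in> X"
  proof (rule closed)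
    fix t' assume "Inf X < t'"
    then obtain t where "t \<in> X" "t < t'"
      using cInf_less_iff[OF ne bdd] by blast
    then show "t' \<in> X"
      using up by (meson less_imp_le)
  qed
  then have "Inf X \<le> \<tau> \<longleftrightarrow> \<tau> \<in> X"
    using up cInf_lower[OF _ bdd] by blast
  then show ?thesis
    unfolding start by (simp add: X_def D_def)
qed

lemma arrival_le_service_start: "1 \<le> n \<Longrightarrow> a j \<le> service_start n a v j"
  using service_start_le_iff[of n a v j "service_start n a v j"] by simp

text \<open>The list holds the times at which the servers become free. All servers are kept busy,
  so the next job goes to the server that is free first (the recursion of Kiefer and
  Wolfowitz).\<close>

definition serve_next :: "real \<Rightarrow> real list \<Rightarrow> real list" where
  "serve_next w rs = (Min (set rs) + w) # remove1 (Min (set rs)) rs"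

text \<open>With service times \<open>w\<close>, the first \<open>d\<close> departures after the
  initial state \<open>rs\<close> lead to a state in which no server becomes free up to time
  \<open>t\<close>. For nonnegative \<open>w\<close> this says that at most \<open>d\<close>
  departures occur up to time \<open>t\<close>. Counting this way avoids the cardinality of a
  possibly infinite set of departures.\<close>

fun all_busy :: "real \<Rightarrow> nat \<Rightarrow> real list \<Rightarrow> (nat \<Rightarrow> real) \<Rightarrow> bool" where
  "all_busy t 0 rs w \<longleftrightarrow> (\<forall>r\<in>set rs. t < r)"
| "all_busy t (Suc d) rs w \<longleftrightarrow> all_busy t d (serve_next (w 0) rs) (\<lambda>i. w (Suc i))"

lemma length_serve_next: "rs \<noteq> [] \<Longrightarrow> length (serve_next w rs) = length rs"
  by (simp add: serve_next_def length_remove1 Suc_pred)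


lemma all_busy_Suc:
  assumes "\<And>i. 0 \<le> w i" "rs \<noteq> []" "all_busy t d rs w"
  shows "all_busy t (Suc d) rs w"
  using assms
proof (induction d arbitrary: rs w)
  case 0
  then have "t < Min (set rs)"
    by simp
  then have "t < Min (set rs) + w 0"
    using 0(1)[of 0] by linarith
  moreover have "\<forall>r\<in>set (remove1 (Min (set rs)) rs). t < r"
    using 0(3) set_remove1_subset[of "Min (set rs)" rs] by auto
  ultimately show ?case
    by (simp add: serve_next_def)
next
  case (Suc d)
  have "serve_next (w 0) rs \<noteq> []"
    by (simp add: serve_next_def)
  from Suc.IH[OF _ this, of "\<lambda>i. w (Suc i)"] Suc.prems show ?case
    by simp
qed

lemma all_busy_mono:
  assumes "\<And>i. 0 \<le> w i" "rs \<noteq> []" "all_busy t d rs w" "d \<le> e"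
  shows "all_busy t e rs w"
  using assms(4,3)
proof (induction rule: dec_induct)
  case (step e)
  show ?case
    by (rule all_busy_Suc[OF assms(1,2)]) (use step in simp)
qed simp

text \<open>The jobs in \<open>C\<close> are those ahead of job \<open>p\<close> that have been
  accounted for. The invariant \<open>ahead\<close> says that at every time at least as many of
  them are still in the system as there are saturated servers that are not yet free. As long as
  all \<open>n\<close> saturated servers are occupied, \<open>n\<close> jobs ahead of
  \<open>p\<close> are therefore present, so \<open>p\<close> cannot start before the first of the
  servers is free, and adding \<open>p\<close> to \<open>C\<close> preserves the
  invariant.\<close>

lemma service_start_after_saturated:
  fixes a v :: "nat \<Rightarrow> real" and C :: "nat set" and n :: nat
  defines "D \<equiv> \<lambda>i. service_start n a v i + v i"
  assumes n: "1 \<le> n" "length rs = n"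
    and C: "C \<subseteq> {..<p}"
    and ahead: "\<And>\<tau>. length (filter (\<lambda>r. \<tau> < r) rs) \<le> card {i\<in>C. \<tau> < D i}"
    and busy: "all_busy t d rs (\<lambda>i. v (p + i))"
  shows "t < service_start n a v (p + d)"
  using n(2) C ahead busy
proof (induction d arbitrary: rs C p)
  case 0
  have "n = length (filter (\<lambda>r. t < r) rs)"
    using 0 by (simp add: filter_True)
  also have "\<dots> \<le> card {i\<in>C. t < D i}"
    by (rule 0)
  also have "\<dots> \<le> card {i. i < p \<and> t < D i}"
    using 0 by (intro card_mono) auto
  finally have "\<not> service_start n a v p \<le> t"
    unfolding service_start_le_iff[OF n(1)] D_def by simp
  then show ?case
    by simp
next
  case (Suc d)
  define m where "m = Min (set rs)"
  have ne: "rs \<noteq> []"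
    using n Suc.prems(1) by auto
  have m_in: "m \<in> set rs"
    using ne by (simp add: m_def)
  have start: "m \<le> service_start n a v p"
  proof (rule ccontr)
    let ?\<tau> = "service_start n a v p"
    assume "\<not> m \<le> ?\<tau>"
    then have "\<forall>r\<in>set rs. ?\<tau> < r"
      using Min_le[of "set rs"] by (auto simp: m_def intro: order.strict_trans2[OF not_le_imp_less])
    then have "n = length (filter (\<lambda>r. ?\<tau> < r) rs)"
      using Suc.prems(1) by (simp add: filter_True)
    also have "\<dots> \<le> card {i\<in>C. ?\<tau> < D i}"
      by (rule Suc.prems)
    also have "\<dots> \<le> card {i. i < p \<and> ?\<tau> < D i}"
      using Suc.prems by (intro card_mono) auto
    finally have "\<not> service_start n a v p \<le> ?\<tau>"
      unfolding service_start_le_iff[OF n(1)] D_def by simp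
    then show False
      by simp
  qed
  have "t < service_start n a v (Suc p + d)"
  proof (rule Suc.IH)
    show "length (serve_next (v p) rs) = n"
      using length_serve_next[OF ne] Suc.prems by simp
    show "insert p C \<subseteq> {..<Suc p}"
      using Suc.prems by auto
    show "all_busy t d (serve_next (v p) rs) (\<lambda>i. v (Suc p + i))"
      using Suc.prems by simp
    fix \<tau>
    have fin: "finite C"
      using Suc.prems(2) finite_subset by blast
    have "length (filter (\<lambda>r. \<tau> < r) (serve_next (v p) rs)) =
        length (filter (\<lambda>r. \<tau> < r) (remove1 m rs)) + (if \<tau> < m + v p then 1 else 0)"
      by (simp add: serve_next_def m_def)
    also have "\<dots> \<le> length (filter (\<lambda>r. \<tau> < r) rs) + (if \<tau> < D p then 1 else 0)"
    proof (intro add_mono)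
      show "length (filter (\<lambda>r. \<tau> < r) (remove1 m rs)) \<le> length (filter (\<lambda>r. \<tau> < r) rs)"
        by (simp add: filter_remove1 length_remove1)
      show "(if \<tau> < m + v p then 1 else 0) \<le> (if \<tau> < D p then 1 else (0::nat))"
        using start by (simp add: D_def)
    qed
    also have "\<dots> \<le> card {i\<in>C. \<tau> < D i} + (if \<tau> < D p then 1 else 0)"
      using Suc.prems(3)[of \<tau>] by simp
    also have "\<dots> = card {i\<in>insert p C. \<tau> < D i}"
    proof -
      have "{i\<in>insert p C. \<tau> < D i} = (if \<tau> < D p then insert p {i\<in>C. \<tau> < D i} else {i\<in>C. \<tau> < D i})"
        by auto
      moreover have "p \<notin> C"
        using Suc.prems(2) by auto
      ultimately show ?thesis
        using fin by simp
    qed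
    finally show "length (filter (\<lambda>r. \<tau> < r) (serve_next (v p) rs)) \<le> card {i\<in>insert p C. \<tau> < D i}" .
  qed
  then show ?case
    by simp
qed

text \<open>The \<open>n\<close> jobs \<open>js\<close> play the initial jobs of the saturated
  system, with departure times as if they had started on arrival; the jobs from position
  \<open>p\<close> on are the later arrivals. Those of them from position \<open>p + d\<close> on
  start after \<open>t\<close>. The first of these has arrived and still waits, which is possible
  only if \<open>n\<close> jobs ahead of it are present.\<close>

lemma number_in_system_ge:
  fixes a v :: "nat \<Rightarrow> real"
  assumes n: "1 \<le> n"
    and mono: "\<And>i j. i \<le> j \<Longrightarrow> a i \<le> a j"
    and v: "\<And>i. 0 \<le> v (p + i)"
    and fin: "finite {j. a j \<le> t}"
    and js: "distinct js" "length js = n" "set js \<subseteq> {..<p}"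
    and busy: "all_busy t d (map (\<lambda>j. a j + v j) js) (\<lambda>i. v (p + i))"
    and arrivals: "\<And>i. i < d + e \<Longrightarrow> a (p + i) \<le> t" and e: "0 < e"
  shows "n + e \<le> number_in_system n a v t"
proof -
  define D where "D i = service_start n a v i + v i" for i
  let ?rs = "map (\<lambda>j. a j + v j) js"
  have ahead: "length (filter (\<lambda>r. \<tau> < r) ?rs) \<le> card {i\<in>set js. \<tau> < D i}" for \<tau>
  proof -
    have "length (filter (\<lambda>r. \<tau> < r) ?rs) = card {j\<in>set js. \<tau> < a j + v j}"
      using js(1) by (simp add: filter_map comp_def distinct_card[symmetric] flip: set_filter)
    also have "\<dots> \<le> card {i\<in>set js. \<tau> < D i}"
    proof (intro card_mono)
      have "a j + v j \<le> D j" for j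
        using arrival_le_service_start[OF n, of a j v] by (simp add: D_def)
      then show "{j\<in>set js. \<tau> < a j + v j} \<subseteq> {i\<in>set js. \<tau> < D i}"
        using order.strict_trans2 by fast
    qed simp
    finally show ?thesis .
  qed
  have start: "t < service_start n a v (p + i)" if "d \<le> i" for i
  proof (rule service_start_after_saturated)
    show "all_busy t i ?rs (\<lambda>i. v (p + i))"
      by (rule all_busy_mono[OF v _ busy that]) (use js(2) n in auto)
  qed (use n js ahead in \<open>auto simp: D_def\<close>)
  let ?B = "{i. i < p + d \<and> t < D i}"
  have "\<not> service_start n a v (p + d) \<le> t"
    using start[of d] by simp
  then have B: "n \<le> card ?B"
    using arrivals[of d] e unfolding service_start_le_iff[OF n] D_def by simp
  have "n + e \<le> card ?B + card {p + d..<p + d + e}"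
    using B by simp
  also have "\<dots> = card (?B \<union> {p + d..<p + d + e})"
    by (intro card_Un_disjoint[symmetric]) auto
  also have "\<dots> \<le> number_in_system n a v t"
    unfolding number_in_system_def
  proof (intro card_mono)
    show "finite {j. a j \<le> t \<and> t < service_start n a v j + v j}"
      using fin by (rule rev_finite_subset) auto
    have "a i \<le> t" if "i < p + d" for i
      using mono[of i "p + d"] arrivals[of d] e that by simp
    moreover have "a i \<le> t \<and> t < D i" if "p + d \<le> i" "i < p + d + e" for i
    proof -
      have "d \<le> i - p" "i - p < d + e" "p + (i - p) = i"
        using that by auto
      then have "t < service_start n a v i" "a i \<le> t" "0 \<le> v i"
        using start[of "i - p"] arrivals[of "i - p"] v[of "i - p"] by auto
      then show ?thesis
        by (simp add: D_def)
    qed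
    ultimately show "?B \<union> {p + d..<p + d + e} \<subseteq> {j. a j \<le> t \<and> t < service_start n a v j + v j}"
      by (auto simp: D_def)
  qed
  finally show ?thesis .
qed

lemma measurable_service_start:
  assumes n: "1 \<le> n"
    and a: "\<And>j. (\<lambda>\<omega>. a \<omega> j) \<in> borel_measurable M" and v: "\<And>j. (\<lambda>\<omega>. v \<omega> j) \<in> borel_measurable M"
  shows "(\<lambda>\<omega>. service_start n (a \<omega>) (v \<omega>) j) \<in> borel_measurable M"
proof (induction j rule: less_induct)
  case (less j)
  have pred: "{\<omega> \<in> space M. i \<in> {i. i < j \<and> \<tau> < service_start n (a \<omega>) (v \<omega>) i + v \<omega> i}} \<in> sets M"
    for \<tau> i
  proof (cases "i < j")
    case True
    note less[OF True, measurable] v[measurable]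
    have "{\<omega> \<in> space M. \<tau> < service_start n (a \<omega>) (v \<omega>) i + v \<omega> i} \<in> sets M"
      by simp
    then show ?thesis
      using True by simp
  qed simp
  have "{\<omega> \<in> space M. service_start n (a \<omega>) (v \<omega>) j \<le> \<tau>} \<in> sets M" for \<tau>
  proof -
    let ?c = "\<lambda>\<omega>. card {i. i < j \<and> \<tau> < service_start n (a \<omega>) (v \<omega>) i + v \<omega> i}"
    have "?c \<in> measurable M (count_space UNIV)"
      by (rule measurable_card[OF pred])
    then have "?c -` {..<n} \<inter> space M \<in> sets M"
      by (rule measurable_sets) simp
    moreover have "(\<lambda>\<omega>. a \<omega> j) -` {..\<tau>} \<inter> space M \<in> sets M"
      by (rule measurable_sets[OF a]) simp
    ultimately have "(?c -` {..<n} \<inter> space M) \<inter> ((\<lambda>\<omega>. a \<omega> j) -` {..\<tau>} \<inter> space M) \<in> sets M"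
      by (rule sets.Int)
    also have "(?c -` {..<n} \<inter> space M) \<inter> ((\<lambda>\<omega>. a \<omega> j) -` {..\<tau>} \<inter> space M) =
        {\<omega> \<in> space M. service_start n (a \<omega>) (v \<omega>) j \<le> \<tau>}"
      by (subst service_start_le_iff[OF n]) auto
    finally show ?thesis .
  qed
  then show ?case
    unfolding borel_measurable_iff_le by blast
qed

lemma measurable_queue_number:
  assumes n: "1 \<le> n"
    and Z: "Z \<in> measurable M (count_space UNIV)" and L: "L \<in> measurable M (count_space UNIV)"
    and [measurable]: "\<And>k. U k \<in> borel_measurable M" "\<And>k. V k \<in> borel_measurable M"
      "\<And>k. W k \<in> borel_measurable M"
  shows "queue_number n Z L U V W t \<in> measurable M (count_space UNIV)"
proof -
  have "(\<lambda>\<omega>. number_in_system n (job_arrival z (\<lambda>k. U k \<omega>))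
      (job_processing z l (\<lambda>k. V k \<omega>) (\<lambda>k. W k \<omega>)) t) \<in> measurable M (count_space UNIV)" for z l
  proof -
    have a[measurable]: "(\<lambda>\<omega>. job_arrival z (\<lambda>k. U k \<omega>) j) \<in> borel_measurable M" for j
      unfolding job_arrival_def by measurable
    have v[measurable]: "(\<lambda>\<omega>. job_processing z l (\<lambda>k. V k \<omega>) (\<lambda>k. W k \<omega>) j) \<in> borel_measurable M" for j
      unfolding job_processing_def by measurable
    note measurable_service_start[OF n a v, measurable]
    show ?thesis
      unfolding number_in_system_def by measurable
  qed
  then have "(\<lambda>\<omega>. number_in_system n (job_arrival (Z \<omega>) (\<lambda>k. U k \<omega>))
      (job_processing (Z \<omega>) l (\<lambda>k. V k \<omega>) (\<lambda>k. W k \<omega>)) t) \<in> measurable M (count_space UNIV)" for l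
    by (rule measurable_compose_countable) fact
  then show ?thesis
    unfolding queue_number_def[abs_def] by (rule measurable_compose_countable) fact
qed

section \<open>Functionals of finite lists of reals\<close>

text \<open>The \<open>\<sigma>\<close>-algebra of finite lists: a list is coded by its length and
  its entries, padded with \<open>0\<close>.\<close>

definition list_space :: "real list measure" where
  "list_space = vimage_algebra UNIV (\<lambda>xs. (length xs, nth_default 0 xs))
     (count_space UNIV \<Otimes>\<^sub>M PiM UNIV (\<lambda>_. borel))"

lemma space_list_space [simp]: "space list_space = UNIV"
  by (simp add: list_space_def)

lemma measurable_list_encoding:
  "(\<lambda>xs. (length xs, nth_default 0 xs)) \<in> list_space \<rightarrow>\<^sub>M count_space UNIV \<Otimes>\<^sub>M PiM UNIV (\<lambda>_. borel)"
  unfolding list_space_def by (rule measurable_vimage_algebra1) (auto simp: space_pair_measure space_PiM)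

lemma measurable_length_list_space [measurable]: "length \<in> list_space \<rightarrow>\<^sub>M count_space UNIV"
  using measurable_compose[OF measurable_list_encoding measurable_fst] by simp

lemma measurable_nth_list_space:
  "(\<lambda>xs. nth_default 0 xs i) \<in> borel_measurable list_space"
  using measurable_compose[OF measurable_compose[OF measurable_list_encoding measurable_snd]
    measurable_component_singleton[of i]] by simp

lemma measurable_Cons_list_space [measurable (raw)]:
  assumes [measurable]: "f \<in> borel_measurable M" and g: "g \<in> M \<rightarrow>\<^sub>M list_space"
  shows "(\<lambda>\<omega>. f \<omega> # g \<omega>) \<in> M \<rightarrow>\<^sub>M list_space"
  unfolding list_space_def
proof (rule measurable_vimage_algebra2)
  note [measurable] = measurable_compose[OF g measurable_length_list_space]
    measurable_compose[OF g measurable_nth_list_space]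
  have "(\<lambda>\<omega>. (Suc (length (g \<omega>)), \<lambda>i. case i of 0 \<Rightarrow> f \<omega> | Suc j \<Rightarrow> nth_default 0 (g \<omega>) j))
      \<in> M \<rightarrow>\<^sub>M count_space UNIV \<Otimes>\<^sub>M PiM UNIV (\<lambda>_. borel)"
  proof (intro measurable_Pair measurable_PiM_single')
    show "(\<lambda>\<omega>. case i of 0 \<Rightarrow> f \<omega> | Suc j \<Rightarrow> nth_default 0 (g \<omega>) j) \<in> borel_measurable M" for i
      by (cases i) simp_all
  qed (use g in simp_all)
  moreover have "(length (f \<omega> # g \<omega>), nth_default 0 (f \<omega> # g \<omega>)) =
      (Suc (length (g \<omega>)), \<lambda>i. case i of 0 \<Rightarrow> f \<omega> | Suc j \<Rightarrow> nth_default 0 (g \<omega>) j)" for \<omega>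
    by (auto simp: nth_default_Cons fun_eq_iff split: nat.split)
  ultimately show "(\<lambda>\<omega>. (length (f \<omega> # g \<omega>), nth_default 0 (f \<omega> # g \<omega>)))
      \<in> M \<rightarrow>\<^sub>M count_space UNIV \<Otimes>\<^sub>M PiM UNIV (\<lambda>_. borel)"
    by simp
qed auto

lemma measurable_map_list_space [measurable (raw)]:
  assumes "\<And>i. (\<lambda>\<omega>. f \<omega> i) \<in> borel_measurable M"
  shows "(\<lambda>\<omega>. map (f \<omega>) js) \<in> M \<rightarrow>\<^sub>M list_space"
proof (induction js)
  case (Cons j js)
  note assms[of j, measurable] Cons[measurable]
  show ?case
    unfolding list.map by (rule measurable_Cons_list_space) fact+
qed simp

text \<open>There are only countably many lengths, and a list of length \<open>k\<close> is a
  vector in disguise. So measurability may be checked with the entries of the list as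
  \<open>k\<close> real random variables, where functions defined by recursion on lists are
  handled by induction on the list of indices.\<close>

lemma measurable_list_space_cases:
  assumes xs: "xs \<in> M \<rightarrow>\<^sub>M list_space"
    and f: "\<And>x k. (\<And>i. (\<lambda>\<omega>. x \<omega> i) \<in> borel_measurable M) \<Longrightarrow> (\<lambda>\<omega>. f \<omega> (map (x \<omega>) [0..<k])) \<in> M \<rightarrow>\<^sub>M N"
  shows "(\<lambda>\<omega>. f \<omega> (xs \<omega>)) \<in> M \<rightarrow>\<^sub>M N"
proof -
  have "(\<lambda>\<omega>. f \<omega> (map (nth_default 0 (xs \<omega>)) [0..<k])) \<in> M \<rightarrow>\<^sub>M N" for k
    by (rule f) (rule measurable_compose[OF xs measurable_nth_list_space])
  then have "(\<lambda>\<omega>. f \<omega> (map (nth_default 0 (xs \<omega>)) [0..<length (xs \<omega>)])) \<in> M \<rightarrow>\<^sub>M N"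
    by (rule measurable_compose_countable) (rule measurable_compose[OF xs measurable_length_list_space])
  moreover have "map (nth_default 0 ys) [0..<length ys] = ys" for ys :: "real list"
    by (rule nth_equalityI) (simp_all add: nth_default_nth)
  ultimately show ?thesis
    by simp
qed

lemma measurable_map_shift_list_space [measurable (raw)]:
  assumes xs: "xs \<in> M \<rightarrow>\<^sub>M list_space"
  shows "(\<lambda>\<omega>. map (\<lambda>x. x + c) (xs \<omega>)) \<in> M \<rightarrow>\<^sub>M list_space"
proof (rule measurable_list_space_cases[OF xs])
  fix x :: "_ \<Rightarrow> nat \<Rightarrow> real" and k assume [measurable]: "\<And>i. (\<lambda>\<omega>. x \<omega> i) \<in> borel_measurable M"
  show "(\<lambda>\<omega>. map (\<lambda>x. x + c) (map (x \<omega>) [0..<k])) \<in> M \<rightarrow>\<^sub>M list_space"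
    unfolding map_map comp_def by (rule measurable_map_list_space) measurable
qed

lemma measurable_filter_list_space [measurable (raw)]:
  assumes xs: "xs \<in> M \<rightarrow>\<^sub>M list_space"
  shows "(\<lambda>\<omega>. filter (\<lambda>x. c < x) (xs \<omega>)) \<in> M \<rightarrow>\<^sub>M list_space"
proof (rule measurable_list_space_cases[OF xs])
  fix x :: "_ \<Rightarrow> nat \<Rightarrow> real" and k assume [measurable]: "\<And>i. (\<lambda>\<omega>. x \<omega> i) \<in> borel_measurable M"
  have "(\<lambda>\<omega>. filter (\<lambda>x. c < x) (map (x \<omega>) js)) \<in> M \<rightarrow>\<^sub>M list_space" for js
    by (induction js) auto
  then show "(\<lambda>\<omega>. filter (\<lambda>x. c < x) (map (x \<omega>) [0..<k])) \<in> M \<rightarrow>\<^sub>M list_space" .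
qed

lemma measurable_remove1_list_space [measurable (raw)]:
  assumes [measurable]: "a \<in> borel_measurable M" and xs: "xs \<in> M \<rightarrow>\<^sub>M list_space"
  shows "(\<lambda>\<omega>. remove1 (a \<omega>) (xs \<omega>)) \<in> M \<rightarrow>\<^sub>M list_space"
proof (rule measurable_list_space_cases[OF xs])
  fix x :: "_ \<Rightarrow> nat \<Rightarrow> real" and k assume [measurable]: "\<And>i. (\<lambda>\<omega>. x \<omega> i) \<in> borel_measurable M"
  have "(\<lambda>\<omega>. remove1 (a \<omega>) (map (x \<omega>) js)) \<in> M \<rightarrow>\<^sub>M list_space" for js
    by (induction js) auto
  then show "(\<lambda>\<omega>. remove1 (a \<omega>) (map (x \<omega>) [0..<k])) \<in> M \<rightarrow>\<^sub>M list_space" .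
qed

lemma measurable_Min_list_space [measurable (raw)]:
  assumes xs: "xs \<in> M \<rightarrow>\<^sub>M list_space"
  shows "(\<lambda>\<omega>. Min (set (xs \<omega>))) \<in> borel_measurable M"
proof (rule measurable_list_space_cases[OF xs])
  fix x :: "_ \<Rightarrow> nat \<Rightarrow> real" and k assume [measurable]: "\<And>i. (\<lambda>\<omega>. x \<omega> i) \<in> borel_measurable M"
  show "(\<lambda>\<omega>. Min (set (map (x \<omega>) [0..<k]))) \<in> borel_measurable M"
    unfolding set_map by (rule borel_measurable_Min) simp_all
qed

lemma measurable_Ball_list_space [measurable (raw)]:
  assumes xs: "xs \<in> M \<rightarrow>\<^sub>M list_space"
  shows "Measurable.pred M (\<lambda>\<omega>. \<forall>r\<in>set (xs \<omega>). t < (r::real))"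
proof (rule measurable_list_space_cases[OF xs])
  fix x :: "_ \<Rightarrow> nat \<Rightarrow> real" and k assume [measurable]: "\<And>i. (\<lambda>\<omega>. x \<omega> i) \<in> borel_measurable M"
  have "(\<forall>r\<in>set (map (x \<omega>) [0..<k]). t < r) \<longleftrightarrow> (\<forall>i\<in>{0..<k}. t < x \<omega> i)" for \<omega>
    by auto
  then show "Measurable.pred M (\<lambda>\<omega>. \<forall>r\<in>set (map (x \<omega>) [0..<k]). t < r)"
    by simp
qed

lemma measurable_serve_next [measurable (raw)]:
  assumes [measurable]: "w \<in> borel_measurable M" "rs \<in> M \<rightarrow>\<^sub>M list_space"
  shows "(\<lambda>\<omega>. serve_next (w \<omega>) (rs \<omega>)) \<in> M \<rightarrow>\<^sub>M list_space"
  unfolding serve_next_def by measurable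

lemma measurable_all_busy [measurable (raw)]:
  assumes "rs \<in> M \<rightarrow>\<^sub>M list_space" "\<And>i. (\<lambda>\<omega>. w \<omega> i) \<in> borel_measurable M"
  shows "Measurable.pred M (\<lambda>\<omega>. all_busy t d (rs \<omega>) (w \<omega>))"
  using assms
proof (induction d arbitrary: rs w)
  case (Suc d)
  show ?case
    unfolding all_busy.simps
    by (rule Suc.IH) (use Suc.prems measurable_serve_next in auto)
qed (simp add: measurable_Ball_list_space)

subsection \<open>Means over sublists\<close>

definition sublists :: "nat \<Rightarrow> 'a list \<Rightarrow> 'a list list" where
  "sublists m xs = filter (\<lambda>ys. length ys = m) (List.subseqs xs)"

definition sum_sublists :: "nat \<Rightarrow> ('a list \<Rightarrow> ennreal) \<Rightarrow> 'a list \<Rightarrow> ennreal" where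
  "sum_sublists m g xs = sum_list (map g (sublists m xs))"

text \<open>This is the expectation of \<open>g\<close> at \<open>m\<close> entries selected
  uniformly at random. Lists with fewer than \<open>m\<close> entries get the value \<open>0 / 0 =
  0\<close>.\<close>

definition mean_sublists :: "nat \<Rightarrow> ('a list \<Rightarrow> ennreal) \<Rightarrow> 'a list \<Rightarrow> ennreal" where
  "mean_sublists m g xs = sum_sublists m g xs / of_nat (length xs choose m)"

lemma sublists_Nil [simp]: "sublists m [] = (if m = 0 then [[]] else [])"
  by (simp add: sublists_def)

lemma sublists_Cons_0: "sublists 0 (x # xs) = sublists 0 xs"
  by (simp add: sublists_def Let_def filter_map comp_def)

lemma sublists_Cons_Suc: "sublists (Suc m) (x # xs) = map (Cons x) (sublists m xs) @ sublists (Suc m) xs"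
  by (simp add: sublists_def Let_def filter_map comp_def)

lemma sublists_0 [simp]: "sublists 0 xs = [[]]"
  by (induction xs) (simp_all add: sublists_Cons_0)

lemma sublists_map: "sublists m (map f xs) = map (map f) (sublists m xs)"
proof (induction xs arbitrary: m)
  case (Cons x xs)
  then show ?case
    by (cases m) (simp_all add: sublists_Cons_Suc)
qed simp

lemma length_sublists: "length (sublists m xs) = length xs choose m"
proof (induction xs arbitrary: m)
  case (Cons x xs)
  then show ?case
    by (cases m) (simp_all add: sublists_Cons_Suc)
qed simp

lemma sublistsD:
  assumes "ys \<in> set (sublists m xs)"
  shows "length ys = m" "set ys \<subseteq> set xs" "distinct xs \<Longrightarrow> distinct ys"
  using assms subseqs_powset[of xs] subseqs_distinctD by (auto simp: sublists_def)

lemma sublists_filter: "set (sublists m (filter P xs)) \<subseteq> set (sublists m xs)"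
proof (induction xs arbitrary: m)
  case (Cons x xs)
  then show ?case
    by (cases m) (auto simp: sublists_Cons_Suc)
qed simp

lemma sum_sublists_Cons_Suc:
  "sum_sublists (Suc m) g (x # xs) = sum_sublists m (\<lambda>ys. g (x # ys)) xs + sum_sublists (Suc m) g xs"
  by (simp add: sum_sublists_def sublists_Cons_Suc comp_def)

lemma sum_sublists_0 [simp]: "sum_sublists 0 g xs = g []"
  by (simp add: sum_sublists_def)

text \<open>Invariance under all permutations, in the form of invariance under adjacent
  transpositions.\<close>

definition symmetric :: "('a list \<Rightarrow> 'b) \<Rightarrow> bool" where
  "symmetric \<Phi> \<longleftrightarrow> (\<forall>zs x y xs. \<Phi> (zs @ x # y # xs) = \<Phi> (zs @ y # x # xs))"

lemma symmetricD: "symmetric \<Phi> \<Longrightarrow> \<Phi> (zs @ x # y # xs) = \<Phi> (zs @ y # x # xs)"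
  by (simp add: symmetric_def)

lemma symmetricD0: "symmetric \<Phi> \<Longrightarrow> \<Phi> (x # y # xs) = \<Phi> (y # x # xs)"
  using symmetricD[of \<Phi> "[]"] by simp

lemma symmetric_Cons: "symmetric \<Phi> \<Longrightarrow> symmetric (\<lambda>xs. \<Phi> (z # xs))"
  unfolding symmetric_def by (metis append_Cons)

lemma symmetric_filter: "symmetric \<Phi> \<Longrightarrow> symmetric (\<lambda>xs. \<Phi> (filter P xs))"
  unfolding symmetric_def by simp

lemma symmetric_mset: "symmetric (\<lambda>xs. f (mset xs))"
  by (simp add: symmetric_def add_mset_commute)

lemma sum_sublists_swap:
  assumes "symmetric g"
  shows "sum_sublists m g (zs @ x # y # xs) = sum_sublists m g (zs @ y # x # xs)"
  using assms
proof (induction zs arbitrary: m g)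
  case Nil
  show ?case
  proof (cases m)
    case (Suc k)
    then show ?thesis
      by (cases k) (simp_all add: sum_sublists_Cons_Suc symmetricD0[OF Nil] ac_simps)
  qed simp
next
  case (Cons z zs)
  then show ?case
    by (cases m) (simp_all add: sum_sublists_Cons_Suc symmetric_Cons)
qed

lemma symmetric_mean_sublists: "symmetric g \<Longrightarrow> symmetric (mean_sublists m g)"
  unfolding mean_sublists_def by (auto simp: symmetric_def intro!: sum_sublists_swap[unfolded symmetric_def] arg_cong2[where f="(/)"])

lemma mean_sublists_le_1:
  assumes "\<And>ys. g ys \<le> 1"
  shows "mean_sublists m g xs \<le> 1"
proof -
  have "sum_list (map g yss) \<le> of_nat (length yss)" for yss
    using assms by (induction yss) (auto intro: add_mono)
  then have le: "sum_sublists m g xs \<le> of_nat (length xs choose m)"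
    by (simp add: sum_sublists_def flip: length_sublists)
  show ?thesis
  proof (cases "length xs choose m = 0")
    case True
    then have "sum_sublists m g xs = 0"
      using le by (metis le_zero_eq of_nat_0)
    then show ?thesis
      by (simp add: mean_sublists_def)
  next
    case False
    then show ?thesis
      using le unfolding mean_sublists_def
      by (intro divide_le_posI_ennreal) (auto simp: of_nat_less_0_iff)
  qed
qed

lemma mean_sublists_nonzeroD:
  assumes "mean_sublists m g xs \<noteq> 0"
  obtains ys where "ys \<in> set (sublists m xs)" "g ys \<noteq> 0"
proof -
  have "sum_list (map g (sublists m xs)) \<noteq> 0"
    using assms by (auto simp: mean_sublists_def sum_sublists_def)
  then have "\<exists>ys\<in>set (sublists m xs). g ys \<noteq> 0"
    by (auto simp: sum_list_nonneg_eq_0_iff)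
  with that show ?thesis
    by blast
qed

lemma mean_sublists_const:
  assumes "\<And>ys. ys \<in> set (sublists m xs) \<Longrightarrow> g ys = c"
  shows "mean_sublists m g xs = (if m \<le> length xs then c else 0)"
proof -
  have "sum_sublists m g xs = of_nat (length (sublists m xs)) * c"
    using assms unfolding sum_sublists_def
    by (induction "sublists m xs") (auto simp: sum_list_triv cong: map_cong)
  then show ?thesis
    by (auto simp: mean_sublists_def length_sublists ennreal_mult_divide_eq binomial_eq_0_iff mult.commute[of _ c])
qed

lemma mean_sublists_cong:
  "(\<And>ys. ys \<in> set (sublists m xs) \<Longrightarrow> g ys = h ys) \<Longrightarrow> mean_sublists m g xs = mean_sublists m h xs"
  unfolding mean_sublists_def sum_sublists_def by (metis (no_types, lifting) map_eq_conv)

lemma mean_sublists_map: "mean_sublists m g (map f js) = mean_sublists m (\<lambda>ks. g (map f ks)) js"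
  by (simp add: mean_sublists_def sum_sublists_def sublists_map comp_def)

lemma nn_integral_mean_sublists:
  assumes "\<And>ys. ys \<in> set (sublists m xs) \<Longrightarrow> (\<lambda>\<omega>. g \<omega> ys) \<in> borel_measurable M"
  shows "(\<integral>\<^sup>+\<omega>. mean_sublists m (g \<omega>) xs \<partial>M) = mean_sublists m (\<lambda>ys. \<integral>\<^sup>+\<omega>. g \<omega> ys \<partial>M) xs"
proof -
  have "(\<lambda>\<omega>. sum_list (map (g \<omega>) yss)) \<in> borel_measurable M \<and>
      (\<integral>\<^sup>+\<omega>. sum_list (map (g \<omega>) yss) \<partial>M) = sum_list (map (\<lambda>ys. \<integral>\<^sup>+\<omega>. g \<omega> ys \<partial>M) yss)"
    if "set yss \<subseteq> set (sublists m xs)" for yss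
    using that
  proof (induction yss)
    case (Cons ys yss)
    have [measurable]: "(\<lambda>\<omega>. g \<omega> ys) \<in> borel_measurable M"
        "(\<lambda>\<omega>. sum_list (map (g \<omega>) yss)) \<in> borel_measurable M"
      using Cons assms by auto
    from Cons show ?case
      by (simp add: nn_integral_add)
  qed simp
  then show ?thesis
    unfolding mean_sublists_def sum_sublists_def by (simp add: nn_integral_divide)
qed

lemma measurable_mean_sublists [measurable (raw)]:
  assumes xs: "xs \<in> M \<rightarrow>\<^sub>M list_space"
    and g: "\<And>ys. ys \<in> M \<rightarrow>\<^sub>M list_space \<Longrightarrow> (\<lambda>\<omega>. g \<omega> (ys \<omega>)) \<in> borel_measurable M"
  shows "(\<lambda>\<omega>. mean_sublists m (g \<omega>) (xs \<omega>)) \<in> borel_measurable M"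
proof (rule measurable_list_space_cases[OF xs])
  fix x :: "_ \<Rightarrow> nat \<Rightarrow> real" and k assume [measurable]: "\<And>i. (\<lambda>\<omega>. x \<omega> i) \<in> borel_measurable M"
  have [measurable]: "(\<lambda>\<omega>. g \<omega> (map (x \<omega>) js)) \<in> borel_measurable M" for js
    by (rule g) measurable
  have "(\<lambda>\<omega>. sum_list (map (\<lambda>js. g \<omega> (map (x \<omega>) js)) jss)) \<in> borel_measurable M" for jss
    by (induction jss) auto
  then show "(\<lambda>\<omega>. mean_sublists m (g \<omega>) (map (x \<omega>) [0..<k])) \<in> borel_measurable M"
    unfolding mean_sublists_def sum_sublists_def sublists_map map_map comp_def length_map by measurable
qed

section \<open>Poisson collections of jobs\<close>

lemma suminf_ennreal_swap:
  fixes f :: "nat \<Rightarrow> nat \<Rightarrow> ennreal"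
  shows "(\<Sum>i. \<Sum>j. f i j) = (\<Sum>j. \<Sum>i. f i j)"
proof -
  have "(\<Sum>j. \<Sum>i. f i j) = (\<Sum>j. \<integral>\<^sup>+i. f i j \<partial>count_space UNIV)"
    by (simp add: nn_integral_count_space_nat)
  also have "\<dots> = (\<integral>\<^sup>+i. (\<Sum>j. f i j) \<partial>count_space UNIV)"
    by (rule nn_integral_suminf[symmetric]) simp
  finally show ?thesis
    by (simp add: nn_integral_count_space_nat)
qed

lemma suminf_ennreal_diagonal:
  fixes f :: "nat \<Rightarrow> nat \<Rightarrow> ennreal"
  shows "(\<Sum>m. \<Sum>j\<le>m. f j (m - j)) = (\<Sum>j. \<Sum>i. f j i)"
proof -
  have "(\<Sum>m. \<Sum>j\<le>m. f j (m - j)) = (\<Sum>m. \<Sum>j. if j \<le> m then f j (m - j) else 0)"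
    by (intro suminf_cong) (subst suminf_finite[where N="{..m}" for m], auto)
  also have "\<dots> = (\<Sum>j. \<Sum>m. if j \<le> m then f j (m - j) else 0)"
    by (rule suminf_ennreal_swap)
  also have "\<dots> = (\<Sum>j. \<Sum>i. f j i)"
  proof (rule suminf_cong)
    fix j
    have "(\<Sum>m. if j \<le> m then f j (m - j) else 0) =
        (\<Sum>i. if j \<le> i + j then f j (i + j - j) else 0) + (\<Sum>m<j. if j \<le> m then f j (m - j) else 0)"
      by (rule suminf_offset) simp
    then show "(\<Sum>m. if j \<le> m then f j (m - j) else 0) = (\<Sum>i. f j i)"
      by simp
  qed
  finally show ?thesis .
qed

lemma measurable_moving_interval [measurable (raw)]:
  fixes f g :: "'a \<Rightarrow> real"
  assumes [measurable]: "f \<in> borel_measurable M" "g \<in> borel_measurable M"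
  shows "Measurable.pred M (\<lambda>z. f z \<in> {g z<..T})" "Measurable.pred M (\<lambda>z. f z \<in> {g z..T})"
    "Measurable.pred M (\<lambda>z. f z \<in> {g z<..})"
  unfolding greaterThanAtMost_iff atLeastAtMost_iff greaterThan_iff by measurable

text \<open>\<open>\<sigma>\<close> is the law of the service times. A job is the pair of its
  arrival time and its service time, so a job \<open>p\<close> that is served on arrival departs
  at \<open>fst p + snd p\<close>.\<close>

locale service_law = prob_space \<sigma> for \<sigma> :: "real measure" +
  assumes sets_law [measurable_cong, simp]: "sets \<sigma> = sets borel"
begin

definition jobs :: "(real \<times> real) measure" where
  "jobs = lborel \<Otimes>\<^sub>M \<sigma>"

lemma sets_jobs [measurable_cong, simp]: "sets jobs = sets (borel \<Otimes>\<^sub>M borel)"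
  unfolding jobs_def by (rule sets_pair_measure_cong) simp_all

lemma space_jobs [simp]: "space jobs = UNIV"
  using sets_eq_imp_space_eq[OF sets_jobs] by (simp add: space_pair_measure)

sublocale jobs: sigma_finite_measure jobs
  unfolding jobs_def using sigma_finite_measure_axioms
  by (intro sigma_finite_pair_measure) (simp_all add: sigma_finite_lborel)

lemma nn_integral_jobs:
  assumes [measurable]: "f \<in> borel_measurable (borel \<Otimes>\<^sub>M borel)"
  shows "(\<integral>\<^sup>+p. f p \<partial>jobs) = (\<integral>\<^sup>+c. \<integral>\<^sup>+w. f (c, w) \<partial>\<sigma> \<partial>lborel)"
  unfolding jobs_def by (rule nn_integral_fst[symmetric]) measurable

text \<open>The departure times of \<open>k\<close> further jobs, integrated over the region
  \<open>D\<close>, are put in front of \<open>xs\<close>. For symmetric \<open>\<Phi>\<close>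
  this is \<open>k!\<close> times the contribution of configurations of \<open>k\<close> points in
  \<open>D\<close> to the expectation of \<open>\<Phi>\<close> under a Poisson process, up to the
  intensity and the normalising factor. Iterated integrals in this form make an induction on
  \<open>k\<close> with arbitrary \<open>xs\<close> possible, without product measures.\<close>

primrec insert_points :: "(real \<times> real) set \<Rightarrow> nat \<Rightarrow> (real list \<Rightarrow> ennreal) \<Rightarrow> real list \<Rightarrow> ennreal" where
  "insert_points D 0 \<Phi> xs = \<Phi> xs"
| "insert_points D (Suc k) \<Phi> xs =
    (\<integral>\<^sup>+p. indicator D p * insert_points D k \<Phi> ((fst p + snd p) # xs) \<partial>jobs)"

lemma measurable_insert_points_param:
  assumes [measurable]: "\<Phi> \<in> borel_measurable list_space"
    and D: "Measurable.pred (borel \<Otimes>\<^sub>M jobs) (\<lambda>(\<tau>::real, p). p \<in> D \<tau>)"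
  shows "(\<lambda>(\<tau>, xs). insert_points (D \<tau>) k \<Phi> xs) \<in> borel_measurable (borel \<Otimes>\<^sub>M list_space)"
proof (induction k)
  case (Suc k)
  note [measurable] = Suc
  have [measurable]: "(\<lambda>z. indicator (D (fst (fst z))) (snd z) :: ennreal) \<in> borel_measurable ((borel \<Otimes>\<^sub>M list_space) \<Otimes>\<^sub>M jobs)"
  proof -
    have [measurable]: "Measurable.pred ((borel \<Otimes>\<^sub>M list_space) \<Otimes>\<^sub>M jobs) (\<lambda>z. snd z \<in> D (fst (fst z)))"
      using measurable_compose[OF _ D, of "\<lambda>z. (fst (fst z), snd z)" "(borel \<Otimes>\<^sub>M list_space) \<Otimes>\<^sub>M jobs"] by simp
    have "(\<lambda>z. if snd z \<in> D (fst (fst z)) then 1 else 0 :: ennreal) \<in> borel_measurable ((borel \<Otimes>\<^sub>M list_space) \<Otimes>\<^sub>M jobs)"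
      by measurable
    then show ?thesis
      by (simp add: indicator_def of_bool_def)
  qed
  have "(\<lambda>z. insert_points (D (fst (fst z))) k \<Phi> ((fst (snd z) + snd (snd z)) # snd (fst z)))
      \<in> borel_measurable ((borel \<Otimes>\<^sub>M list_space) \<Otimes>\<^sub>M jobs)"
    using measurable_compose[OF _ Suc, of "\<lambda>z. (fst (fst z), (fst (snd z) + snd (snd z)) # snd (fst z))"
      "(borel \<Otimes>\<^sub>M list_space) \<Otimes>\<^sub>M jobs"] by simp
  then show ?case
    unfolding insert_points.simps case_prod_beta
    by (intro jobs.borel_measurable_nn_integral) (simp add: case_prod_beta)
qed simp

lemma measurable_insert_points [measurable]:
  assumes "\<Phi> \<in> borel_measurable list_space" and [measurable]: "D \<in> sets (borel \<Otimes>\<^sub>M borel)"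
  shows "insert_points D k \<Phi> \<in> borel_measurable list_space"
proof -
  have "(\<lambda>(\<tau>::real, xs). insert_points D k \<Phi> xs) \<in> borel_measurable (borel \<Otimes>\<^sub>M list_space)"
    by (rule measurable_insert_points_param[OF assms(1)]) simp
  from measurable_compose[OF _ this, of "\<lambda>xs. (0, xs)" list_space] show ?thesis
    by simp
qed

lemma symmetric_insert_points: "symmetric \<Phi> \<Longrightarrow> symmetric (insert_points D k \<Phi>)"
proof (induction k)
  case (Suc k)
  have "insert_points D k \<Phi> (p # zs @ x # y # xs) = insert_points D k \<Phi> (p # zs @ y # x # xs)" for p zs x y xs
    using symmetricD[OF Suc.IH[OF Suc.prems], of "p # zs"] by simp
  then show ?case
    by (simp add: symmetric_def)
qed (simp add: symmetric_def)

text \<open>Unordered points can be generated by choosing the earliest one first and restricting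
  the others to later times, at the price of the factor \<open>k + 1\<close>. In the induction
  step the hypothesis orders the last \<open>k + 1\<close> points; the remaining point is compared
  with the earliest of them. If it comes first, the hypothesis applies once more, from its time
  on; otherwise it is one of the unordered later points. The two cases contribute \<open>1\<close>
  and \<open>k + 1\<close> times the right-hand side.\<close>

lemma insert_points_time_ordered:
  fixes T :: real
  defines "D \<equiv> \<lambda>\<tau>. {\<tau><..T} \<times> UNIV"
  assumes \<Phi>: "\<Phi> \<in> borel_measurable list_space" "symmetric \<Phi>"
  shows "insert_points (D \<tau>) (Suc k) \<Phi> xs =
    of_nat (Suc k) * (\<integral>\<^sup>+p. indicator (D \<tau>) p * insert_points (D (fst p)) k \<Phi> ((fst p + snd p) # xs) \<partial>jobs)"
proof (induction k arbitrary: \<tau> xs)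
  case (Suc k)
  define J where "J c xs = insert_points (D c) k \<Phi> xs" for c xs
  define y where "y p = fst p + snd p" for p :: "real \<times> real"
  have "Measurable.pred (borel \<Otimes>\<^sub>M jobs) (\<lambda>(\<tau>::real, p). p \<in> D \<tau>)"
    unfolding D_def mem_Times_iff case_prod_beta greaterThanAtMost_iff by measurable
  from measurable_insert_points_param[OF \<Phi>(1) this]
  have J: "(\<lambda>z. J (fst z) (snd z)) \<in> borel_measurable (borel \<Otimes>\<^sub>M list_space)" for k
    unfolding J_def case_prod_beta .
  have [measurable (raw)]: "(\<lambda>z. J (f z) (g z)) \<in> borel_measurable M"
    if "f \<in> borel_measurable M" "g \<in> M \<rightarrow>\<^sub>M list_space" for f g and M :: "(real \<times> real) measure"
    using measurable_compose[OF _ J, of "\<lambda>z. (f z, g z)"] that by simp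
  have [measurable (raw)]: "(\<lambda>z. J (f z) (g z)) \<in> borel_measurable M"
    if "f \<in> borel_measurable M" "g \<in> M \<rightarrow>\<^sub>M list_space" for f g and M :: "((real \<times> real) \<times> real \<times> real) measure"
    using measurable_compose[OF _ J, of "\<lambda>z. (f z, g z)"] that by simp
  have [measurable]: "y \<in> borel_measurable (borel \<Otimes>\<^sub>M borel)"
    unfolding y_def[abs_def] by measurable
  have [measurable]: "D \<tau> \<in> sets (borel \<Otimes>\<^sub>M borel)" for \<tau>
    unfolding D_def by measurable
  have D_iff: "indicator (D \<tau>) p = (indicator {\<tau><..T} (fst p) :: ennreal)" for \<tau> p
    by (cases p) (simp add: D_def indicator_def)
  have symm: "J c (a # b # xs) = J c (b # a # xs)" for c a b xs
    unfolding J_def by (rule symmetricD0[OF symmetric_insert_points[OF \<Phi>(2)]])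
  have IH: "insert_points (D \<tau>) (Suc k) \<Phi> xs =
      of_nat (Suc k) * (\<integral>\<^sup>+p. indicator {\<tau><..T} (fst p) * J (fst p) (y p # xs) \<partial>jobs)" for \<tau> xs
    unfolding Suc.IH J_def y_def D_iff ..
  let ?I = "\<lambda>c q. indicator {c<..T} (fst q) :: ennreal"
  let ?A = "\<integral>\<^sup>+p. \<integral>\<^sup>+q. ?I \<tau> p * ?I (fst p) q * J (fst q) (y q # y p # xs) \<partial>jobs \<partial>jobs"
  let ?B = "\<integral>\<^sup>+p. \<integral>\<^sup>+q. indicator {fst q..T} (fst p) * ?I \<tau> q * J (fst q) (y q # y p # xs) \<partial>jobs \<partial>jobs"
  let ?R = "\<integral>\<^sup>+p. ?I \<tau> p * insert_points (D (fst p)) (Suc k) \<Phi> (y p # xs) \<partial>jobs"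
  have "insert_points (D \<tau>) (Suc (Suc k)) \<Phi> xs =
      (\<integral>\<^sup>+p. ?I \<tau> p * (of_nat (Suc k) * (\<integral>\<^sup>+q. ?I \<tau> q * J (fst q) (y q # y p # xs) \<partial>jobs)) \<partial>jobs)"
    unfolding insert_points.simps(2)[of _ "Suc k"] IH y_def D_iff ..
  also have "\<dots> = of_nat (Suc k) *
      (\<integral>\<^sup>+p. \<integral>\<^sup>+q. ?I \<tau> p * ?I \<tau> q * J (fst q) (y q # y p # xs) \<partial>jobs \<partial>jobs)"
    by (simp add: mult.assoc mult.left_commute[of _ "of_nat (Suc k)"] nn_integral_cmult del: of_nat_Suc)
  \<comment> \<open>split according to which of the two points is the earlier one\<close>
  also have "(\<integral>\<^sup>+p. \<integral>\<^sup>+q. ?I \<tau> p * ?I \<tau> q * J (fst q) (y q # y p # xs) \<partial>jobs \<partial>jobs) = ?A + ?B"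
    apply (subst nn_integral_add[symmetric], measurable)
    apply (intro nn_integral_cong)
    apply (subst nn_integral_add[symmetric], measurable)
    apply (intro nn_integral_cong)
    apply (auto simp: indicator_def)
    done
  also have "of_nat (Suc k) * (?A + ?B) = of_nat (Suc k) * ?A + of_nat (Suc k) * ?B"
    by (rule distrib_left)
  also have "of_nat (Suc k) * ?A = ?R"
    unfolding IH
    by (simp add: mult.assoc mult.left_commute[of _ "of_nat (Suc k)"] nn_integral_cmult del: of_nat_Suc)
  also have "?B = ?R"
  proof -
    have "?B =
        (\<integral>\<^sup>+q. \<integral>\<^sup>+p. indicator {fst q..T} (fst p) * ?I \<tau> q * J (fst q) (y q # y p # xs) \<partial>jobs \<partial>jobs)"
      by (rule pair_sigma_finite.Fubini') (unfold_locales, measurable)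
    also have "\<dots> = ?R"
    proof (intro nn_integral_cong)
      fix q :: "real \<times> real"
      have null: "AE p in jobs. fst p \<noteq> fst q"
      proof (rule AE_I')
        have "emeasure jobs ({fst q} \<times> UNIV) = emeasure lborel {fst q} * emeasure \<sigma> UNIV"
          unfolding jobs_def by (rule emeasure_pair_measure_Times) simp_all
        then show "{fst q} \<times> UNIV \<in> null_sets jobs"
          by (intro null_setsI) auto
      qed auto
      have "(\<integral>\<^sup>+p. indicator {fst q..T} (fst p) * ?I \<tau> q * J (fst q) (y q # y p # xs) \<partial>jobs) =
          (\<integral>\<^sup>+p. ?I \<tau> q * (indicator (D (fst q)) p * J (fst q) (y p # y q # xs)) \<partial>jobs)"
        by (rule nn_integral_cong_AE, rule AE_mp[OF null], rule AE_I2)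
           (auto simp: indicator_def symm[of _ "y q"] D_def)
      also have "\<dots> = ?I \<tau> q * (\<integral>\<^sup>+p. indicator (D (fst q)) p * J (fst q) (y p # y q # xs) \<partial>jobs)"
        by (rule nn_integral_cmult) measurable
      also have "\<dots> = ?I \<tau> q * insert_points (D (fst q)) (Suc k) \<Phi> (y q # xs)"
        by (simp add: J_def y_def)
      finally show "(\<integral>\<^sup>+p. indicator {fst q..T} (fst p) * ?I \<tau> q * J (fst q) (y q # y p # xs) \<partial>jobs) =
          ?I \<tau> q * insert_points (D (fst q)) (Suc k) \<Phi> (y q # xs)" .
    qed
    finally show ?thesis .
  qed
  also have "?R + of_nat (Suc k) * ?R = of_nat (Suc (Suc k)) * ?R"
    by (simp add: algebra_simps)
  finally show ?case
    unfolding D_iff y_def .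
qed simp

lemma insert_points_suminf:
  assumes [measurable]: "D \<in> sets (borel \<Otimes>\<^sub>M borel)" "\<And>i::nat. \<Phi> i \<in> borel_measurable list_space"
  shows "insert_points D k (\<lambda>zs. \<Sum>i. \<Phi> i zs) xs = (\<Sum>i. insert_points D k (\<Phi> i) xs)"
  by (induction k arbitrary: xs) (simp_all flip: ennreal_suminf_cmult add: nn_integral_suminf)

lemma insert_points_cmult:
  assumes [measurable]: "D \<in> sets (borel \<Otimes>\<^sub>M borel)" "\<Phi> \<in> borel_measurable list_space"
  shows "insert_points D k (\<lambda>zs. a * \<Phi> zs) xs = a * insert_points D k \<Phi> xs"
  by (induction k arbitrary: xs) (simp_all add: mult.left_commute[of _ a] nn_integral_cmult)

lemma insert_points_commute:
  assumes [measurable]: "D \<in> sets (borel \<Otimes>\<^sub>M borel)" "D' \<in> sets (borel \<Otimes>\<^sub>M borel)"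
    "\<Phi> \<in> borel_measurable list_space" and sym: "symmetric \<Phi>"
  shows "insert_points D' 1 (insert_points D k \<Phi>) xs = insert_points D k (insert_points D' 1 \<Phi>) xs"
proof (induction k arbitrary: xs)
  case (Suc k)
  define J where "J = insert_points D k \<Phi>"
  have [measurable]: "J \<in> borel_measurable list_space"
    unfolding J_def by measurable
  have swap: "J (a # b # zs) = J (b # a # zs)" for a b zs
    unfolding J_def by (rule symmetricD0[OF symmetric_insert_points[OF sym]])
  have "insert_points D' 1 (insert_points D (Suc k) \<Phi>) xs =
      (\<integral>\<^sup>+q. \<integral>\<^sup>+p. indicator D' q * (indicator D p * J ((fst p + snd p) # (fst q + snd q) # xs)) \<partial>jobs \<partial>jobs)"
    by (simp add: J_def nn_integral_cmult)
  also have "\<dots> = (\<integral>\<^sup>+p. \<integral>\<^sup>+q. indicator D' q * (indicator D p * J ((fst p + snd p) # (fst q + snd q) # xs)) \<partial>jobs \<partial>jobs)"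
    by (rule pair_sigma_finite.Fubini') (unfold_locales, measurable)
  also have "\<dots> = (\<integral>\<^sup>+p. indicator D p * insert_points D' 1 J ((fst p + snd p) # xs) \<partial>jobs)"
  proof (intro nn_integral_cong)
    fix p :: "real \<times> real"
    have "(\<integral>\<^sup>+q. indicator D' q * (indicator D p * J ((fst p + snd p) # (fst q + snd q) # xs)) \<partial>jobs) =
        (\<integral>\<^sup>+q. indicator D p * (indicator D' q * J ((fst q + snd q) # (fst p + snd p) # xs)) \<partial>jobs)"
      by (intro nn_integral_cong) (simp add: swap[of "fst p + snd p"] mult.left_commute)
    then show "(\<integral>\<^sup>+q. indicator D' q * (indicator D p * J ((fst p + snd p) # (fst q + snd q) # xs)) \<partial>jobs) =
        indicator D p * insert_points D' 1 J ((fst p + snd p) # xs)"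
      by (simp add: nn_integral_cmult)
  qed
  also have "\<dots> = insert_points D (Suc k) (insert_points D' 1 \<Phi>) xs"
    unfolding J_def Suc.IH by simp
  finally show ?case .
qed simp

text \<open>The binomial theorem for the commuting operations of adding a job from one or the
  other of two disjoint regions.\<close>

lemma insert_points_Un:
  assumes [measurable]: "D \<in> sets (borel \<Otimes>\<^sub>M borel)" "D' \<in> sets (borel \<Otimes>\<^sub>M borel)"
    "\<Phi> \<in> borel_measurable list_space" and sym: "symmetric \<Phi>" and disj: "D \<inter> D' = {}"
  shows "insert_points (D \<union> D') m \<Phi> xs =
    (\<Sum>j\<le>m. of_nat (m choose j) * insert_points D j (insert_points D' (m - j) \<Phi>) xs)"
proof (induction m arbitrary: xs)
  case (Suc m)
  define X where "X i j = insert_points D i (insert_points D' j \<Phi>) xs" for i j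
  let ?J = "\<lambda>j. insert_points D j (insert_points D' (m - j) \<Phi>)"
  have 1: "(\<integral>\<^sup>+p. indicator D p * ?J j ((fst p + snd p) # xs) \<partial>jobs) = X (Suc j) (m - j)" for j
    by (simp add: X_def)
  have 2: "(\<integral>\<^sup>+p. indicator D' p * ?J j ((fst p + snd p) # xs) \<partial>jobs) = X j (Suc (m - j))" for j
  proof -
    have "(\<integral>\<^sup>+p. indicator D' p * ?J j ((fst p + snd p) # xs) \<partial>jobs) = insert_points D' 1 (?J j) xs"
      by simp
    also have "\<dots> = insert_points D j (insert_points D' 1 (insert_points D' (m - j) \<Phi>)) xs"
      by (rule insert_points_commute) (simp_all add: symmetric_insert_points[OF sym])
    also have "insert_points D' 1 (insert_points D' (m - j) \<Phi>) = insert_points D' (Suc (m - j)) \<Phi>"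
      by (simp add: fun_eq_iff)
    finally show ?thesis
      unfolding X_def .
  qed
  have "insert_points (D \<union> D') (Suc m) \<Phi> xs =
      (\<integral>\<^sup>+p. (\<Sum>j\<le>m. of_nat (m choose j) * (indicator D p * ?J j ((fst p + snd p) # xs))) +
        (\<Sum>j\<le>m. of_nat (m choose j) * (indicator D' p * ?J j ((fst p + snd p) # xs))) \<partial>jobs)"
    unfolding insert_points.simps Suc.IH
  proof (intro nn_integral_cong)
    fix p
    have ind: "indicator (D \<union> D') p = indicator D p + (indicator D' p :: ennreal)"
      using disj by (auto simp: indicator_def)
    show "indicator (D \<union> D') p * (\<Sum>j\<le>m. of_nat (m choose j) * ?J j ((fst p + snd p) # xs)) =
        (\<Sum>j\<le>m. of_nat (m choose j) * (indicator D p * ?J j ((fst p + snd p) # xs))) +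
        (\<Sum>j\<le>m. of_nat (m choose j) * (indicator D' p * ?J j ((fst p + snd p) # xs)))"
      unfolding ind distrib_right sum_distrib_left sum.distrib[symmetric]
      by (intro sum.cong refl arg_cong2[where f="(+)"] mult.left_commute)
  qed
  also have "\<dots> = (\<Sum>j\<le>m. of_nat (m choose j) * X (Suc j) (m - j)) +
      (\<Sum>j\<le>m. of_nat (m choose j) * X j (Suc (m - j)))"
    by (simp add: nn_integral_add nn_integral_sum nn_integral_cmult 1 2)
  also have "\<dots> = (\<Sum>j\<le>Suc m. of_nat (Suc m choose j) * X j (Suc m - j))"
  proof -
    let ?S = "\<Sum>j\<le>m. of_nat (m choose Suc j) * X (Suc j) (m - j)"
    have "(\<Sum>j\<le>Suc m. of_nat (Suc m choose j) * X j (Suc m - j)) =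
        X 0 (Suc m) + ((\<Sum>j\<le>m. of_nat (m choose j) * X (Suc j) (m - j)) + ?S)"
      by (subst sum.atMost_Suc_shift) (simp add: distrib_right sum.distrib)
    moreover have "(\<Sum>j\<le>m. of_nat (m choose j) * X j (Suc (m - j))) = X 0 (Suc m) + ?S"
    proof -
      have "(\<Sum>j\<le>m. of_nat (m choose j) * X j (Suc (m - j))) =
          (\<Sum>j\<le>m. of_nat (m choose j) * X j (Suc m - j))"
        by (intro sum.cong) (auto simp: Suc_diff_le)
      also have "\<dots> = (\<Sum>j\<le>Suc m. of_nat (m choose j) * X j (Suc m - j))"
        by simp
      also have "\<dots> = X 0 (Suc m) + ?S"
        by (subst sum.atMost_Suc_shift) simp
      finally show ?thesis .
    qed
    ultimately show ?thesis
      by (simp only: add.left_commute)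
  qed
  finally show ?case
    unfolding X_def .
qed simp

text \<open>The expectation of \<open>\<Phi>\<close>, at the departure times of the points of a
  Poisson process with intensity \<open>l\<close> on \<open>D\<close> in front of
  \<open>xs\<close>, divided by the probability \<open>exp (- l |D|)\<close> of no point. Without
  this factor the definition makes sense before the mass of \<open>D\<close> is known to be
  finite.\<close>

definition poisson_points :: "real \<Rightarrow> (real \<times> real) set \<Rightarrow> (real list \<Rightarrow> ennreal) \<Rightarrow> real list \<Rightarrow> ennreal" where
  "poisson_points l D \<Phi> xs = (\<Sum>k. ennreal (l ^ k / fact k) * insert_points D k \<Phi> xs)"

lemma measurable_poisson_points [measurable]:
  assumes [measurable]: "\<Phi> \<in> borel_measurable list_space" "D \<in> sets (borel \<Otimes>\<^sub>M borel)"
  shows "poisson_points l D \<Phi> \<in> borel_measurable list_space"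
  unfolding poisson_points_def[abs_def] by measurable

lemma poisson_points_cmult:
  assumes [measurable]: "D \<in> sets (borel \<Otimes>\<^sub>M borel)" "\<Phi> \<in> borel_measurable list_space"
  shows "poisson_points l D (\<lambda>zs. a * \<Phi> zs) xs = a * poisson_points l D \<Phi> xs"
  by (simp add: poisson_points_def insert_points_cmult mult.left_commute[of _ a])

text \<open>Poisson points in disjoint regions are independent: the exponential of a sum of
  commuting operations is the product of their exponentials.\<close>

lemma poisson_points_Un:
  assumes [measurable]: "D \<in> sets (borel \<Otimes>\<^sub>M borel)" "D' \<in> sets (borel \<Otimes>\<^sub>M borel)"
    "\<Phi> \<in> borel_measurable list_space" and sym: "symmetric \<Phi>" and disj: "D \<inter> D' = {}" and l: "0 \<le> l"
  shows "poisson_points l (D \<union> D') \<Phi> xs = poisson_points l D (poisson_points l D' \<Phi>) xs"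
proof -
  let ?c = "\<lambda>k. ennreal (l ^ k / fact k)"
  have "poisson_points l (D \<union> D') \<Phi> xs =
      (\<Sum>m. \<Sum>j\<le>m. ?c j * (?c (m - j) * insert_points D j (insert_points D' (m - j) \<Phi>) xs))"
    unfolding poisson_points_def
  proof (intro suminf_cong)
    fix m
    have c: "?c m * of_nat (m choose j) = ?c j * ?c (m - j)" if "j \<le> m" for j
    proof -
      have "l ^ m / fact m * real (m choose j) = l ^ j / fact j * (l ^ (m - j) / fact (m - j))"
        using that by (simp add: binomial_fact field_simps flip: power_add)
      then show ?thesis
        using l unfolding ennreal_of_nat_eq_real_of_nat by (subst (1 2) ennreal_mult[symmetric]) simp_all
    qed
    show "?c m * insert_points (D \<union> D') m \<Phi> xs =
        (\<Sum>j\<le>m. ?c j * (?c (m - j) * insert_points D j (insert_points D' (m - j) \<Phi>) xs))"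
      by (subst insert_points_Un) (simp_all add: sym disj sum_distrib_left c flip: mult.assoc)
  qed
  also have "\<dots> = (\<Sum>j. \<Sum>i. ?c j * (?c i * insert_points D j (insert_points D' i \<Phi>) xs))"
    by (rule suminf_ennreal_diagonal)
  also have "\<dots> = poisson_points l D (poisson_points l D' \<Phi>) xs"
    unfolding poisson_points_def
    by (subst insert_points_suminf) (simp_all add: insert_points_cmult)
  finally show ?thesis .
qed

text \<open>Points that \<open>\<Phi>\<close> cannot see contribute only their normalising
  factor.\<close>

lemma poisson_points_invisible:
  assumes [measurable]: "D \<in> sets (borel \<Otimes>\<^sub>M borel)" "\<Phi> \<in> borel_measurable list_space"
    and invisible: "\<And>p zs. p \<in> D \<Longrightarrow> \<Phi> ((fst p + snd p) # zs) = \<Phi> zs"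
    and l: "0 \<le> l" and mass: "emeasure jobs D = ennreal m" "0 \<le> m"
  shows "poisson_points l D \<Phi> xs = ennreal (exp (l * m)) * \<Phi> xs"
proof -
  have k: "insert_points D k \<Phi> xs = ennreal (m ^ k) * \<Phi> xs" for k xs
  proof (induction k arbitrary: xs)
    case (Suc k)
    have "insert_points D (Suc k) \<Phi> xs = (\<integral>\<^sup>+p. (ennreal (m ^ k) * \<Phi> xs) * indicator D p \<partial>jobs)"
      unfolding insert_points.simps Suc.IH by (intro nn_integral_cong) (auto simp: indicator_def invisible)
    also have "\<dots> = (ennreal (m ^ k) * \<Phi> xs) * emeasure jobs D"
      by (subst nn_integral_cmult_indicator) simp_all
    finally show ?case
      using mass(2) by (simp add: mass(1) ennreal_mult'' ac_simps)
  qed simp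
  have "poisson_points l D \<Phi> xs = (\<Sum>k. ennreal ((l * m) ^ k / fact k)) * \<Phi> xs"
    unfolding poisson_points_def k using l mass(2)
    by (simp add: power_mult_distrib mult.assoc[symmetric] flip: ennreal_mult)
  also have "(\<Sum>k. ennreal ((l * m) ^ k / fact k)) = ennreal (exp (l * m))"
    using exp_converges[of "l * m"] l mass(2)
    by (intro suminf_ennreal_eq) (simp_all add: divide_inverse mult.commute)
  finally show ?thesis .
qed

end

section \<open>Poisson arrivals\<close>

abbreviation iid :: "'a measure \<Rightarrow> (nat \<Rightarrow> 'a) measure" where
  "iid N \<equiv> PiM UNIV (\<lambda>_. N)"

lemma prob_space_iid: "prob_space N \<Longrightarrow> prob_space (iid N)"
  by (rule prob_space_PiM)

lemma sets_iid: "sets N = sets borel \<Longrightarrow> sets (iid N) = sets (iid borel)"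
  by (rule sets_PiM_cong) simp_all

lemma measurable_iid_ident: "sets N = sets borel \<Longrightarrow> (\<lambda>v. v) \<in> iid N \<rightarrow>\<^sub>M iid borel"
  by (rule measurable_ident_sets) (rule sets_iid)

lemma measurable_iid_component: "sets N = sets borel \<Longrightarrow> (\<lambda>v. v i) \<in> borel_measurable (iid N)"
  by (rule measurable_compose[OF measurable_iid_ident measurable_component_singleton]) simp_all

lemma rev_upt_Suc: "rev [0..<Suc k] = map Suc (rev [0..<k]) @ [0]"
proof -
  have "[0..<Suc k] = 0 # map Suc [0..<k]"
    by (simp add: map_Suc_upt upt_conv_Cons del: upt_Suc)
  then show ?thesis
    by (simp only: rev.simps rev_map)
qed

lemma nn_integral_iid_case_nat:
  assumes "prob_space N" and [measurable]: "f \<in> borel_measurable (iid N)"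
  shows "(\<integral>\<^sup>+\<omega>. f \<omega> \<partial>iid N) = (\<integral>\<^sup>+x. \<integral>\<^sup>+\<omega>. f (case_nat x \<omega>) \<partial>iid N \<partial>N)"
proof -
  interpret N: prob_space N by fact
  interpret I: sigma_finite_measure "iid N"
    using assms(1) prob_space_iid prob_space_imp_sigma_finite by blast
  interpret S: sequence_space N
    by unfold_locales
  have "(\<integral>\<^sup>+\<omega>. f \<omega> \<partial>iid N) = (\<integral>\<^sup>+z. f (case_prod case_nat z) \<partial>(N \<Otimes>\<^sub>M iid N))"
    by (subst S.PiM_iter[symmetric], subst nn_integral_distr) simp_all
  also have "\<dots> = (\<integral>\<^sup>+x. \<integral>\<^sup>+\<omega>. f (case_nat x \<omega>) \<partial>iid N \<partial>N)"
    by (subst I.nn_integral_fst[symmetric]) simp_all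
  finally show ?thesis .
qed

lemma measurable_shift_sequence [measurable (raw)]:
  assumes "g \<in> M \<rightarrow>\<^sub>M iid N"
  shows "(\<lambda>z i. g z (Suc i)) \<in> M \<rightarrow>\<^sub>M iid N"
  by (rule measurable_PiM_single') (use assms measurable_space[OF assms] in \<open>auto simp: space_PiM\<close>)

definition exp_law :: "real \<Rightarrow> real measure" where
  "exp_law l = density lborel (\<lambda>x. ennreal (exponential_density l x))"

lemma sets_exp_law [measurable_cong, simp]: "sets (exp_law l) = sets borel"
  by (simp add: exp_law_def)

lemma space_exp_law [simp]: "space (exp_law l) = UNIV"
  by (simp add: exp_law_def)

lemma prob_space_exp_law: "0 < l \<Longrightarrow> prob_space (exp_law l)"
  unfolding exp_law_def by (rule prob_space_exponential_density)

lemma measurable_exponential_density [measurable]: "exponential_density l \<in> borel_measurable borel"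
  unfolding exponential_density_def[abs_def] by measurable

lemma nn_integral_exp_law_shift:
  assumes [measurable]: "f \<in> borel_measurable borel"
  shows "(\<integral>\<^sup>+u. f (\<tau> + u) \<partial>exp_law l) = (\<integral>\<^sup>+c. ennreal (exponential_density l (c - \<tau>)) * f c \<partial>lborel)"
proof -
  have "(\<integral>\<^sup>+u. f (\<tau> + u) \<partial>exp_law l) = (\<integral>\<^sup>+u. ennreal (exponential_density l u) * f (\<tau> + u) \<partial>lborel)"
    unfolding exp_law_def by (rule nn_integral_density) measurable
  also have "\<dots> = (\<integral>\<^sup>+c. ennreal (exponential_density l (c - \<tau>)) * f c \<partial>lborel)"
    using nn_integral_real_affine[of "\<lambda>c. ennreal (exponential_density l (c - \<tau>)) * f c" 1 \<tau>] by simp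
  finally show ?thesis .
qed

lemma exp_law_memoryless:
  assumes [measurable]: "f \<in> borel_measurable borel" and b: "0 \<le> b"
  shows "(\<integral>\<^sup>+u. indicator {b<..} u * f (u - b) \<partial>exp_law l) = ennreal (exp (- l * b)) * (\<integral>\<^sup>+u. f u \<partial>exp_law l)"
proof -
  have "(\<integral>\<^sup>+u. indicator {b<..} u * f (u - b) \<partial>exp_law l) =
      (\<integral>\<^sup>+c. ennreal (exponential_density l (c + b)) * (indicator {0<..} c * f c) \<partial>lborel)"
    using nn_integral_exp_law_shift[where \<tau>="- b" and f="\<lambda>c. indicator {0<..} c * f c"]
    by (simp add: indicator_def)
  also have "\<dots> = (\<integral>\<^sup>+c. ennreal (exp (- l * b)) * (ennreal (exponential_density l c) * f c) \<partial>lborel)"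
  proof (rule nn_integral_cong_AE)
    show "AE c in lborel. ennreal (exponential_density l (c + b)) * (indicator {0<..} c * f c) =
        ennreal (exp (- l * b)) * (ennreal (exponential_density l c) * f c)"
      using AE_lborel_singleton[of 0]
    proof eventually_elim
      case (elim c)
      show ?case
      proof (cases "0 < c")
        case True
        then have "exponential_density l (c + b) = exp (- l * b) * exponential_density l c"
          using b by (simp add: exponential_density_def algebra_simps flip: exp_add)
        then show ?thesis
          using True by (simp add: ennreal_mult' mult.assoc)
      qed (use elim in \<open>simp add: exponential_density_def\<close>)
    qed
  qed
  also have "\<dots> = ennreal (exp (- l * b)) * (\<integral>\<^sup>+c. ennreal (exponential_density l c) * f c \<partial>lborel)"
    by (rule nn_integral_cmult) measurable
  also have "(\<integral>\<^sup>+c. ennreal (exponential_density l c) * f c \<partial>lborel) = (\<integral>\<^sup>+u. f u \<partial>exp_law l)"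
    using nn_integral_exp_law_shift[where \<tau>=0 and f=f] by simp
  finally show ?thesis .
qed

text \<open>The current time is \<open>\<tau>\<close>, the infinite-server queue has the departure
  times \<open>xs\<close>, and \<open>u\<close>, \<open>w\<close> are the inter-arrival and
  service times still to come. If exactly \<open>k\<close> jobs arrive during \<open>(\<tau>,
  T]\<close>, the value is \<open>post\<close> at the situation at time \<open>T\<close>, where
  the first inter-arrival time is the part of the current one that exceeds \<open>T\<close>;
  otherwise it is \<open>0\<close>.\<close>

fun run_arrivals :: "real \<Rightarrow> (real list \<Rightarrow> (nat \<Rightarrow> real) \<Rightarrow> (nat \<Rightarrow> real) \<Rightarrow> ennreal) \<Rightarrow>
    nat \<Rightarrow> real \<Rightarrow> real list \<Rightarrow> (nat \<Rightarrow> real) \<Rightarrow> (nat \<Rightarrow> real) \<Rightarrow> ennreal" where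
  "run_arrivals T post 0 \<tau> xs u w =
    indicator {T<..} (\<tau> + u 0) * post xs (case_nat (\<tau> + u 0 - T) (\<lambda>i. u (Suc i))) w"
| "run_arrivals T post (Suc k) \<tau> xs u w =
    indicator {..T} (\<tau> + u 0) *
      run_arrivals T post k (\<tau> + u 0) ((\<tau> + u 0 + w 0) # xs) (\<lambda>i. u (Suc i)) (\<lambda>i. w (Suc i))"

lemma measurable_run_arrivals:
  assumes post: "\<And>f g h. f \<in> M \<rightarrow>\<^sub>M list_space \<Longrightarrow> g \<in> M \<rightarrow>\<^sub>M iid borel \<Longrightarrow> h \<in> M \<rightarrow>\<^sub>M iid borel \<Longrightarrow>
      (\<lambda>z. post (f z) (g z) (h z)) \<in> borel_measurable M"
    and "f \<in> M \<rightarrow>\<^sub>M list_space" "g \<in> M \<rightarrow>\<^sub>M iid borel" "h \<in> M \<rightarrow>\<^sub>M iid borel" "t \<in> borel_measurable M"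
  shows "(\<lambda>z. run_arrivals T post k (t z) (f z) (g z) (h z)) \<in> borel_measurable M"
  using assms(2-)
proof (induction k arbitrary: t f g h)
  case 0
  note [measurable] = 0
  have "(\<lambda>z. post (f z) (case_nat (t z + g z 0 - T) (\<lambda>i. g z (Suc i))) (h z)) \<in> borel_measurable M"
    by (rule post) measurable
  then show ?case
    by simp
next
  case (Suc k)
  note [measurable] = Suc.prems
  have "(\<lambda>z. run_arrivals T post k (t z + g z 0) ((t z + g z 0 + h z 0) # f z)
      (\<lambda>i. g z (Suc i)) (\<lambda>i. h z (Suc i))) \<in> borel_measurable M"
    by (rule Suc.IH) measurable
  then show ?case
    by simp
qed

context service_law
begin

text \<open>The first arrival has an exponential density, and the arrivals after it form the same
  problem with one arrival fewer from a later time on. This is the time-ordered integral of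
  \<open>insert_points_time_ordered\<close>, which supplies the factor \<open>1 / (k + 1)\<close>.
  By the lack of memory, the part of the last inter-arrival time beyond \<open>T\<close> is again
  exponential, so that what happens after \<open>T\<close> enters only through the expectation
  \<open>F\<close>.\<close>

lemma nn_integral_run_arrivals:
  fixes T l :: real
  assumes l: "0 < l" and \<tau>: "\<tau> \<le> T"
    and post: "(\<lambda>(xs, u, w). post xs u w) \<in> borel_measurable (list_space \<Otimes>\<^sub>M iid borel \<Otimes>\<^sub>M iid borel)"
  defines "F \<equiv> \<lambda>xs. \<integral>\<^sup>+u. \<integral>\<^sup>+w. post xs u w \<partial>iid \<sigma> \<partial>iid (exp_law l)"
  assumes sym: "symmetric F"
  shows "(\<integral>\<^sup>+u. \<integral>\<^sup>+w. run_arrivals T post k \<tau> xs u w \<partial>iid \<sigma> \<partial>iid (exp_law l)) =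
    ennreal (exp (- l * (T - \<tau>)) * l ^ k / fact k) * insert_points ({\<tau><..T} \<times> UNIV) k F xs"
proof -
  interpret E: prob_space "exp_law l"
    using l by (rule prob_space_exp_law)
  interpret U: prob_space "iid (exp_law l)"
    by (rule prob_space_iid) unfold_locales
  interpret W: prob_space "iid \<sigma>"
    by (rule prob_space_iid) unfold_locales
  note sets_iid[OF sets_exp_law, measurable_cong] sets_iid[OF sets_law, measurable_cong]
  have post_m [measurable (raw)]: "(\<lambda>z. post (f z) (g z) (h z)) \<in> borel_measurable M"
    if "f \<in> M \<rightarrow>\<^sub>M list_space" "g \<in> M \<rightarrow>\<^sub>M iid borel" "h \<in> M \<rightarrow>\<^sub>M iid borel" for M :: "'m measure" and f g h
    using measurable_compose[OF _ post, of "\<lambda>z. (f z, g z, h z)" M] that by simp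
  have post_w: "post xs u \<in> borel_measurable (iid \<sigma>)" for xs u
    using post_m[of "\<lambda>_. xs" "iid \<sigma>" "\<lambda>_. u" "\<lambda>w. w"] measurable_iid_ident[OF sets_law]
    by (simp add: space_PiM)
  have F [measurable]: "F \<in> borel_measurable list_space"
    unfolding F_def[abs_def] by measurable
  define R where "R k \<tau> xs = (\<integral>\<^sup>+u. \<integral>\<^sup>+w. run_arrivals T post k \<tau> xs u w \<partial>iid \<sigma> \<partial>iid (exp_law l))" for k \<tau> xs
  have run_m [measurable (raw)]: "(\<lambda>z. run_arrivals T post k (t z) (f z) (g z) (h z)) \<in> borel_measurable M"
    if "f \<in> M \<rightarrow>\<^sub>M list_space" "g \<in> M \<rightarrow>\<^sub>M iid borel" "h \<in> M \<rightarrow>\<^sub>M iid borel" "t \<in> borel_measurable M"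
    for M :: "'m measure" and f g h t k
    by (rule measurable_run_arrivals[OF post_m that])
  have "R k \<tau> xs = ennreal (exp (- l * (T - \<tau>)) * l ^ k / fact k) * insert_points ({\<tau><..T} \<times> UNIV) k F xs"
    using \<tau>
  proof (induction k arbitrary: \<tau> xs)
    case 0
    define g where "g y = (\<integral>\<^sup>+u. \<integral>\<^sup>+w. post xs (case_nat y u) w \<partial>iid \<sigma> \<partial>iid (exp_law l))" for y
    have [measurable]: "g \<in> borel_measurable borel"
      unfolding g_def[abs_def] by measurable
    have "R 0 \<tau> xs = (\<integral>\<^sup>+y. indicator {T<..} (\<tau> + y) * g (\<tau> + y - T) \<partial>exp_law l)"
      unfolding R_def run_arrivals.simps
      by (subst nn_integral_iid_case_nat)
        (auto simp: E.prob_space_axioms nn_integral_cmult[OF post_w] g_def nn_integral_cmult intro!: nn_integral_cong)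
    also have "\<dots> = (\<integral>\<^sup>+y. indicator {T - \<tau><..} y * g (y - (T - \<tau>)) \<partial>exp_law l)"
      by (intro nn_integral_cong) (auto simp: indicator_def algebra_simps)
    also have "\<dots> = ennreal (exp (- l * (T - \<tau>))) * (\<integral>\<^sup>+y. g y \<partial>exp_law l)"
      by (rule exp_law_memoryless) (use 0 in auto)
    also have "(\<integral>\<^sup>+y. g y \<partial>exp_law l) = F xs"
      unfolding F_def g_def by (rule nn_integral_iid_case_nat[symmetric]) (auto simp: E.prob_space_axioms)
    finally show ?case
      by simp
  next
    case (Suc k)
    define J where "J c xs = insert_points ({c<..T} \<times> UNIV) k F xs" for c xs
    have "Measurable.pred (borel \<Otimes>\<^sub>M jobs) (\<lambda>(c::real, p). p \<in> {c<..T} \<times> UNIV)"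
      unfolding mem_Times_iff case_prod_beta greaterThanAtMost_iff by measurable
    from measurable_insert_points_param[OF F this, of k]
    have J: "(\<lambda>z. J (fst z) (snd z)) \<in> borel_measurable (borel \<Otimes>\<^sub>M list_space)"
      unfolding J_def case_prod_beta .
    have [measurable (raw)]: "(\<lambda>z. J (f z) (g z)) \<in> borel_measurable M"
      if "f \<in> borel_measurable M" "g \<in> M \<rightarrow>\<^sub>M list_space" for f g and M :: "(real \<times> real) measure"
      using measurable_compose[OF _ J, of "\<lambda>z. (f z, g z)"] that by simp
    have [measurable (raw)]: "(\<lambda>z. J (f z) (g z)) \<in> borel_measurable M"
      if "f \<in> borel_measurable M" "g \<in> M \<rightarrow>\<^sub>M list_space" for f g and M :: "real measure"
      using measurable_compose[OF _ J, of "\<lambda>z. (f z, g z)"] that by simp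
    define K where "K c = (\<integral>\<^sup>+w. J c ((c + w) # xs) \<partial>\<sigma>)" for c
    have [measurable]: "K \<in> borel_measurable borel"
      unfolding K_def[abs_def] by measurable
    define e where "e c = ennreal (exp (- l * (T - c)) * l ^ k / fact k)" for c
    have [measurable]: "e \<in> borel_measurable borel"
      unfolding e_def[abs_def] by measurable
    have "R (Suc k) \<tau> xs = (\<integral>\<^sup>+y. \<integral>\<^sup>+u. \<integral>\<^sup>+x. \<integral>\<^sup>+w. indicator {..T} (\<tau> + y) *
        run_arrivals T post k (\<tau> + y) ((\<tau> + y + x) # xs) u w \<partial>iid \<sigma> \<partial>\<sigma> \<partial>iid (exp_law l) \<partial>exp_law l)"
    proof -
      let ?f = "\<lambda>u w. indicator {..T} (\<tau> + u 0) *
        run_arrivals T post k (\<tau> + u 0) ((\<tau> + u 0 + w 0) # xs) (\<lambda>i. u (Suc i)) (\<lambda>i. w (Suc i))"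
      have "R (Suc k) \<tau> xs = (\<integral>\<^sup>+y. \<integral>\<^sup>+u. \<integral>\<^sup>+w. ?f (case_nat y u) w \<partial>iid \<sigma> \<partial>iid (exp_law l) \<partial>exp_law l)"
        unfolding R_def run_arrivals.simps
        by (rule nn_integral_iid_case_nat[OF E.prob_space_axioms]) measurable
      also have "\<dots> = (\<integral>\<^sup>+y. \<integral>\<^sup>+u. \<integral>\<^sup>+w. indicator {..T} (\<tau> + y) *
          run_arrivals T post k (\<tau> + y) ((\<tau> + y + w 0) # xs) u (\<lambda>i. w (Suc i)) \<partial>iid \<sigma> \<partial>iid (exp_law l) \<partial>exp_law l)"
        by simp
      also have "\<dots> = (\<integral>\<^sup>+y. \<integral>\<^sup>+u. \<integral>\<^sup>+x. \<integral>\<^sup>+w. indicator {..T} (\<tau> + y) *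
          run_arrivals T post k (\<tau> + y) ((\<tau> + y + case_nat x w 0) # xs) u (\<lambda>i. case_nat x w (Suc i))
          \<partial>iid \<sigma> \<partial>\<sigma> \<partial>iid (exp_law l) \<partial>exp_law l)"
      proof (intro nn_integral_cong nn_integral_iid_case_nat[OF prob_space_axioms])
        fix y u
        have "(\<lambda>w i. w (Suc i)) \<in> iid \<sigma> \<rightarrow>\<^sub>M iid borel"
          by (rule measurable_shift_sequence[OF measurable_iid_ident[OF sets_law]])
        have "(\<lambda>w. w 0) \<in> borel_measurable (iid \<sigma>)"
          by (rule measurable_iid_component[OF sets_law])
        then have "(\<lambda>w. \<tau> + y + w 0) \<in> borel_measurable (iid \<sigma>)"
          by (intro borel_measurable_add measurable_const) simp_all
        then have xs_w: "(\<lambda>w. (\<tau> + y + w 0) # xs) \<in> iid \<sigma> \<rightarrow>\<^sub>M list_space"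
          by (rule measurable_Cons_list_space) simp
        have "(\<lambda>w. run_arrivals T post k (\<tau> + y) ((\<tau> + y + w 0) # xs) u (\<lambda>i. w (Suc i))) \<in> borel_measurable (iid \<sigma>)"
        proof (rule run_m)
          show "(\<lambda>w. u) \<in> iid \<sigma> \<rightarrow>\<^sub>M iid borel"
            by (rule measurable_const) (simp add: space_PiM)
        qed (fact xs_w, fact, simp)
        then show "(\<lambda>w. indicator {..T} (\<tau> + y) *
            run_arrivals T post k (\<tau> + y) ((\<tau> + y + w 0) # xs) u (\<lambda>i. w (Suc i))) \<in> borel_measurable (iid \<sigma>)"
          by simp
      qed
      finally show ?thesis
        by simp
    qed
    also have "\<dots> = (\<integral>\<^sup>+y. \<integral>\<^sup>+x. \<integral>\<^sup>+u. \<integral>\<^sup>+w. indicator {..T} (\<tau> + y) *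
        run_arrivals T post k (\<tau> + y) ((\<tau> + y + x) # xs) u w \<partial>iid \<sigma> \<partial>iid (exp_law l) \<partial>\<sigma> \<partial>exp_law l)"
      by (intro nn_integral_cong pair_sigma_finite.Fubini') (unfold_locales, measurable)
    also have "\<dots> = (\<integral>\<^sup>+y. \<integral>\<^sup>+x. indicator {..T} (\<tau> + y) * R k (\<tau> + y) ((\<tau> + y + x) # xs) \<partial>\<sigma> \<partial>exp_law l)"
    proof (intro nn_integral_cong)
      fix y x
      show "(\<integral>\<^sup>+u. \<integral>\<^sup>+w. indicator {..T} (\<tau> + y) *
          run_arrivals T post k (\<tau> + y) ((\<tau> + y + x) # xs) u w \<partial>iid \<sigma> \<partial>iid (exp_law l)) =
          indicator {..T} (\<tau> + y) * R k (\<tau> + y) ((\<tau> + y + x) # xs)"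
        by (cases "\<tau> + y \<le> T") (simp_all add: R_def)
    qed
    also have "\<dots> = (\<integral>\<^sup>+y. indicator {..T} (\<tau> + y) * (e (\<tau> + y) * K (\<tau> + y)) \<partial>exp_law l)"
    proof (intro nn_integral_cong)
      fix y
      have "indicator {..T} (\<tau> + y) * R k (\<tau> + y) ((\<tau> + y + x) # xs) =
          indicator {..T} (\<tau> + y) * (e (\<tau> + y) * J (\<tau> + y) ((\<tau> + y + x) # xs))" for x
        by (cases "\<tau> + y \<le> T") (simp_all add: Suc.IH e_def J_def)
      then show "(\<integral>\<^sup>+x. indicator {..T} (\<tau> + y) * R k (\<tau> + y) ((\<tau> + y + x) # xs) \<partial>\<sigma>) =
          indicator {..T} (\<tau> + y) * (e (\<tau> + y) * K (\<tau> + y))"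
        by (simp add: K_def nn_integral_cmult)
    qed
    also have "\<dots> = (\<integral>\<^sup>+c. ennreal (exponential_density l (c - \<tau>)) * (indicator {..T} c * (e c * K c)) \<partial>lborel)"
      by (rule nn_integral_exp_law_shift[of "\<lambda>c. indicator {..T} c * (e c * K c)"]) measurable
    also have "\<dots> = (\<integral>\<^sup>+c. ennreal (exp (- l * (T - \<tau>)) * l ^ Suc k / fact k) * (indicator {\<tau><..T} c * K c) \<partial>lborel)"
    proof (rule nn_integral_cong_AE)
      show "AE c in lborel. ennreal (exponential_density l (c - \<tau>)) * (indicator {..T} c * (e c * K c)) =
          ennreal (exp (- l * (T - \<tau>)) * l ^ Suc k / fact k) * (indicator {\<tau><..T} c * K c)"
        using AE_lborel_singleton[of \<tau>]
      proof eventually_elim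
        case (elim c)
        show ?case
        proof (cases "\<tau> < c \<and> c \<le> T")
          case True
          then have "exponential_density l (c - \<tau>) * (exp (- l * (T - c)) * l ^ k / fact k) =
              exp (- l * (T - \<tau>)) * l ^ Suc k / fact k"
            by (simp add: exponential_density_def field_simps flip: exp_add)
          then have "ennreal (exponential_density l (c - \<tau>)) * e c = ennreal (exp (- l * (T - \<tau>)) * l ^ Suc k / fact k)"
            using l unfolding e_def by (subst ennreal_mult''[symmetric]) simp_all
          then show ?thesis
            using True by (simp add: mult.assoc[symmetric])
        qed (use elim in \<open>auto simp: exponential_density_def indicator_def\<close>)
      qed
    qed
    also have "\<dots> = ennreal (exp (- l * (T - \<tau>)) * l ^ Suc k / fact k) *
        (\<integral>\<^sup>+c. indicator {\<tau><..T} c * K c \<partial>lborel)"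
      by (rule nn_integral_cmult) measurable
    also have "(\<integral>\<^sup>+c. indicator {\<tau><..T} c * K c \<partial>lborel) =
        (\<integral>\<^sup>+p. indicator ({\<tau><..T} \<times> UNIV) p * J (fst p) ((fst p + snd p) # xs) \<partial>jobs)"
      by (subst nn_integral_jobs) (simp_all add: K_def indicator_times nn_integral_cmult)
    also have "ennreal (exp (- l * (T - \<tau>)) * l ^ Suc k / fact k) * \<dots> =
        ennreal (exp (- l * (T - \<tau>)) * l ^ Suc k / fact (Suc k)) * insert_points ({\<tau><..T} \<times> UNIV) (Suc k) F xs"
    proof -
      have "exp (- l * (T - \<tau>)) * l ^ Suc k / fact k =
          exp (- l * (T - \<tau>)) * l ^ Suc k / fact (Suc k) * real (Suc k)"
        by (simp add: fact_Suc del: of_nat_Suc)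
      then have "ennreal (exp (- l * (T - \<tau>)) * l ^ Suc k / fact k) =
          ennreal (exp (- l * (T - \<tau>)) * l ^ Suc k / fact (Suc k)) * of_nat (Suc k)"
        using l unfolding ennreal_of_nat_eq_real_of_nat
        by (subst ennreal_mult''[symmetric]) (simp_all del: of_nat_Suc)
      then show ?thesis
        unfolding insert_points_time_ordered[OF F sym] J_def by (simp only: mult.assoc)
    qed
    finally show ?case .
  qed
  then show ?thesis
    unfolding R_def .
qed

end

section \<open>Residual life\<close>

context service_law
begin

text \<open>The jobs present at time \<open>T\<close> in an infinite-server queue that has been
  running forever.\<close>

definition in_service :: "real \<Rightarrow> (real \<times> real) set" where
  "in_service T = {p. fst p \<le> T \<and> T < fst p + snd p}"

lemma measurable_in_service [measurable]: "in_service T \<in> sets (borel \<Otimes>\<^sub>M borel)"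
proof -
  have "{p \<in> space (borel \<Otimes>\<^sub>M borel). fst p \<le> T \<and> T < fst p + (snd p :: real)} \<in> sets (borel \<Otimes>\<^sub>M borel)"
    by measurable
  then show ?thesis
    by (simp add: in_service_def space_pair_measure)
qed

lemma measurable_tail [measurable]: "(\<lambda>y. emeasure \<sigma> {y<..}) \<in> borel_measurable borel"
proof -
  have "(\<lambda>y. \<integral>\<^sup>+w. indicator {y<..} w \<partial>\<sigma>) \<in> borel_measurable borel"
    by measurable
  then show ?thesis
    by simp
qed

text \<open>Translation invariance of Lebesgue measure; this is where stationarity comes
  from.\<close>

lemma nn_integral_in_service_shift:
  assumes [measurable]: "f \<in> borel_measurable borel"
  shows "(\<integral>\<^sup>+p. indicator (in_service T) p * f (fst p + snd p) \<partial>jobs) =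
    (\<integral>\<^sup>+p. indicator (in_service 0) p * f (fst p + snd p + T) \<partial>jobs)"
proof -
  have "(\<integral>\<^sup>+p. indicator (in_service T) p * f (fst p + snd p) \<partial>jobs) =
      (\<integral>\<^sup>+c. \<integral>\<^sup>+w. indicator (in_service T) (c, w) * f (c + w) \<partial>\<sigma> \<partial>lborel)"
    by (subst nn_integral_jobs) simp_all
  also have "\<dots> = (\<integral>\<^sup>+c. \<integral>\<^sup>+w. indicator (in_service T) (T + c, w) * f (T + c + w) \<partial>\<sigma> \<partial>lborel)"
    by (subst nn_integral_real_affine[where c=1 and t=T]) simp_all
  also have "\<dots> = (\<integral>\<^sup>+c. \<integral>\<^sup>+w. indicator (in_service 0) (c, w) * f (c + w + T) \<partial>\<sigma> \<partial>lborel)"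
    by (intro nn_integral_cong) (auto simp: in_service_def indicator_def ac_simps)
  also have "\<dots> = (\<integral>\<^sup>+p. indicator (in_service 0) p * f (fst p + snd p + T) \<partial>jobs)"
    by (subst nn_integral_jobs) simp_all
  finally show ?thesis .
qed

lemma in_service_tail:
  assumes "0 \<le> z"
  shows "(\<integral>\<^sup>+p. indicator (in_service 0) p * indicator {z<..} (fst p + snd p) \<partial>jobs) =
    (\<integral>\<^sup>+y. indicator {z<..} y * emeasure \<sigma> {y<..} \<partial>lborel)"
proof -
  have "(\<integral>\<^sup>+p. indicator (in_service 0) p * indicator {z<..} (fst p + snd p) \<partial>jobs) =
      (\<integral>\<^sup>+c. \<integral>\<^sup>+w. indicator (in_service 0) (c, w) * indicator {z<..} (c + w) \<partial>\<sigma> \<partial>lborel)"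
    by (subst nn_integral_jobs) simp_all
  also have "\<dots> = (\<integral>\<^sup>+c. \<integral>\<^sup>+w. indicator {..0} c * indicator {z - c<..} w \<partial>\<sigma> \<partial>lborel)"
    using assms by (intro nn_integral_cong) (auto simp: in_service_def indicator_def)
  also have "\<dots> = (\<integral>\<^sup>+c. indicator {..0} c * emeasure \<sigma> {z - c<..} \<partial>lborel)"
    by (simp add: nn_integral_cmult)
  also have "\<dots> = (\<integral>\<^sup>+y. indicator {..0} (z - y) * emeasure \<sigma> {z - (z - y)<..} \<partial>lborel)"
    by (subst nn_integral_real_affine[where c="-1" and t=z]) simp_all
  also have "\<dots> = (\<integral>\<^sup>+y. indicator {z<..} y * emeasure \<sigma> {y<..} \<partial>lborel)"
    by (rule nn_integral_cong_AE, rule AE_mp[OF AE_lborel_singleton[of z]], rule AE_I2) (auto simp: indicator_def)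
  finally show ?thesis .
qed

lemma nn_integral_tail:
  assumes "AE w in \<sigma>. 0 \<le> w"
  shows "(\<integral>\<^sup>+y. indicator {0<..} y * emeasure \<sigma> {y<..} \<partial>lborel) = (\<integral>\<^sup>+w. ennreal w \<partial>\<sigma>)"
proof -
  have "(\<integral>\<^sup>+y. indicator {0<..} y * emeasure \<sigma> {y<..} \<partial>lborel) =
      (\<integral>\<^sup>+y. \<integral>\<^sup>+w. indicator {0<..} y * indicator {y<..} w \<partial>\<sigma> \<partial>lborel)"
    by (simp add: nn_integral_cmult)
  also have "\<dots> = (\<integral>\<^sup>+w. \<integral>\<^sup>+y. indicator {0<..} y * indicator {y<..} w \<partial>lborel \<partial>\<sigma>)"
    by (rule pair_sigma_finite.Fubini') (unfold_locales, measurable)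
  also have "\<dots> = (\<integral>\<^sup>+w. ennreal w \<partial>\<sigma>)"
  proof (rule nn_integral_cong_AE, rule AE_mp[OF assms], rule AE_I2, rule impI)
    fix w :: real assume "0 \<le> w"
    have "(\<integral>\<^sup>+y. indicator {0<..} y * indicator {y<..} w \<partial>lborel) = (\<integral>\<^sup>+y. indicator {0<..<w} y \<partial>lborel)"
      by (intro nn_integral_cong) (auto simp: indicator_def)
    also have "\<dots> = ennreal w"
      using \<open>0 \<le> w\<close> by simp
    finally show "(\<integral>\<^sup>+y. indicator {0<..} y * indicator {y<..} w \<partial>lborel) = ennreal w" .
  qed
  finally show ?thesis .
qed

text \<open>If jobs have been arriving at unit rate forever, those present at time
  \<open>0\<close> have total mass \<open>1 / \<mu>\<close>, the mean service time, and their
  departure times are distributed as residual lives.\<close>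

definition residual_law :: "real \<Rightarrow> real measure" where
  "residual_law \<mu> = distr (density jobs (\<lambda>p. ennreal \<mu> * indicator (in_service 0) p)) borel (\<lambda>p. fst p + snd p)"

lemma sets_residual_law [measurable_cong, simp]: "sets (residual_law \<mu>) = sets borel"
  by (simp add: residual_law_def)

lemma space_residual_law [simp]: "space (residual_law \<mu>) = UNIV"
  by (simp add: residual_law_def)

lemma nn_integral_residual_law:
  assumes [measurable]: "f \<in> borel_measurable borel"
  shows "(\<integral>\<^sup>+r. f r \<partial>residual_law \<mu>) =
    ennreal \<mu> * (\<integral>\<^sup>+p. indicator (in_service 0) p * f (fst p + snd p) \<partial>jobs)"
  unfolding residual_law_def
  by (simp add: nn_integral_distr nn_integral_density mult.assoc nn_integral_cmult)

lemma emeasure_residual_law_tail: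
  assumes "0 \<le> z"
  shows "emeasure (residual_law \<mu>) {z<..} =
    ennreal \<mu> * (\<integral>\<^sup>+y. indicator {z<..} y * emeasure \<sigma> {y<..} \<partial>lborel)"
  using nn_integral_residual_law[of "indicator {z<..}" \<mu>] assms by (simp add: in_service_tail)

lemma
  assumes "AE w in \<sigma>. 0 \<le> w" "(\<integral>\<^sup>+w. ennreal w \<partial>\<sigma>) = ennreal (1 / \<mu>)" "0 < \<mu>"
  shows residual_law_pos: "emeasure (residual_law \<mu>) {0<..} = 1"
    and prob_space_residual_law: "prob_space (residual_law \<mu>)"
proof -
  show pos: "emeasure (residual_law \<mu>) {0<..} = 1"
    using assms by (simp add: emeasure_residual_law_tail nn_integral_tail flip: ennreal_mult)
  have "indicator (in_service 0) p * indicator {0<..} (fst p + snd p) = (indicator (in_service 0) p :: ennreal)" for p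
    by (auto simp: indicator_def in_service_def)
  then have "emeasure (residual_law \<mu>) UNIV = emeasure (residual_law \<mu>) {0<..}"
    using nn_integral_residual_law[of "indicator UNIV" \<mu>] nn_integral_residual_law[of "indicator {0<..}" \<mu>]
    by (simp del: indicator_simps)
  with pos show "prob_space (residual_law \<mu>)"
    by (intro prob_spaceI) simp
qed

end

lemma service_law_distr:
  assumes "positive_rv_with_rate P X \<mu>" "prob_space P"
  shows "service_law (distr P borel X)" "AE w in distr P borel X. 0 \<le> w" "AE w in distr P borel X. 0 < w"
    "(\<integral>\<^sup>+w. ennreal w \<partial>distr P borel X) = ennreal (1 / \<mu>)" "0 < \<mu>"
proof -
  interpret P: prob_space P by fact
  have X [measurable]: "X \<in> borel_measurable P" and nonneg: "AE \<omega> in P. 0 \<le> X \<omega>"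
    and nz: "AE \<omega> in P. X \<omega> \<noteq> 0" and int: "integrable P X" and mean: "(\<integral>\<omega>. X \<omega> \<partial>P) = inverse \<mu>"
    using assms(1) by (auto simp: positive_rv_with_rate_def)
  show "service_law (distr P borel X)"
    unfolding service_law_def service_law_axioms_def by (simp add: P.prob_space_distr)
  show "AE w in distr P borel X. 0 \<le> w"
    using nonneg by (subst AE_distr_iff) simp_all
  show "AE w in distr P borel X. 0 < w"
    using nonneg nz by (subst AE_distr_iff) auto
  show "0 < \<mu>"
    using assms(1) by (simp add: positive_rv_with_rate_def)
  have "(\<integral>\<^sup>+w. ennreal w \<partial>distr P borel X) = (\<integral>\<^sup>+\<omega>. ennreal (X \<omega>) \<partial>P)"
    by (rule nn_integral_distr) simp_all
  also have "\<dots> = ennreal (1 / \<mu>)"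
    using nn_integral_eq_integral[OF int nonneg] mean by (simp add: inverse_eq_divide)
  finally show "(\<integral>\<^sup>+w. ennreal w \<partial>distr P borel X) = ennreal (1 / \<mu>)" .
qed

lemma residual_life_tail:
  assumes rl: "residual_life M R P X" and X: "positive_rv_with_rate P X \<mu>" and "prob_space P" "prob_space M" and "0 \<le> z"
  shows "emeasure (distr M borel R) {z<..} =
    ennreal \<mu> * (\<integral>\<^sup>+y. indicator {z<..} y * emeasure (distr P borel X) {y<..} \<partial>lborel)"
proof -
  interpret P: prob_space P by fact
  interpret M: prob_space M by fact
  interpret service_law "distr P borel X"
    by (rule service_law_distr) fact+
  have [measurable]: "X \<in> borel_measurable P" "R \<in> borel_measurable M"
    using X rl by (auto simp: positive_rv_with_rate_def residual_life_def)
  have mean: "(\<integral>\<omega>. X \<omega> \<partial>P) = inverse \<mu>" and \<mu>: "0 < \<mu>"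
    using X by (auto simp: positive_rv_with_rate_def)
  let ?g = "\<lambda>y. emeasure (distr P borel X) {y<..}"
  have g: "?g y = ennreal (measure P {\<omega> \<in> space P. y < X \<omega>})" for y
  proof -
    have "?g y = emeasure P (X -` {y<..} \<inter> space P)"
      by (rule emeasure_distr) simp_all
    also have "X -` {y<..} \<inter> space P = {\<omega> \<in> space P. y < X \<omega>}"
      by auto
    finally show ?thesis
      by (simp add: P.emeasure_eq_measure)
  qed
  have [measurable]: "(\<lambda>y. measure P {\<omega> \<in> space P. y < X \<omega>}) \<in> borel_measurable borel"
  proof -
    have "(\<lambda>y. enn2real (?g y)) \<in> borel_measurable borel"
      by measurable
    then show ?thesis
      by (simp add: g)
  qed
  let ?I = "\<integral>\<^sup>+y. indicator {z<..} y * ?g y \<partial>lborel"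
  have "?I \<le> (\<integral>\<^sup>+y. indicator {0<..} y * ?g y \<partial>lborel)"
    using \<open>0 \<le> z\<close> by (intro nn_integral_mono) (auto simp: indicator_def)
  also have "\<dots> = ennreal (1 / \<mu>)"
    using service_law_distr[OF X \<open>prob_space P\<close>] by (simp add: nn_integral_tail)
  finally have fin: "?I < \<top>"
    by (rule order.strict_trans1) simp
  have "(LBINT y:{z<..}. measure P {\<omega> \<in> space P. y < X \<omega>}) =
      enn2real (\<integral>\<^sup>+y. ennreal (indicator {z<..} y * measure P {\<omega> \<in> space P. y < X \<omega>}) \<partial>lborel)"
    unfolding set_lebesgue_integral_def by (subst integral_eq_nn_integral) simp_all
  also have "(\<integral>\<^sup>+y. ennreal (indicator {z<..} y * measure P {\<omega> \<in> space P. y < X \<omega>}) \<partial>lborel) = ?I"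
    by (intro nn_integral_cong) (auto simp: g indicator_def)
  finally have LB: "(LBINT y:{z<..}. measure P {\<omega> \<in> space P. y < X \<omega>}) = enn2real ?I" .
  have "emeasure (distr M borel R) {z<..} = emeasure M (R -` {z<..} \<inter> space M)"
    by (rule emeasure_distr) simp_all
  also have "R -` {z<..} \<inter> space M = {\<omega> \<in> space M. z < R \<omega>}"
    by auto
  also have "emeasure M {\<omega> \<in> space M. z < R \<omega>} = ennreal (\<mu> * enn2real ?I)"
    using rl \<open>0 \<le> z\<close> mean LB by (simp add: M.emeasure_eq_measure residual_life_def)
  also have "\<dots> = ennreal \<mu> * ?I"
    using \<mu> fin by (simp add: ennreal_mult)
  finally show ?thesis .
qed

lemma residual_life_positive:
  assumes "residual_life M R P X" and "positive_rv_with_rate P X \<mu>" and "prob_space P" "prob_space M"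
  shows "emeasure (distr M borel R) {0<..} = 1"
proof -
  interpret service_law "distr P borel X"
    by (rule service_law_distr) fact+
  show ?thesis
    using residual_life_tail[OF assms, of 0] service_law_distr[OF assms(2,3)]
    by (simp add: nn_integral_tail flip: ennreal_mult)
qed

text \<open>The tail at \<open>z = 0\<close> has probability one by the layer-cake formula, which
  also fixes the tails at negative \<open>z\<close>.\<close>

lemma residual_life_eqI:
  assumes rl: "residual_life M R P X" and X: "positive_rv_with_rate P X \<mu>" and P: "prob_space P" "prob_space M"
    and N: "sets N = sets borel" "prob_space N" "emeasure N {0<..} = 1"
      "\<And>z. 0 \<le> z \<Longrightarrow> emeasure N {z<..} =
        ennreal \<mu> * (\<integral>\<^sup>+y. indicator {z<..} y * emeasure (distr P borel X) {y<..} \<partial>lborel)"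
  shows "distr M borel R = N"
proof (rule measure_eqI_lessThan)
  have R: "R \<in> borel_measurable M"
    using rl by (simp add: residual_life_def)
  interpret D: prob_space "distr M borel R"
    using P(2) R by (rule prob_space.prob_space_distr)
  interpret N: prob_space N by fact
  show "emeasure (distr M borel R) {z<..} = emeasure N {z<..}" for z
  proof (cases "0 \<le> z")
    case True
    then show ?thesis
      by (simp add: residual_life_tail[OF rl X P] N)
  next
    case False
    then have "{0<..} \<subseteq> {z<..}"
      by auto
    then have "1 \<le> emeasure (distr M borel R) {z<..}" "1 \<le> emeasure N {z<..}"
      using emeasure_mono[of "{0<..}" "{z<..}" "distr M borel R"] emeasure_mono[of "{0<..}" "{z<..}" N]
        residual_life_positive[OF rl X P] N(1,3) by simp_all
    then show ?thesis
      using D.emeasure_le_1[of "{z<..}"] N.emeasure_le_1[of "{z<..}"] by simp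
  qed
  show "emeasure (distr M borel R) {z<..} < \<infinity>" for z
    by (simp add: D.emeasure_eq_measure)
qed (use N in simp_all)

lemma distr_residual_life:
  assumes rl: "residual_life M R P X" and X: "positive_rv_with_rate P X \<mu>" and P: "prob_space P" "prob_space M"
  shows "distr M borel R = service_law.residual_law (distr P borel X) \<mu>"
proof -
  interpret service_law "distr P borel X"
    by (rule service_law_distr[OF X P(1)])
  note law = service_law_distr(2,4,5)[OF X P(1)]
  show ?thesis
    by (rule residual_life_eqI[OF rl X P])
      (simp_all add: emeasure_residual_law_tail residual_law_pos[OF law] prob_space_residual_law[OF law])
qed

lemma distr_exponential:
  "distributed P lborel A (\<lambda>x. ennreal (exponential_density l x)) \<Longrightarrow> distr P borel A = exp_law l"
  unfolding exp_law_def by (simp add: distributed_distr_eq_density[symmetric] cong: distr_cong)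

text \<open>The density of the exponential law is \<open>l\<close> times its own tail, so the law
  is its own residual law.\<close>

lemma distr_residual_life_exponential:
  assumes rl: "residual_life M R P A" and A: "positive_rv_with_rate P A l" and P: "prob_space P" "prob_space M"
    and exp: "distributed P lborel A (\<lambda>x. ennreal (exponential_density l x))"
  shows "distr M borel R = exp_law l"
proof -
  have l: "0 < l"
    using A by (simp add: positive_rv_with_rate_def)
  interpret P: prob_space P by fact
  note law = distr_exponential[OF exp]
  have exp_tail: "emeasure (exp_law l) {y<..} = ennreal (exp (- l * y))" if "0 \<le> y" for y
    using exp_law_memoryless[where f="\<lambda>_. 1" and l=l, OF borel_measurable_const that] prob_space.emeasure_space_1[OF prob_space_exp_law[OF l]]
    by simp
  show ?thesis
  proof (rule residual_life_eqI[OF rl A P])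
    show "prob_space (exp_law l)"
      using l by (rule prob_space_exp_law)
    show "emeasure (exp_law l) {0<..} = 1"
      by (simp add: exp_tail)
    fix z :: real assume "0 \<le> z"
    have "emeasure (exp_law l) {z<..} = (\<integral>\<^sup>+y. indicator {z<..} y \<partial>exp_law l)"
      by simp
    also have "\<dots> = (\<integral>\<^sup>+y. ennreal (exponential_density l y) * indicator {z<..} y \<partial>lborel)"
      using nn_integral_exp_law_shift[where f="indicator {z<..}" and \<tau>=0] by simp
    also have "\<dots> = (\<integral>\<^sup>+y. ennreal l * (indicator {z<..} y * emeasure (exp_law l) {y<..}) \<partial>lborel)"
      using l \<open>0 \<le> z\<close>
      by (intro nn_integral_cong) (auto simp: exp_tail indicator_def exponential_density_def ennreal_mult mult.commute)
    also have "\<dots> = ennreal l * (\<integral>\<^sup>+y. indicator {z<..} y * emeasure (exp_law l) {y<..} \<partial>lborel)"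
    proof (rule nn_integral_cmult)
      interpret E: service_law "exp_law l"
        using l by (simp add: service_law_def service_law_axioms_def prob_space_exp_law)
      show "(\<lambda>y. indicator {z<..} y * emeasure (exp_law l) {y<..}) \<in> borel_measurable lborel"
        by measurable
    qed
    finally show "emeasure (exp_law l) {z<..} =
        ennreal l * (\<integral>\<^sup>+y. indicator {z<..} y * emeasure (distr P borel A) {y<..} \<partial>lborel)"
      unfolding law .
  qed simp
qed

section \<open>Renewal counts\<close>

unbundle no vec_syntax
unbundle fps_syntax

lemma event_count_eq_iff:
  fixes y :: "nat \<Rightarrow> real"
  assumes y: "\<And>i. 0 \<le> y i" and fin: "finite {k. (\<Sum>j\<le>k. y j) \<le> t}"
  shows "event_count y t = m \<longleftrightarrow> t < (\<Sum>j\<le>m. y j) \<and> (\<forall>k<m. (\<Sum>j\<le>k. y j) \<le> t)"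
proof -
  let ?S = "\<lambda>k. \<Sum>j\<le>k. y j"
  let ?K = "{k. ?S k \<le> t}"
  have mono: "?S i \<le> ?S k" if "i \<le> k" for i k
    using that by (intro sum_mono2) (auto intro: y)
  have "?K = {..<m}" if "t < ?S m" "\<forall>k<m. ?S k \<le> t" for m
  proof -
    have "k < m" if "?S k \<le> t" for k
      using mono[of m k] \<open>t < ?S m\<close> that by (meson leI order.strict_trans2 not_le)
    with that show ?thesis
      by auto
  qed
  then have 1: "event_count y t = m" if "t < ?S m" "\<forall>k<m. ?S k \<le> t" for m
    using that by (simp add: event_count_def)
  obtain m' where "\<not> ?S m' \<le> t"
    using fin infinite_UNIV_nat by (metis (mono_tags, lifting) UNIV_I finite_subset mem_Collect_eq subsetI)
  define m0 where "m0 = (LEAST k. \<not> ?S k \<le> t)"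
  have "t < ?S m0" "\<forall>k<m0. ?S k \<le> t"
    using LeastI[of "\<lambda>k. \<not> ?S k \<le> t", OF \<open>\<not> ?S m' \<le> t\<close>] not_less_Least[of _ "\<lambda>k. \<not> ?S k \<le> t"]
    by (auto simp: m0_def not_le not_less)
  with 1 show ?thesis
    by metis
qed

text \<open>Exactly \<open>m\<close> events up to time \<open>t\<close>, when the next event
  happens at \<open>r\<close> and \<open>w\<close> are the subsequent inter-event times. Unlike
  \<open>event_count\<close>, this can be unfolded one event at a time.\<close>

fun has_count :: "real \<Rightarrow> nat \<Rightarrow> real \<Rightarrow> (nat \<Rightarrow> real) \<Rightarrow> bool" where
  "has_count t 0 r w \<longleftrightarrow> t < r"
| "has_count t (Suc m) r w \<longleftrightarrow> r \<le> t \<and> has_count t m (r + w 0) (\<lambda>i. w (Suc i))"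

lemma has_count_iff:
  "has_count t m r w \<longleftrightarrow> t < r + (\<Sum>j<m. w j) \<and> (\<forall>k<m. r + (\<Sum>j<k. w j) \<le> t)"
proof (induction m arbitrary: r w)
  case (Suc m)
  have "(\<forall>k<Suc m. r + (\<Sum>j<k. w j) \<le> t) \<longleftrightarrow> r \<le> t \<and> (\<forall>k<m. r + (\<Sum>j<Suc k. w j) \<le> t)"
    by (auto simp: less_Suc_eq_0_disj)
  then show ?case
    by (simp add: Suc.IH sum.lessThan_Suc_shift add.assoc del: sum.lessThan_Suc) blast
qed simp

lemma event_count_iff_has_count:
  assumes "\<And>i. 0 \<le> y i" and "finite {k. (\<Sum>j\<le>k. y j) \<le> t}"
  shows "event_count y t = m \<longleftrightarrow> has_count t m (y 0) (\<lambda>i. y (Suc i))"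
  unfolding event_count_eq_iff[OF assms] has_count_iff sum.atMost_shift by simp

context service_law
begin

primrec count_prob :: "real \<Rightarrow> nat \<Rightarrow> real \<Rightarrow> ennreal" where
  "count_prob t 0 r = indicator {t<..} r"
| "count_prob t (Suc m) r = indicator {..t} r * (\<integral>\<^sup>+w. count_prob t m (r + w) \<partial>\<sigma>)"

lemma measurable_count_prob [measurable]: "count_prob t m \<in> borel_measurable borel"
proof (induction m)
  case 0
  have "count_prob t 0 = indicator {t<..}"
    by (simp add: fun_eq_iff)
  then show ?case
    by simp
next
  case (Suc m)
  note [measurable] = Suc
  have "(\<lambda>r. indicator {..t} r * (\<integral>\<^sup>+w. count_prob t m (r + w) \<partial>\<sigma>)) \<in> borel_measurable borel"
    by measurable
  then show ?case
    by simp
qed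

lemma count_prob_shift: "count_prob (t + c) m (r + c) = count_prob t m r"
proof (induction m arbitrary: r)
  case (Suc m)
  have "count_prob (t + c) m (r + c + w) = count_prob t m (r + w)" for w
    using Suc[of "r + w"] by (simp add: ac_simps)
  then show ?case
    by (simp add: indicator_def)
qed (simp add: indicator_def)

lemmas sets_iid_law [measurable_cong] = sets_iid[OF sets_law]

lemma measurable_has_count [measurable]:
  assumes "f \<in> borel_measurable M" "w \<in> M \<rightarrow>\<^sub>M iid borel"
  shows "Measurable.pred M (\<lambda>z. has_count t m (f z) (w z))"
  using assms
proof (induction m arbitrary: f w)
  case (Suc m)
  note [measurable] = Suc.prems
  have "Measurable.pred M (\<lambda>z. has_count t m (f z + w z 0) (\<lambda>i. w z (Suc i)))"
    by (rule Suc.IH) measurable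
  then show ?case
    by simp
qed simp

lemma nn_integral_has_count:
  "(\<integral>\<^sup>+w. of_bool (has_count t m r w) \<partial>iid \<sigma>) = count_prob t m r"
proof (induction m arbitrary: r)
  case 0
  interpret W: prob_space "iid \<sigma>"
    by (rule prob_space_iid) unfold_locales
  show ?case
    by (simp add: indicator_def W.emeasure_space_1)
next
  case (Suc m)
  have m: "Measurable.pred (iid \<sigma>) (\<lambda>w. has_count t k r w)" for k r
    by (rule measurable_has_count) (simp_all add: measurable_iid_ident[OF sets_law])
  have "(\<integral>\<^sup>+w. of_bool (has_count t (Suc m) r w) \<partial>iid \<sigma>) =
      (\<integral>\<^sup>+x. \<integral>\<^sup>+w. of_bool (has_count t (Suc m) r (case_nat x w)) \<partial>iid \<sigma> \<partial>\<sigma>)"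
    using m by (intro nn_integral_iid_case_nat) (unfold_locales, measurable)
  also have "\<dots> = (\<integral>\<^sup>+x. indicator {..t} r * count_prob t m (r + x) \<partial>\<sigma>)"
    by (cases "r \<le> t") (simp_all add: Suc.IH)
  also have "\<dots> = count_prob t (Suc m) r"
    by (simp add: nn_integral_cmult)
  finally show ?case .
qed

text \<open>Coefficients are taken in the extended nonnegative reals, so that integrals commute
  with products of power series without integrability conditions.\<close>

definition count_gf :: "real \<Rightarrow> real \<Rightarrow> ennreal fps" where
  "count_gf t r = Abs_fps (\<lambda>m. count_prob t m r)"

definition counts_gf :: "real \<Rightarrow> real list \<Rightarrow> ennreal fps" where
  "counts_gf t rs = (\<Prod>r\<in>#mset rs. count_gf t r)"

lemma count_gf_gt: "t < r \<Longrightarrow> count_gf t r = 1"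
proof (rule fps_ext)
  fix m assume "t < r"
  then show "count_gf t r $ m = 1 $ m"
    by (cases m) (simp_all add: count_gf_def)
qed

lemma count_gf_le:
  assumes "r \<le> t"
  shows "count_gf t r $ 0 = 0" "count_gf t r $ Suc m = (\<integral>\<^sup>+w. count_gf t (r + w) $ m \<partial>\<sigma>)"
  using assms by (simp_all add: count_gf_def)

lemma measurable_count_gf [measurable]: "(\<lambda>r. count_gf t r $ m) \<in> borel_measurable borel"
  by (simp add: count_gf_def)

lemma counts_gf_Nil [simp]: "counts_gf t [] = 1"
  by (simp add: counts_gf_def)

lemma counts_gf_Cons: "counts_gf t (r # rs) = count_gf t r * counts_gf t rs"
  by (simp add: counts_gf_def)

lemma symmetric_counts_gf: "symmetric (\<lambda>rs. f (counts_gf t rs))"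
  unfolding counts_gf_def by (rule symmetric_mset)

lemma counts_gf_remove1: "r \<in> set rs \<Longrightarrow> counts_gf t rs = count_gf t r * counts_gf t (remove1 r rs)"
  unfolding counts_gf_def mset_remove1
  by (metis (no_types, lifting) image_mset_add_mset insert_DiffM prod_mset.add_mset set_mset_mset)

lemma counts_gf_gt: "\<forall>r\<in>set rs. t < r \<Longrightarrow> counts_gf t rs = 1"
  by (induction rs) (simp_all add: counts_gf_Cons count_gf_gt)

text \<open>The saturated system feeds all servers from one sequence of service times, whereas the
  product on the right belongs to independent servers with sequences of their own. Both sides
  satisfy the same recursion: if the first departure happens at \<open>r \<le> t\<close>, the
  factor \<open>count_gf t r\<close> is \<open>X\<close> times the mean of \<open>count_gf t (r +
  w)\<close> over the next service time \<open>w\<close>, and the other factors are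
  unchanged.\<close>

lemma nn_integral_all_busy:
  assumes nonneg: "AE w in \<sigma>. 0 \<le> w" and "rs \<noteq> []"
  shows "(\<integral>\<^sup>+w. of_bool (all_busy t d rs w) \<partial>iid \<sigma>) = (\<Sum>m\<le>d. counts_gf t rs $ m)"
  using \<open>rs \<noteq> []\<close>
proof (induction d arbitrary: rs)
  case 0
  interpret W: prob_space "iid \<sigma>"
    by (rule prob_space_iid) unfold_locales
  show ?case
  proof (cases "\<forall>r\<in>set rs. t < r")
    case True
    then show ?thesis
      by (simp add: counts_gf_gt W.emeasure_space_1)
  next
    case False
    then obtain r where "r \<in> set rs" "r \<le> t"
      by (auto simp: not_less)
    then have "counts_gf t rs $ 0 = 0"
      by (simp add: counts_gf_remove1[of r] fps_mult_nth_0 count_gf_le)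
    then show ?thesis
      using False by simp
  qed
next
  case (Suc d)
  define r where "r = Min (set rs)"
  define rs' where "rs' = remove1 r rs"
  have r: "r \<in> set rs"
    using Suc.prems by (simp add: r_def)
  have next_rs: "serve_next w rs = (r + w) # rs'" for w
    by (simp add: serve_next_def r_def rs'_def)
  have m: "Measurable.pred (iid \<sigma>) (\<lambda>w. all_busy t k zs w)" for k zs
    by (rule measurable_all_busy) (simp_all add: measurable_iid_component[OF sets_law])
  have "(\<integral>\<^sup>+w. of_bool (all_busy t (Suc d) rs w) \<partial>iid \<sigma>) =
      (\<integral>\<^sup>+x. \<integral>\<^sup>+w. of_bool (all_busy t (Suc d) rs (case_nat x w)) \<partial>iid \<sigma> \<partial>\<sigma>)"
    using m by (intro nn_integral_iid_case_nat) (unfold_locales, measurable)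
  also have "\<dots> = (\<integral>\<^sup>+x. (\<Sum>m\<le>d. counts_gf t ((r + x) # rs') $ m) \<partial>\<sigma>)"
    by (simp add: next_rs Suc.IH)
  also have "\<dots> = (\<Sum>m\<le>Suc d. counts_gf t rs $ m)"
  proof (cases "t < r")
    case True
    then have all: "\<forall>z\<in>set rs. t < z"
      using Suc.prems by (simp add: r_def)
    then have "\<forall>z\<in>set rs'. t < z"
      using set_remove1_subset[of r rs] by (auto simp: rs'_def)
    then have "AE x in \<sigma>. counts_gf t ((r + x) # rs') = 1"
      using nonneg True by (elim AE_mp) (auto intro!: AE_I2 counts_gf_gt)
    then have "(\<integral>\<^sup>+x. (\<Sum>m\<le>d. counts_gf t ((r + x) # rs') $ m) \<partial>\<sigma>) = (\<integral>\<^sup>+x. (\<Sum>m\<le>d. (1 :: ennreal fps) $ m) \<partial>\<sigma>)"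
      by (intro nn_integral_cong_AE) auto
    also have "\<dots> = (\<Sum>m\<le>Suc d. counts_gf t rs $ m)"
      using all by (simp add: counts_gf_gt emeasure_space_1)
    finally show ?thesis .
  next
    case False
    have "(\<integral>\<^sup>+x. (\<Sum>m\<le>d. counts_gf t ((r + x) # rs') $ m) \<partial>\<sigma>) =
        (\<Sum>m\<le>d. \<Sum>j=0..m. count_gf t r $ Suc j * counts_gf t rs' $ (m - j))"
      using False
      by (simp add: counts_gf_Cons fps_mult_nth nn_integral_sum nn_integral_multc count_gf_le not_less)
    also have "\<dots> = (\<Sum>m\<le>d. counts_gf t rs $ Suc m)"
    proof (intro sum.cong refl)
      fix m
      have "counts_gf t rs $ Suc m = (\<Sum>j=0..Suc m. count_gf t r $ j * counts_gf t rs' $ (Suc m - j))"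
        by (simp add: counts_gf_remove1[OF r] rs'_def fps_mult_nth)
      also have "\<dots> = (\<Sum>j=0..m. count_gf t r $ Suc j * counts_gf t rs' $ (m - j))"
        using False by (subst sum.atLeast0_atMost_Suc_shift) (simp add: count_gf_le not_less)
      finally show "(\<Sum>j=0..m. count_gf t r $ Suc j * counts_gf t rs' $ (m - j)) = counts_gf t rs $ Suc m" ..
    qed
    also have "\<dots> = (\<Sum>m\<le>Suc d. counts_gf t rs $ m)"
    proof -
      have "counts_gf t rs $ 0 = 0"
        using False by (simp add: counts_gf_remove1[OF r] fps_mult_nth_0 count_gf_le)
      then show ?thesis
        by (subst sum.atMost_Suc_shift) simp
    qed
    finally show ?thesis .
  qed
  finally show ?case .
qed

lemma counts_gf_shift: "counts_gf (t + c) (map (\<lambda>r. r + c) rs) = counts_gf t rs"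
  by (induction rs) (simp_all add: counts_gf_Cons count_gf_def count_prob_shift)

lemma measurable_counts_gf [measurable (raw)]:
  assumes xs: "xs \<in> M \<rightarrow>\<^sub>M list_space"
  shows "(\<lambda>\<omega>. counts_gf t (xs \<omega>) $ m) \<in> borel_measurable M"
proof (rule measurable_list_space_cases[OF xs])
  fix x :: "_ \<Rightarrow> nat \<Rightarrow> real" and k assume [measurable]: "\<And>i. (\<lambda>\<omega>. x \<omega> i) \<in> borel_measurable M"
  have "(\<lambda>\<omega>. counts_gf t (map (x \<omega>) js) $ m) \<in> borel_measurable M" for js m
  proof (induction js arbitrary: m)
    case (Cons j js)
    note [measurable] = Cons
    show ?case
      by (simp add: counts_gf_Cons fps_mult_nth)
  qed simp
  then show "(\<lambda>\<omega>. counts_gf t (map (x \<omega>) [0..<k]) $ m) \<in> borel_measurable M" .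
qed

definition mean_count_gf :: "real \<Rightarrow> real measure \<Rightarrow> ennreal fps" where
  "mean_count_gf t \<nu> = Abs_fps (\<lambda>m. \<integral>\<^sup>+r. count_prob t m r \<partial>\<nu>)"

lemma nn_integral_counts_gf:
  assumes "prob_space \<nu>" and [measurable_cong]: "sets \<nu> = sets borel"
  shows "(\<integral>\<^sup>+v. counts_gf t (map v (rev [0..<k])) $ m \<partial>iid \<nu>) = (mean_count_gf t \<nu> ^ k) $ m"
proof (induction k arbitrary: m)
  case 0
  interpret V: prob_space "iid \<nu>"
    by (rule prob_space_iid) fact
  show ?case
    by (simp add: V.emeasure_space_1)
next
  case (Suc k)
  have m: "(\<lambda>v. counts_gf t (map v js) $ m) \<in> borel_measurable (iid \<nu>)" for js m
    by (intro measurable_counts_gf measurable_map_list_space measurable_iid_component assms)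
  have snoc: "counts_gf t (map (case_nat x v) (rev [0..<Suc k])) = count_gf t x * counts_gf t (map v (rev [0..<k]))" for x v
    unfolding rev_upt_Suc by (simp add: counts_gf_def comp_def)
  have "(\<integral>\<^sup>+v. counts_gf t (map v (rev [0..<Suc k])) $ m \<partial>iid \<nu>) =
      (\<integral>\<^sup>+x. \<integral>\<^sup>+v. (count_gf t x * counts_gf t (map v (rev [0..<k]))) $ m \<partial>iid \<nu> \<partial>\<nu>)"
    unfolding snoc[symmetric] by (rule nn_integral_iid_case_nat[OF assms(1) m])
  also have "\<dots> = (\<Sum>j=0..m. (\<integral>\<^sup>+x. count_gf t x $ j \<partial>\<nu>) * (mean_count_gf t \<nu> ^ k) $ (m - j))"
    using m by (simp add: fps_mult_nth nn_integral_sum nn_integral_cmult nn_integral_multc Suc.IH)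
  also have "\<dots> = (mean_count_gf t \<nu> ^ Suc k) $ m"
    by (simp add: fps_mult_nth mean_count_gf_def count_gf_def)
  finally show ?case .
qed

end


section \<open>The overload event\<close>

text \<open>With \<open>a\<close> the number of arrivals during the \<open>s\<close> time units
  after \<open>T\<close>, this says that they exceed the departures from the saturated system
  started at \<open>T\<close> with departure times \<open>ys\<close> by more than
  \<open>q\<close>: \<open>a \<ge> q + 1\<close> and at most \<open>a - q - 1\<close> departures.
  Departure times are absolute, hence the horizon \<open>s + T\<close>; inter-arrival times count
  from \<open>T\<close>.\<close>

definition overload :: "nat \<Rightarrow> real \<Rightarrow> real \<Rightarrow> real list \<Rightarrow> (nat \<Rightarrow> real) \<Rightarrow> (nat \<Rightarrow> real) \<Rightarrow> bool" where
  "overload q T s ys u w \<longleftrightarrow>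
    q < event_count u s \<and> all_busy (s + T) (event_count u s - q - 1) ys w"

definition mean_overload ::
  "nat \<Rightarrow> nat \<Rightarrow> real \<Rightarrow> real \<Rightarrow> real list \<Rightarrow> (nat \<Rightarrow> real) \<Rightarrow> (nat \<Rightarrow> real) \<Rightarrow> ennreal" where
  "mean_overload n q T s xs u w =
    mean_sublists n (\<lambda>ys. of_bool (overload q T s ys u w)) (filter (\<lambda>x. T < x) xs)"

lemma run_arrivals_eq:
  "run_arrivals T post k \<tau> xs u w =
    of_bool ((\<forall>j<k. \<tau> + (\<Sum>i\<le>j. u i) \<le> T) \<and> T < \<tau> + (\<Sum>i\<le>k. u i)) *
    post (rev (map (\<lambda>j. \<tau> + (\<Sum>i\<le>j. u i) + w j) [0..<k]) @ xs)
      (case_nat (\<tau> + (\<Sum>i\<le>k. u i) - T) (\<lambda>i. u (Suc (k + i)))) (\<lambda>i. w (k + i))"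
proof (induction k arbitrary: \<tau> xs u w)
  case 0
  have sum_0: "(\<Sum>i\<le>0. u i) = u 0"
    by simp
  show ?case
    unfolding run_arrivals.simps add_0 sum_0 by (simp add: indicator_def)
next
  case (Suc k)
  have upt: "[0..<Suc k] = 0 # map Suc [0..<k]"
    by (simp add: map_Suc_upt upt_conv_Cons del: upt_Suc)
  have all: "(\<forall>j<Suc k. \<tau> + (\<Sum>i\<le>j. u i) \<le> T) \<longleftrightarrow> \<tau> + u 0 \<le> T \<and> (\<forall>j<k. \<tau> + (\<Sum>i\<le>Suc j. u i) \<le> T)"
    by (auto simp: less_Suc_eq_0_disj)
  show ?case
    unfolding run_arrivals.simps Suc.IH all upt
    by (simp add: sum.atMost_Suc_shift comp_def indicator_def add.assoc del: sum.atMost_Suc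
      cong del: nat.case_cong_weak) blast
qed

text \<open>At most one \<open>k\<close>, the number of arrivals up to \<open>T\<close>, gives a
  nonzero summand, and this summand is a mean of indicators. If it is positive, overload occurs
  for some sublist of length \<open>n\<close> of the jobs present in the infinite-server queue at
  \<open>T\<close>. These departure times belong to \<open>n\<close> different jobs of the real
  queue that arrived up to \<open>T\<close>, whatever the order \<open>l\<close> of the initial
  jobs, so \<open>number_in_system_ge\<close> applies.\<close>

lemma run_arrivals_le_queue:
  fixes u v w :: "nat \<Rightarrow> real"
  assumes n: "1 \<le> n" and u: "\<And>i. 0 \<le> u i" and w: "\<And>i. 0 \<le> w i"
    and l: "distinct l" "set l = {..<z}"
    and fin: "\<And>t. finite {k. (\<Sum>i\<le>k. u i) \<le> t}"
  shows "(\<Sum>k. run_arrivals T (mean_overload n q T s) k 0 (map v (rev [0..<z])) u w) \<le>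
    of_bool (n + Suc q \<le> number_in_system n (job_arrival z u) (job_processing z l v w) (s + T))"
proof -
  define R where "R k = run_arrivals T (mean_overload n q T s) k 0 (map v (rev [0..<z])) u w" for k
  define S where "S k = (\<Sum>i\<le>k. u i)" for k
  define u' where "u' k = (case_nat (S k - T) (\<lambda>i. u (Suc (k + i))) :: nat \<Rightarrow> real)" for k
  define xs where "xs k = rev (map (\<lambda>j. S j + w j) [0..<k]) @ map v (rev [0..<z])" for k
  have R: "R k = of_bool ((\<forall>j<k. S j \<le> T) \<and> T < S k) * mean_overload n q T s (xs k) (u' k) (\<lambda>i. w (k + i))" for k
    unfolding R_def run_arrivals_eq by (simp add: S_def u'_def xs_def)
  have S_mono: "S i \<le> S j" if "i \<le> j" for i j
    unfolding S_def using that u by (intro sum_mono2) auto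
  show ?thesis
  proof (cases "\<forall>k. R k = 0")
    case True
    then show ?thesis
      by (simp add: R_def)
  next
    case False
    then obtain k where k: "R k \<noteq> 0"
      by blast
    then have T: "\<And>j. j < k \<Longrightarrow> S j \<le> T" "T < S k"
      by (auto simp: R split: if_splits)
    have "R j = 0" if "j \<noteq> k" for j
    proof (cases "j < k")
      case True
      with T(1)[of j] show ?thesis
        by (simp add: R)
    next
      case False
      with that have "k < j"
        by simp
      with T(2) show ?thesis
        by (auto simp: R not_le)
    qed
    then have "(\<Sum>k. R k) = R k"
      by (subst suminf_finite[of "{k}"]) auto
    also have "R k \<le> 1"
    proof -
      have "mean_overload n q T s (xs k) (u' k) (\<lambda>i. w (k + i)) \<le> 1"
        unfolding mean_overload_def by (rule mean_sublists_le_1) simp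
      then show ?thesis
        by (simp add: R)
    qed
    finally have sum_le: "(\<Sum>k. R k) \<le> 1" .
    define a where "a = job_arrival z u"
    define p where "p = job_processing z l v w"
    have a_ge: "a (z + j) = S j" for j
      by (simp add: a_def job_arrival_def S_def)
    have a_lt: "a i = 0" if "i < z" for i
      using that by (simp add: a_def job_arrival_def)
    have p_ge: "p (z + j) = w j" for j
      by (simp add: p_def job_processing_def)
    have p_lt: "p i = v (l ! i)" if "i < z" for i
      using that by (simp add: p_def job_processing_def)
    have len: "length l = z"
      using l distinct_card[OF l(1)] by simp
    \<comment> \<open>the position in the order of priority of the initial job with label \<open>i\<close>\<close>
    define pos where "pos i = (THE j. j < z \<and> l ! j = i)" for i
    have pos: "pos i < z" "l ! pos i = i" if "i < z" for i
    proof -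
      have "\<exists>j. j < z \<and> l ! j = i"
        using that l(2) len by (metis in_set_conv_nth lessThan_iff)
      then have "\<exists>!j. j < z \<and> l ! j = i"
        using nth_eq_iff_index_eq[OF l(1)] len by auto
      from theI'[OF this] show "pos i < z" "l ! pos i = i"
        by (simp_all add: pos_def)
    qed
    define js0 where "js0 = map (\<lambda>j. z + j) (rev [0..<k]) @ map pos (rev [0..<z])"
    have "inj_on pos {0..<z}"
      by (rule inj_on_inverseI[of _ "\<lambda>j. l ! j"]) (use pos in auto)
    then have js0: "distinct js0" "set js0 \<subseteq> {..<z + k}"
      using pos by (fastforce simp: js0_def distinct_map inj_on_def)+
    have xs_js0: "xs k = map (\<lambda>j. a j + p j) js0"
      by (simp add: xs_def js0_def rev_map a_ge p_ge a_lt p_lt pos)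
    have "mean_overload n q T s (xs k) (u' k) (\<lambda>i. w (k + i)) \<noteq> 0"
      using k by (auto simp: R)
    then obtain ys where "ys \<in> set (sublists n (filter (\<lambda>x. T < x) (xs k)))"
        and "of_bool (overload q T s ys (u' k) (\<lambda>i. w (k + i))) \<noteq> (0 :: ennreal)"
      unfolding mean_overload_def by (rule mean_sublists_nonzeroD)
    then have "ys \<in> set (sublists n (xs k))" and over: "overload q T s ys (u' k) (\<lambda>i. w (k + i))"
      using sublists_filter by (auto split: if_splits)
    then obtain js where js: "js \<in> set (sublists n js0)" and ys: "ys = map (\<lambda>j. a j + p j) js"
      unfolding xs_js0 sublists_map by auto
    define m where "m = event_count (u' k) s"
    have u'_sum: "(\<Sum>j\<le>i. u' k j) = S (k + i) - T" for i
      by (induction i) (simp_all add: u'_def S_def)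
    have u'_nonneg: "0 \<le> u' k i" for i
      using T u by (cases i) (simp_all add: u'_def)
    have fin_S: "finite {i. S i \<le> t}" for t
      using fin by (simp add: S_def)
    have "finite {i. (\<Sum>j\<le>i. u' k j) \<le> s}"
    proof (rule finite_subset)
      show "{i. (\<Sum>j\<le>i. u' k j) \<le> s} \<subseteq> (\<lambda>i. i - k) ` {i. S i \<le> s + T}"
      proof
        fix i assume "i \<in> {i. (\<Sum>j\<le>i. u' k j) \<le> s}"
        then have "k + i \<in> {i. S i \<le> s + T}"
          by (simp add: u'_sum)
        then show "i \<in> (\<lambda>i. i - k) ` {i. S i \<le> s + T}"
          by (intro image_eqI[of _ _ "k + i"]) simp_all
      qed
    qed (use fin_S in simp)
    from event_count_eq_iff[OF u'_nonneg this, of m] have arr: "S (k + i) \<le> s + T" if "i < m" for i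
      using that by (auto simp: m_def u'_sum)
    have "n + Suc q \<le> number_in_system n a p (s + T)"
    proof (rule number_in_system_ge[OF n])
      show "a i \<le> a j" if "i \<le> j" for i j
      proof (cases "i < z")
        case True
        have "0 \<le> a j"
          by (cases "j < z") (use u in \<open>auto simp: a_def job_arrival_def intro: sum_nonneg\<close>)
        with True show ?thesis
          by (simp add: a_lt)
      next
        case False
        with that S_mono[of "i - z" "j - z"] a_ge[of "i - z"] a_ge[of "j - z"] show ?thesis
          by simp
      qed
      show "0 \<le> p (z + k + i)" for i
        using w p_ge[of "k + i"] by (simp add: add.assoc)
      show "finite {j. a j \<le> s + T}"
      proof (rule finite_subset)
        show "{j. a j \<le> s + T} \<subseteq> {..<z} \<union> (\<lambda>i. z + i) ` {i. S i \<le> s + T}"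
        proof
          fix j assume j: "j \<in> {j. a j \<le> s + T}"
          show "j \<in> {..<z} \<union> (\<lambda>i. z + i) ` {i. S i \<le> s + T}"
          proof (cases "j < z")
            case False
            then have "j = z + (j - z)"
              by simp
            with j a_ge[of "j - z"] show ?thesis
              by (intro UnI2 image_eqI[of _ _ "j - z"]) simp_all
          qed simp
        qed
      qed (use fin_S in simp)
      show "distinct js" "length js = n" "set js \<subseteq> {..<z + k}"
        using sublistsD[OF js] js0 by auto
      show "all_busy (s + T) (m - q - 1) (map (\<lambda>j. a j + p j) js) (\<lambda>i. p (z + k + i))"
        using over by (simp add: overload_def ys m_def add.assoc p_ge)
      show "a (z + k + i) \<le> s + T" if "i < m - q - 1 + Suc q" for i
        using that over arr[of i] by (simp add: overload_def add.assoc a_ge flip: m_def)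
    qed simp
    with sum_le show ?thesis
      by (simp add: R_def a_def p_def)
  qed
qed

lemma measurable_event_count [measurable (raw)]:
  assumes [measurable]: "u \<in> M \<rightarrow>\<^sub>M iid borel"
  shows "(\<lambda>\<omega>. event_count (u \<omega>) t) \<in> M \<rightarrow>\<^sub>M count_space UNIV"
proof -
  have "{\<omega> \<in> space M. k \<in> {k. (\<Sum>j\<le>k. u \<omega> j) \<le> t}} \<in> sets M" for k
    by simp
  then show ?thesis
    unfolding event_count_def by (rule measurable_card)
qed

lemma measurable_overload:
  assumes ys: "ys \<in> M \<rightarrow>\<^sub>M list_space" and u: "u \<in> M \<rightarrow>\<^sub>M iid borel" and w: "w \<in> M \<rightarrow>\<^sub>M iid borel"
  shows "(\<lambda>z. of_bool (overload q T s (ys z) (u z) (w z)) :: ennreal) \<in> borel_measurable M"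
proof -
  have count: "(\<lambda>z. event_count (u z) s) \<in> M \<rightarrow>\<^sub>M count_space UNIV"
    using u by (rule measurable_event_count)
  have "(\<lambda>z. q < a \<and> all_busy (s + T) (a - q - 1) (ys z) (w z)) \<in> M \<rightarrow>\<^sub>M count_space UNIV" for a
  proof (intro pred_intros_logic measurable_all_busy ys)
    show "(\<lambda>z. w z i) \<in> borel_measurable M" for i
      by (rule measurable_compose[OF w measurable_component_singleton]) simp
  qed simp
  from measurable_compose_countable[OF this count]
  have [measurable]: "Measurable.pred M (\<lambda>z. overload q T s (ys z) (u z) (w z))"
    by (simp add: overload_def)
  show ?thesis
    by measurable
qed

lemma measurable_mean_overload:
  assumes "f \<in> M \<rightarrow>\<^sub>M list_space" "g \<in> M \<rightarrow>\<^sub>M iid borel" "h \<in> M \<rightarrow>\<^sub>M iid borel"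
  shows "(\<lambda>z. mean_overload n q T s (f z) (g z) (h z)) \<in> borel_measurable M"
  unfolding mean_overload_def
  by (intro measurable_mean_sublists measurable_filter_list_space measurable_overload assms)

lemma nn_integral_iid_distinct:
  assumes "prob_space \<nu>" and sets_\<nu>: "sets \<nu> = sets borel"
    and f: "f \<in> borel_measurable list_space" and "distinct ks" "distinct js" "length ks = length js"
  shows "(\<integral>\<^sup>+v. f (map v ks) \<partial>iid \<nu>) = (\<integral>\<^sup>+v. f (map v js) \<partial>iid \<nu>)"
proof -
  have *: "(\<integral>\<^sup>+v. f (map v ks) \<partial>iid \<nu>) = (\<integral>\<^sup>+y. f (map y [0..<n]) \<partial>PiM {..<n} (\<lambda>_. \<nu>))"
    if "distinct ks" "length ks = n" for ks n
  proof -
    let ?t = "\<lambda>v. \<lambda>i\<in>{..<n}. v (ks ! i)"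
    have comp: "(\<lambda>y. y i) \<in> borel_measurable (PiM {..<n} (\<lambda>_. \<nu>))" if "i < n" for i
      using measurable_component_singleton[of i "{..<n}" "\<lambda>_. \<nu>"] that
      by (simp add: measurable_cong_sets[OF refl sets_\<nu>])
    have m: "(\<lambda>y. map y [0..<n]) \<in> PiM {..<n} (\<lambda>_. \<nu>) \<rightarrow>\<^sub>M list_space"
    proof -
      have "(\<lambda>y. map (\<lambda>i. if i < n then y i else 0) [0..<n]) \<in> PiM {..<n} (\<lambda>_. \<nu>) \<rightarrow>\<^sub>M list_space"
      proof (rule measurable_map_list_space)
        show "(\<lambda>y. if i < n then y i else 0) \<in> borel_measurable (PiM {..<n} (\<lambda>_. \<nu>))" for i
          by (cases "i < n") (simp_all add: comp)
      qed
      moreover have "map (\<lambda>i. if i < n then y i else 0) [0..<n] = map y [0..<n]" for y :: "nat \<Rightarrow> real"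
        by simp
      ultimately show ?thesis
        by (simp only:)
    qed
    have "inj_on ((!) ks) {..<n}"
      using that by (simp add: inj_on_nth)
    then have "PiM {..<n} (\<lambda>_. \<nu>) = distr (iid \<nu>) (PiM {..<n} (\<lambda>_. \<nu>)) ?t"
      by (intro distr_PiM_reindex[symmetric]) (use assms(1) in auto)
    then have "(\<integral>\<^sup>+y. f (map y [0..<n]) \<partial>PiM {..<n} (\<lambda>_. \<nu>)) =
        (\<integral>\<^sup>+y. f (map y [0..<n]) \<partial>distr (iid \<nu>) (PiM {..<n} (\<lambda>_. \<nu>)) ?t)"
      by simp
    also have "\<dots> = (\<integral>\<^sup>+v. f (map (?t v) [0..<n]) \<partial>iid \<nu>)"
    proof (rule nn_integral_distr)
      show "?t \<in> iid \<nu> \<rightarrow>\<^sub>M PiM {..<n} (\<lambda>_. \<nu>)"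
        by (rule measurable_restrict) (rule measurable_component_singleton, simp)
      show "(\<lambda>y. f (map y [0..<n])) \<in> borel_measurable (distr (iid \<nu>) (PiM {..<n} (\<lambda>_. \<nu>)) ?t)"
        using measurable_compose[OF m f] by simp
    qed
    also have "\<dots> = (\<integral>\<^sup>+v. f (map v ks) \<partial>iid \<nu>)"
    proof -
      have "map (?t v) [0..<n] = map v ks" for v
        using that by (intro nth_equalityI) simp_all
      then show ?thesis
        by (intro nn_integral_cong arg_cong[where f=f])
    qed
    finally show ?thesis
      by (rule sym)
  qed
  show ?thesis
    using *[of ks "length js"] *[of js "length js"] assms by simp
qed

section \<open>The stationary infinite-server queue\<close>

locale mgi_queue = service_law +
  fixes \<mu> l :: real
  assumes nonneg: "AE w in \<sigma>. 0 \<le> w"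
    and mean: "(\<integral>\<^sup>+w. ennreal w \<partial>\<sigma>) = ennreal (1 / \<mu>)"
    and \<mu>: "0 < \<mu>" and l: "0 < l"
begin

abbreviation \<nu> :: "real measure" where
  "\<nu> \<equiv> residual_law \<mu>"

lemmas residual_law_facts = residual_law_pos[OF nonneg mean \<mu>] prob_space_residual_law[OF nonneg mean \<mu>]

lemma nn_integral_in_service:
  assumes [measurable]: "f \<in> borel_measurable borel"
  shows "ennreal (l / \<mu>) * (\<integral>\<^sup>+r. f (r + T) \<partial>\<nu>) =
    ennreal l * (\<integral>\<^sup>+p. indicator (in_service T) p * f (fst p + snd p) \<partial>jobs)"
proof -
  have "ennreal (l / \<mu>) * ennreal \<mu> = ennreal l"
    using l \<mu> by (simp flip: ennreal_mult)
  then show ?thesis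
    by (subst nn_integral_residual_law) (simp_all add: nn_integral_in_service_shift mult.assoc[symmetric])
qed

lemma AE_residual_law_pos: "AE r in \<nu>. 0 < r"
proof -
  interpret N: prob_space \<nu>
    by (rule residual_law_facts)
  show ?thesis
    using N.AE_in_set_eq_1[of "{0<..}"] residual_law_facts(1) by (simp add: N.emeasure_eq_measure)
qed

lemma jobs_in_service: "emeasure jobs (in_service T) = ennreal (1 / \<mu>)"
proof -
  interpret N: prob_space \<nu>
    by (rule residual_law_facts(2))
  have "ennreal l * emeasure jobs (in_service T) = ennreal l * ennreal (1 / \<mu>)"
    using nn_integral_in_service[of "\<lambda>_. 1" T] N.emeasure_space_1 l \<mu>
    by (simp flip: ennreal_mult)
  then show ?thesis
    using l by (simp add: ennreal_mult_cancel_left)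
qed

text \<open>Independent residual lives are points in service with the intensity normalised to mass
  one. The case \<open>T = 0\<close> turns the initial jobs into Poisson points, and the general
  case turns the points present at \<open>T\<close> back into independent residual lives.\<close>

lemma insert_points_in_service:
  assumes [measurable]: "\<Phi> \<in> borel_measurable list_space"
  shows "ennreal ((l / \<mu>) ^ k) * (\<integral>\<^sup>+v. \<Phi> (map (\<lambda>i. v i + T) (rev [0..<k]) @ xs) \<partial>iid \<nu>) =
    ennreal (l ^ k) * insert_points (in_service T) k \<Phi> xs"
proof (induction k arbitrary: xs)
  case 0
  interpret V: prob_space "iid \<nu>"
    by (rule prob_space_iid[OF residual_law_facts(2)])
  show ?case
    by (simp add: V.emeasure_space_1)
next
  case (Suc k)
  let ?\<rho> = "l / \<mu>"
  interpret V: prob_space "iid \<nu>"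
    by (rule prob_space_iid[OF residual_law_facts(2)])
  note comp1 = measurable_iid_component[OF sets_residual_law]
  have comp: "(\<lambda>z. snd z i) \<in> borel_measurable (borel \<Otimes>\<^sub>M iid \<nu>)" for i
    by (rule measurable_compose[OF measurable_snd comp1])
  have app: "(\<lambda>z. map (\<lambda>i. f z i) js @ g z # xs) \<in> M \<rightarrow>\<^sub>M list_space"
    if "\<And>i. (\<lambda>z. f z i) \<in> borel_measurable M" "g \<in> borel_measurable M" for f g js and M :: "'m measure"
    using that by (induction js) auto
  define h where "h x = (\<integral>\<^sup>+v. \<Phi> (map (\<lambda>i. v i + T) (rev [0..<k]) @ x # xs) \<partial>iid \<nu>)" for x
  have h: "h \<in> borel_measurable borel"
    unfolding h_def[abs_def]
  proof (rule V.borel_measurable_nn_integral)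
    have "(\<lambda>z. map (\<lambda>i. snd z i + T) (rev [0..<k]) @ fst z # xs) \<in> borel \<Otimes>\<^sub>M iid \<nu> \<rightarrow>\<^sub>M list_space"
      by (rule app) (use comp in simp_all)
    then show "(\<lambda>(x, v). \<Phi> (map (\<lambda>i. v i + T) (rev [0..<k]) @ x # xs)) \<in> borel_measurable (borel \<Otimes>\<^sub>M iid \<nu>)"
      unfolding case_prod_beta by measurable
  qed
  have snoc: "map (\<lambda>i. case_nat x v i + T) (rev [0..<Suc k]) @ xs = map (\<lambda>i. v i + T) (rev [0..<k]) @ (x + T) # xs" for x v
    unfolding rev_upt_Suc by simp
  have "ennreal (?\<rho> ^ Suc k) * (\<integral>\<^sup>+v. \<Phi> (map (\<lambda>i. v i + T) (rev [0..<Suc k]) @ xs) \<partial>iid \<nu>) =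
      ennreal (?\<rho> ^ k) * (ennreal ?\<rho> * (\<integral>\<^sup>+x. h (x + T) \<partial>\<nu>))"
  proof -
    have "(\<lambda>v. map (\<lambda>i. v i + T) js @ xs) \<in> iid \<nu> \<rightarrow>\<^sub>M list_space" for js
      by (induction js) (use comp1 in auto)
    then have "(\<lambda>v. \<Phi> (map (\<lambda>i. v i + T) (rev [0..<Suc k]) @ xs)) \<in> borel_measurable (iid \<nu>)"
      by (rule measurable_compose) fact
    from nn_integral_iid_case_nat[OF residual_law_facts(2) this]
    have "(\<integral>\<^sup>+v. \<Phi> (map (\<lambda>i. v i + T) (rev [0..<Suc k]) @ xs) \<partial>iid \<nu>) = (\<integral>\<^sup>+x. h (x + T) \<partial>\<nu>)"
      unfolding snoc h_def .
    moreover have "ennreal (?\<rho> ^ Suc k) = ennreal (?\<rho> ^ k) * ennreal ?\<rho>"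
      using l \<mu> by (simp add: mult.commute flip: ennreal_mult)
    ultimately show ?thesis
      by (simp only: mult.assoc)
  qed
  also have "\<dots> = ennreal (?\<rho> ^ k) * (ennreal l * (\<integral>\<^sup>+p. indicator (in_service T) p * h (fst p + snd p) \<partial>jobs))"
    by (simp add: nn_integral_in_service[OF h])
  also have "\<dots> = ennreal l * (\<integral>\<^sup>+p. indicator (in_service T) p * (ennreal (?\<rho> ^ k) * h (fst p + snd p)) \<partial>jobs)"
    using h by (simp add: nn_integral_cmult mult.left_commute[of _ "ennreal (?\<rho> ^ k)"])
  also have "\<dots> = ennreal l * (\<integral>\<^sup>+p. indicator (in_service T) p *
      (ennreal (l ^ k) * insert_points (in_service T) k \<Phi> ((fst p + snd p) # xs)) \<partial>jobs)"
    unfolding h_def Suc.IH ..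
  also have "\<dots> = ennreal (l ^ Suc k) * insert_points (in_service T) (Suc k) \<Phi> xs"
    using l by (simp add: nn_integral_cmult mult.left_commute[of _ "ennreal (l ^ k)"] ennreal_mult mult.assoc)
  finally show ?case .
qed

lemma poisson_points_in_service:
  assumes [measurable]: "\<Phi> \<in> borel_measurable list_space"
  shows "(\<Sum>k. ennreal (pmf (poisson_pmf (l / \<mu>)) k) * (\<integral>\<^sup>+v. \<Phi> (map (\<lambda>i. v i + T) (rev [0..<k])) \<partial>iid \<nu>)) =
    ennreal (exp (- (l / \<mu>))) * poisson_points l (in_service T) \<Phi> []"
proof -
  have "ennreal (pmf (poisson_pmf (l / \<mu>)) k) * (\<integral>\<^sup>+v. \<Phi> (map (\<lambda>i. v i + T) (rev [0..<k])) \<partial>iid \<nu>) =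
      ennreal (exp (- (l / \<mu>))) * (ennreal (l ^ k / fact k) * insert_points (in_service T) k \<Phi> [])" for k
  proof -
    have "ennreal (pmf (poisson_pmf (l / \<mu>)) k) = ennreal (exp (- (l / \<mu>)) / fact k) * ennreal ((l / \<mu>) ^ k)"
      using l \<mu> by (simp add: mult.commute flip: ennreal_mult)
    moreover have "ennreal (exp (- (l / \<mu>))) * ennreal (l ^ k / fact k) = ennreal (exp (- (l / \<mu>)) / fact k) * ennreal (l ^ k)"
      using l by (simp flip: ennreal_mult)
    ultimately show ?thesis
      using insert_points_in_service[OF assms, of k T "[]"] by (simp add: mult.assoc[symmetric]) (simp add: mult.assoc)
  qed
  then show ?thesis
    by (simp add: poisson_points_def)
qed

text \<open>The initial jobs and the arrivals up to \<open>T\<close> are the points with \<open>c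
  \<le> T\<close> that were present at time \<open>0\<close> or arrived later. They split into the
  points in service at \<open>T\<close> and those that have left; the latter are invisible, and
  their mass is \<open>T\<close> since the two sets of points in service have equal mass.\<close>

lemma poisson_points_stationary:
  assumes [measurable]: "\<Phi> \<in> borel_measurable list_space" and sym: "symmetric \<Phi>"
    and dead: "\<And>x zs. x \<le> T \<Longrightarrow> \<Phi> (x # zs) = \<Phi> zs" and T: "0 \<le> T"
  shows "poisson_points l (in_service 0) (poisson_points l ({0<..T} \<times> UNIV) \<Phi>) xs =
    ennreal (exp (l * T)) * poisson_points l (in_service T) \<Phi> xs"
proof -
  let ?B = "{0<..T} \<times> (UNIV :: real set)"
  define D where "D = in_service 0 \<union> ?B - in_service T"
  have [measurable]: "?B \<in> sets (borel \<Otimes>\<^sub>M borel)"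
    by (intro pair_measureI) simp_all
  have [measurable]: "D \<in> sets (borel \<Otimes>\<^sub>M borel)"
    unfolding D_def by measurable
  have sub: "in_service 0 \<union> ?B = in_service T \<union> D"
    using T by (auto simp: D_def in_service_def)
  have disj: "in_service 0 \<inter> ?B = {}"
    by (auto simp: in_service_def)
  have B: "emeasure jobs ?B = ennreal T"
  proof -
    have "emeasure \<sigma> UNIV = 1"
      using emeasure_space_1 sets_eq_imp_space_eq[OF sets_law] by simp
    then show ?thesis
      using T unfolding jobs_def by (subst emeasure_pair_measure_Times) simp_all
  qed
  have D: "emeasure jobs D = ennreal T"
  proof -
    have "emeasure jobs (in_service 0 \<union> ?B) = ennreal (1 / \<mu>) + ennreal T"
      using disj by (subst plus_emeasure[symmetric]) (simp_all add: jobs_in_service B)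
    moreover have "emeasure jobs (in_service T \<union> D) = ennreal (1 / \<mu>) + emeasure jobs D"
      by (subst plus_emeasure[symmetric]) (simp_all add: jobs_in_service D_def)
    ultimately show ?thesis
      unfolding sub by (simp add: ennreal_add_left_cancel)
  qed
  have inv: "poisson_points l D \<Phi> = (\<lambda>zs. ennreal (exp (l * T)) * \<Phi> zs)"
  proof
    fix zs
    show "poisson_points l D \<Phi> zs = ennreal (exp (l * T)) * \<Phi> zs"
    proof (rule poisson_points_invisible)
      show "\<Phi> ((fst p + snd p) # zs) = \<Phi> zs" if "p \<in> D" for p zs
        using that T by (intro dead) (auto simp: D_def in_service_def)
    qed (use l T D in simp_all)
  qed
  have "poisson_points l (in_service 0) (poisson_points l ?B \<Phi>) xs = poisson_points l (in_service 0 \<union> ?B) \<Phi> xs"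
    using l by (intro poisson_points_Un[symmetric] disj sym) simp_all
  also have "\<dots> = poisson_points l (in_service T) (poisson_points l D \<Phi>) xs"
    unfolding sub using l by (intro poisson_points_Un sym) (simp_all add: D_def)
  also have "\<dots> = ennreal (exp (l * T)) * poisson_points l (in_service T) \<Phi> xs"
    unfolding inv by (rule poisson_points_cmult) simp_all
  finally show ?thesis .
qed

text \<open>The probability that the arrivals during time \<open>s\<close> exceed the sum of
  \<open>n\<close> independent equilibrium renewal counts by more than \<open>q\<close>, given
  through the generating function of these counts.\<close>

definition overload_prob :: "nat \<Rightarrow> nat \<Rightarrow> real \<Rightarrow> ennreal" where
  "overload_prob n q s = (\<integral>\<^sup>+u. (if q < event_count u s
     then (\<Sum>m\<le>event_count u s - q - 1. (mean_count_gf s \<nu> ^ n) $ m) else 0) \<partial>iid (exp_law l))"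

text \<open>The future after \<open>T\<close> is integrated out first, which leaves a symmetric
  functional \<open>F\<close> of the departure times that ignores the jobs already gone. The
  initial jobs and the arrivals up to \<open>T\<close> are then one Poisson collection,
  stationarity replaces it by a Poisson number of shifted independent residual lives, and on a
  list of these every sublist of length \<open>n\<close> has the same expectation, so that the
  mean over sublists reduces to that value whenever there are at least \<open>n\<close>
  jobs.\<close>

lemma nn_integral_queue:
  assumes n: "1 \<le> n" and T: "0 \<le> T"
  shows "(\<Sum>z. ennreal (pmf (poisson_pmf (l / \<mu>)) z) *
      (\<integral>\<^sup>+v. \<integral>\<^sup>+u. \<integral>\<^sup>+w. (\<Sum>k. run_arrivals T (mean_overload n q T s) k 0 (map v (rev [0..<z])) u w)
        \<partial>iid \<sigma> \<partial>iid (exp_law l) \<partial>iid \<nu>)) =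
    emeasure (measure_pmf (poisson_pmf (l / \<mu>))) {n..} * overload_prob n q s"
proof -
  interpret U: prob_space "iid (exp_law l)"
    by (rule prob_space_iid[OF prob_space_exp_law[OF l]])
  interpret W: prob_space "iid \<sigma>"
    by (rule prob_space_iid) unfold_locales
  interpret V: prob_space "iid \<nu>"
    by (rule prob_space_iid[OF residual_law_facts(2)])
  note UU = measurable_iid_ident[OF sets_exp_law] and WW = measurable_iid_ident[OF sets_law]
    and VV = measurable_iid_ident[OF sets_residual_law]
  let ?post = "mean_overload n q T s"
  define g where "g a rs = (if q < a then \<Sum>m\<le>a - q - 1. counts_gf (s + T) rs $ m else 0)" for a rs
  define G where "G rs = (\<integral>\<^sup>+u. g (event_count u s) rs \<partial>iid (exp_law l))" for rs
  define F where "F xs = (\<integral>\<^sup>+u. \<integral>\<^sup>+w. ?post xs u w \<partial>iid \<sigma> \<partial>iid (exp_law l))" for xs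
  have count: "(\<lambda>z. event_count (f z) s) \<in> M \<rightarrow>\<^sub>M count_space UNIV" if "f \<in> M \<rightarrow>\<^sub>M iid borel" for f and M :: "'m measure"
    using that by (rule measurable_event_count)
  have g_m: "(\<lambda>z. g (event_count (f z) s) (h z)) \<in> borel_measurable M"
    if "f \<in> M \<rightarrow>\<^sub>M iid borel" "h \<in> M \<rightarrow>\<^sub>M list_space" for f h and M :: "'m measure"
  proof (rule measurable_compose_countable[OF _ count[OF that(1)]])
    show "(\<lambda>z. g a (h z)) \<in> borel_measurable M" for a
      unfolding g_def using that(2) by (cases "q < a") (auto intro!: borel_measurable_sum measurable_counts_gf)
  qed
  have w_integral: "(\<integral>\<^sup>+w. of_bool (overload q T s ys u w) \<partial>iid \<sigma>) = g (event_count u s) ys" if "ys \<noteq> []" for ys u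
    using nn_integral_all_busy[OF nonneg that, of "s + T"] by (simp add: overload_def g_def)
  have over_w: "(\<lambda>w. of_bool (overload q T s ys u w) :: ennreal) \<in> borel_measurable (iid \<sigma>)" for ys u
    by (rule measurable_overload) (simp_all add: WW space_PiM)
  have F_eq: "F xs = mean_sublists n G (filter (\<lambda>x. T < x) xs)" for xs
  proof -
    have ne: "ys \<noteq> []" if "ys \<in> set (sublists n zs)" for ys zs :: "real list"
      using sublistsD(1)[OF that] n by auto
    have "F xs = (\<integral>\<^sup>+u. mean_sublists n (\<lambda>ys. \<integral>\<^sup>+w. of_bool (overload q T s ys u w) \<partial>iid \<sigma>) (filter (\<lambda>x. T < x) xs) \<partial>iid (exp_law l))"
      unfolding F_def mean_overload_def by (subst nn_integral_mean_sublists) (simp_all add: over_w)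
    also have "\<dots> = (\<integral>\<^sup>+u. mean_sublists n (\<lambda>ys. g (event_count u s) ys) (filter (\<lambda>x. T < x) xs) \<partial>iid (exp_law l))"
      by (intro nn_integral_cong mean_sublists_cong) (simp add: w_integral ne)
    also have "\<dots> = mean_sublists n G (filter (\<lambda>x. T < x) xs)"
      unfolding G_def by (rule nn_integral_mean_sublists) (rule g_m[OF UU], simp)
    finally show ?thesis .
  qed
  have G_m: "G \<in> borel_measurable list_space"
    unfolding G_def[abs_def]
  proof (rule U.borel_measurable_nn_integral)
    show "(\<lambda>(rs, u). g (event_count u s) rs) \<in> borel_measurable (list_space \<Otimes>\<^sub>M iid (exp_law l))"
      unfolding case_prod_beta
      by (rule g_m) (rule measurable_compose[OF measurable_snd UU], rule measurable_fst)
  qed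
  have F_m: "F \<in> borel_measurable list_space"
    unfolding F_eq[abs_def]
    by (rule measurable_mean_sublists) (auto intro: measurable_filter_list_space measurable_compose[OF _ G_m])
  have G_sym: "symmetric G"
    unfolding G_def g_def by (rule symmetric_counts_gf)
  have F_sym: "symmetric F"
    unfolding F_eq[abs_def] by (rule symmetric_filter[OF symmetric_mean_sublists[OF G_sym]])
  have arrivals: "(\<integral>\<^sup>+u. \<integral>\<^sup>+w. (\<Sum>k. run_arrivals T ?post k 0 xs u w) \<partial>iid \<sigma> \<partial>iid (exp_law l)) =
      ennreal (exp (- l * T)) * poisson_points l ({0<..T} \<times> UNIV) F xs" for xs
  proof -
    have run_w: "run_arrivals T ?post k 0 xs u \<in> borel_measurable (iid \<sigma>)" for k u
      by (rule measurable_run_arrivals[OF measurable_mean_overload]) (simp_all add: WW space_PiM)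
    have run_u: "(\<lambda>u. \<integral>\<^sup>+w. run_arrivals T ?post k 0 xs u w \<partial>iid \<sigma>) \<in> borel_measurable (iid (exp_law l))" for k
    proof (rule W.borel_measurable_nn_integral)
      show "(\<lambda>(u, w). run_arrivals T ?post k 0 xs u w) \<in> borel_measurable (iid (exp_law l) \<Otimes>\<^sub>M iid \<sigma>)"
        unfolding case_prod_beta
        by (rule measurable_run_arrivals[OF measurable_mean_overload])
          (simp_all add: measurable_compose[OF measurable_snd WW] measurable_compose[OF measurable_fst UU])
    qed
    have "(\<integral>\<^sup>+u. \<integral>\<^sup>+w. (\<Sum>k. run_arrivals T ?post k 0 xs u w) \<partial>iid \<sigma> \<partial>iid (exp_law l)) =
        (\<Sum>k. \<integral>\<^sup>+u. \<integral>\<^sup>+w. run_arrivals T ?post k 0 xs u w \<partial>iid \<sigma> \<partial>iid (exp_law l))"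
      using run_w run_u by (simp add: nn_integral_suminf)
    also have "\<dots> = (\<Sum>k. ennreal (exp (- l * T)) * (ennreal (l ^ k / fact k) * insert_points ({0<..T} \<times> UNIV) k F xs))"
    proof (intro suminf_cong)
      fix k
      have "(\<integral>\<^sup>+u. \<integral>\<^sup>+w. run_arrivals T ?post k 0 xs u w \<partial>iid \<sigma> \<partial>iid (exp_law l)) =
          ennreal (exp (- l * (T - 0)) * l ^ k / fact k) * insert_points ({0<..T} \<times> UNIV) k F xs"
        unfolding F_def using F_sym[unfolded F_def] l T
        unfolding case_prod_beta
        by (intro nn_integral_run_arrivals[unfolded case_prod_beta] measurable_mean_overload) simp_all
      moreover have "ennreal (exp (- l * (T - 0)) * l ^ k / fact k) = ennreal (exp (- l * T)) * ennreal (l ^ k / fact k)"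
        using l by (simp flip: ennreal_mult)
      ultimately show "(\<integral>\<^sup>+u. \<integral>\<^sup>+w. run_arrivals T ?post k 0 xs u w \<partial>iid \<sigma> \<partial>iid (exp_law l)) =
          ennreal (exp (- l * T)) * (ennreal (l ^ k / fact k) * insert_points ({0<..T} \<times> UNIV) k F xs)"
        by (simp add: mult.assoc)
    qed
    finally show ?thesis
      by (simp add: poisson_points_def)
  qed
  let ?B = "{0<..T} \<times> (UNIV :: real set)"
  have [measurable]: "?B \<in> sets (borel \<Otimes>\<^sub>M borel)"
    by (intro pair_measureI) simp_all
  note F_m [measurable]
  have "(\<Sum>z. ennreal (pmf (poisson_pmf (l / \<mu>)) z) *
      (\<integral>\<^sup>+v. \<integral>\<^sup>+u. \<integral>\<^sup>+w. (\<Sum>k. run_arrivals T ?post k 0 (map v (rev [0..<z])) u w)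
        \<partial>iid \<sigma> \<partial>iid (exp_law l) \<partial>iid \<nu>)) =
      (\<Sum>z. ennreal (pmf (poisson_pmf (l / \<mu>)) z) *
      (\<integral>\<^sup>+v. ennreal (exp (- l * T)) * poisson_points l ?B F (map (\<lambda>i. v i + 0) (rev [0..<z])) \<partial>iid \<nu>))"
    unfolding arrivals by simp
  also have "\<dots> = ennreal (exp (- (l / \<mu>))) *
      poisson_points l (in_service 0) (\<lambda>xs. ennreal (exp (- l * T)) * poisson_points l ?B F xs) []"
    by (rule poisson_points_in_service) measurable
  also have "poisson_points l (in_service 0) (\<lambda>xs. ennreal (exp (- l * T)) * poisson_points l ?B F xs) [] =
      ennreal (exp (- l * T)) * poisson_points l (in_service 0) (poisson_points l ?B F) []"
    by (rule poisson_points_cmult) measurable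
  also have "poisson_points l (in_service 0) (poisson_points l ?B F) [] =
      ennreal (exp (l * T)) * poisson_points l (in_service T) F []"
    by (rule poisson_points_stationary) (use F_sym T in \<open>auto simp: F_eq\<close>)
  also have "ennreal (exp (- l * T)) * \<dots> = poisson_points l (in_service T) F []"
    by (simp add: mult.assoc[symmetric] flip: ennreal_mult exp_add)
  also have "ennreal (exp (- (l / \<mu>))) * \<dots> =
      (\<Sum>k. ennreal (pmf (poisson_pmf (l / \<mu>)) k) * (\<integral>\<^sup>+v. F (map (\<lambda>i. v i + T) (rev [0..<k])) \<partial>iid \<nu>))"
    by (rule poisson_points_in_service[symmetric]) measurable
  also have "\<dots> = (\<Sum>k. ennreal (pmf (poisson_pmf (l / \<mu>)) k) * (indicator {n..} k * overload_prob n q s))"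
  proof (intro suminf_cong arg_cong2[where f="(*)"] refl)
    fix k
    have AE_pos: "AE v in iid \<nu>. \<forall>i. 0 < v i"
    proof (subst AE_all_countable, intro allI)
      fix i
      show "AE v in iid \<nu>. 0 < v i"
        using AE_PiM_component[of UNIV "\<lambda>_. \<nu>" i "\<lambda>r. 0 < r"] residual_law_facts(2) AE_residual_law_pos by simp
    qed
    have G_shift: "(\<lambda>v. G (map (\<lambda>i. v i + T) ks)) \<in> borel_measurable (iid \<nu>)" for ks
      by (intro measurable_compose[OF _ G_m] measurable_map_list_space borel_measurable_add measurable_const
          measurable_compose[OF VV measurable_component_singleton]) simp_all
    have G_val: "(\<integral>\<^sup>+v. G (map (\<lambda>i. v i + T) ks) \<partial>iid \<nu>) = overload_prob n q s"
      if "distinct ks" "length ks = n" for ks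
    proof -
      have "(\<lambda>rs. G (map (\<lambda>r. r + T) rs)) \<in> borel_measurable list_space"
        by (rule measurable_compose[OF measurable_map_shift_list_space G_m]) simp
      from nn_integral_iid_distinct[OF residual_law_facts(2) sets_residual_law this that(1), of "rev [0..<n]"]
      have "(\<integral>\<^sup>+v. G (map (\<lambda>i. v i + T) ks) \<partial>iid \<nu>) = (\<integral>\<^sup>+v. G (map (\<lambda>r. r + T) (map v (rev [0..<n]))) \<partial>iid \<nu>)"
        using that(2) by (simp add: comp_def)
      also have "\<dots> = (\<integral>\<^sup>+u. \<integral>\<^sup>+v. g (event_count u s) (map (\<lambda>r. r + T) (map v (rev [0..<n]))) \<partial>iid \<nu> \<partial>iid (exp_law l))"
        unfolding G_def
      proof (rule pair_sigma_finite.Fubini')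
        show "pair_sigma_finite (iid (exp_law l)) (iid \<nu>)"
          by unfold_locales
        show "(\<lambda>(u, v). g (event_count u s) (map (\<lambda>r. r + T) (map v (rev [0..<n])))) \<in>
            borel_measurable (iid (exp_law l) \<Otimes>\<^sub>M iid \<nu>)"
          unfolding case_prod_beta
          by (intro g_m measurable_map_shift_list_space measurable_map_list_space measurable_compose[OF measurable_fst UU]
              measurable_compose[OF measurable_compose[OF measurable_snd VV] measurable_component_singleton]) simp
      qed
      also have "\<dots> = overload_prob n q s"
        unfolding overload_prob_def
      proof (intro nn_integral_cong)
        fix u
        have m: "(\<lambda>v. counts_gf s (map v (rev [0..<n])) $ m) \<in> borel_measurable (iid \<nu>)" for m
          by (intro measurable_counts_gf measurable_map_list_space measurable_compose[OF VV measurable_component_singleton]) simp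
        show "(\<integral>\<^sup>+v. g (event_count u s) (map (\<lambda>r. r + T) (map v (rev [0..<n]))) \<partial>iid \<nu>) =
            (if q < event_count u s then \<Sum>m\<le>event_count u s - q - 1. (mean_count_gf s \<nu> ^ n) $ m else 0)"
          unfolding g_def counts_gf_shift
          using m by (simp add: nn_integral_sum nn_integral_counts_gf residual_law_facts(2))
      qed
      finally show ?thesis .
    qed
    have "(\<integral>\<^sup>+v. F (map (\<lambda>i. v i + T) (rev [0..<k])) \<partial>iid \<nu>) =
        (\<integral>\<^sup>+v. mean_sublists n (\<lambda>ks. G (map (\<lambda>i. v i + T) ks)) (rev [0..<k]) \<partial>iid \<nu>)"
    proof (rule nn_integral_cong_AE, rule AE_mp[OF AE_pos], rule AE_I2, rule impI)
      fix v :: "nat \<Rightarrow> real" assume "\<forall>i. 0 < v i"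
      then have "filter (\<lambda>x. T < x) (map (\<lambda>i. v i + T) (rev [0..<k])) = map (\<lambda>i. v i + T) (rev [0..<k])"
        by (intro filter_True) auto
      then show "F (map (\<lambda>i. v i + T) (rev [0..<k])) = mean_sublists n (\<lambda>ks. G (map (\<lambda>i. v i + T) ks)) (rev [0..<k])"
        unfolding F_eq by (simp only: mean_sublists_map)
    qed
    also have "\<dots> = mean_sublists n (\<lambda>ks. \<integral>\<^sup>+v. G (map (\<lambda>i. v i + T) ks) \<partial>iid \<nu>) (rev [0..<k])"
      by (rule nn_integral_mean_sublists[OF G_shift])
    also have "\<dots> = (if n \<le> length (rev [0..<k]) then overload_prob n q s else 0)"
      by (rule mean_sublists_const) (auto dest: sublistsD intro!: G_val)
    finally show "(\<integral>\<^sup>+v. F (map (\<lambda>i. v i + T) (rev [0..<k])) \<partial>iid \<nu>) = indicator {n..} k * overload_prob n q s"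
      by simp
  qed
  also have "\<dots> = (\<Sum>k. ennreal (pmf (poisson_pmf (l / \<mu>)) k) * indicator {n..} k) * overload_prob n q s"
    by (simp add: mult.assoc[symmetric])
  also have "(\<Sum>k. ennreal (pmf (poisson_pmf (l / \<mu>)) k) * indicator {n..} k) =
      emeasure (measure_pmf (poisson_pmf (l / \<mu>))) {n..}"
  proof -
    have "emeasure (measure_pmf (poisson_pmf (l / \<mu>))) {n..} =
        (\<integral>\<^sup>+k. indicator {n..} k \<partial>measure_pmf (poisson_pmf (l / \<mu>)))"
      by simp
    also have "\<dots> = (\<integral>\<^sup>+k. ennreal (pmf (poisson_pmf (l / \<mu>)) k) * indicator {n..} k \<partial>count_space UNIV)"
      by (rule nn_integral_measure_pmf)
    finally show ?thesis
      by (simp add: nn_integral_count_space_nat)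
  qed
  finally show ?thesis .
qed

end


section \<open>Laws of independent sequences\<close>

lemma (in prob_space)
  fixes X :: "'i \<Rightarrow> 'a \<Rightarrow> real" and f :: "'j \<Rightarrow> 'i"
  assumes indep: "indep_vars (\<lambda>_. borel) X UNIV" and f: "inj f"
  shows distr_subfamily: "distr M (PiM UNIV (\<lambda>_. borel)) (\<lambda>\<omega> j. X (f j) \<omega>) = PiM UNIV (\<lambda>j. distr M borel (X (f j)))"
    and indep_vars_subfamily: "indep_vars (\<lambda>_. borel) (\<lambda>j. X (f j)) UNIV"
proof -
  have X [measurable]: "X i \<in> borel_measurable M" for i
    using indep by (auto simp: indep_vars_def)
  have D: "prob_space (distr M borel (X i))" for i
    by (rule prob_space_distr) measurable
  have X_m: "(\<lambda>\<omega> i. X i \<omega>) \<in> M \<rightarrow>\<^sub>M PiM UNIV (\<lambda>_. borel)"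
    by (rule measurable_PiM_single') simp_all
  have f_m: "(\<lambda>x j. x (f j)) \<in> PiM UNIV (\<lambda>_. borel) \<rightarrow>\<^sub>M PiM UNIV (\<lambda>_. borel :: real measure)"
    by (rule measurable_PiM_single') simp_all
  have sets_eq: "sets (PiM UNIV (\<lambda>i. distr M borel (X i))) = sets (PiM UNIV (\<lambda>_. borel))" for X :: "'k \<Rightarrow> 'a \<Rightarrow> real"
    by (rule sets_PiM_cong) simp_all
  have all: "distr M (PiM UNIV (\<lambda>_. borel)) (\<lambda>\<omega> i. X i \<omega>) = PiM UNIV (\<lambda>i. distr M borel (X i))"
    using indep indep_vars_iff_distr_eq_PiM[where I=UNIV and M'="\<lambda>_. borel" and X=X] by (simp add: restrict_def)
  have "distr M (PiM UNIV (\<lambda>_. borel)) (\<lambda>\<omega> j. X (f j) \<omega>) =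
      distr (distr M (PiM UNIV (\<lambda>_. borel)) (\<lambda>\<omega> i. X i \<omega>)) (PiM UNIV (\<lambda>_. borel)) (\<lambda>x j. x (f j))"
    by (simp add: distr_distr[OF f_m X_m] comp_def)
  also have "\<dots> = distr (PiM UNIV (\<lambda>i. distr M borel (X i))) (PiM UNIV (\<lambda>j. distr M borel (X (f j)))) (\<lambda>x j. x (f j))"
    unfolding all by (rule distr_cong) (simp_all add: sets_eq)
  also have "\<dots> = PiM UNIV (\<lambda>j. distr M borel (X (f j)))"
    using distr_PiM_reindex[of UNIV "\<lambda>i. distr M borel (X i)" f UNIV] D f by (simp add: restrict_def)
  finally show distr: "distr M (PiM UNIV (\<lambda>_. borel)) (\<lambda>\<omega> j. X (f j) \<omega>) = PiM UNIV (\<lambda>j. distr M borel (X (f j)))" .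
  then show "indep_vars (\<lambda>_. borel) (\<lambda>j. X (f j)) UNIV"
    using indep_vars_iff_distr_eq_PiM[where I=UNIV and M'="\<lambda>_. borel" and X="\<lambda>j. X (f j)"] by (simp add: restrict_def)
qed

lemma (in prob_space) AE_positive_from_distr:
  assumes "X \<in> borel_measurable M" "AE x in distr M borel X. 0 < (x::real)"
  shows "AE \<omega> in M. 0 < X \<omega>"
  using assms by (subst (asm) AE_distr_iff) simp_all

text \<open>The expectations of \<open>exp (- S\<^sub>k)\<close> for the partial sums
  \<open>S\<^sub>k\<close> are dominated by a geometric series, so these variables are almost
  surely summable and \<open>S\<^sub>k\<close> tends to infinity. Without this, the cardinalities
  that define event counts and queue lengths could be those of infinite sets, which are
  \<open>0\<close>.\<close>

lemma (in prob_space) AE_finite_partial_sums: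
  fixes Y :: "nat \<Rightarrow> 'a \<Rightarrow> real"
  assumes indep: "indep_vars (\<lambda>_. borel) Y UNIV" and law: "\<And>k. distr M borel (Y (Suc k)) = N"
    and pos: "AE x in N. 0 < x" and pos_0: "AE \<omega> in M. 0 < Y 0 \<omega>"
  shows "AE \<omega> in M. \<forall>t. finite {k. (\<Sum>j\<le>k. Y j \<omega>) \<le> t}"
proof -
  have Y [measurable]: "Y i \<in> borel_measurable M" for i
    using indep by (auto simp: indep_vars_def)
  have N: "prob_space N" "sets N = sets borel"
    unfolding law[of 0, symmetric] by (auto intro: prob_space_distr)
  interpret N: prob_space N by fact
  note N(2) [measurable_cong]
  define \<theta> where "\<theta> = (\<integral>x. exp (- x) \<partial>N)"
  have int: "integrable N (\<lambda>x. exp (- x))"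
    by (rule N.integrable_const_bound[of _ 1]) (use pos in auto)
  have \<theta>: "0 \<le> \<theta>" "\<theta> < 1"
    unfolding \<theta>_def
    by (rule integral_nonneg_AE, simp, rule N.expectation_less[OF int]) (use pos in auto)
  have \<theta>_eq: "(\<integral>\<^sup>+\<omega>. ennreal (exp (- Y (Suc k) \<omega>)) \<partial>M) = ennreal \<theta>" for k
  proof -
    have "(\<integral>\<^sup>+\<omega>. ennreal (exp (- Y (Suc k) \<omega>)) \<partial>M) = (\<integral>\<^sup>+x. ennreal (exp (- x)) \<partial>distr M borel (Y (Suc k)))"
      by (rule nn_integral_distr[symmetric]) simp_all
    then show ?thesis
      unfolding law \<theta>_def using nn_integral_eq_integral[OF int] by simp
  qed
  have le_1: "(\<integral>\<^sup>+\<omega>. ennreal (exp (- Y 0 \<omega>)) \<partial>M) \<le> 1"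
  proof -
    have "(\<integral>\<^sup>+\<omega>. ennreal (exp (- Y 0 \<omega>)) \<partial>M) \<le> (\<integral>\<^sup>+\<omega>. 1 \<partial>M)"
      by (rule nn_integral_mono_AE) (use pos_0 in auto)
    then show ?thesis
      by (simp add: emeasure_space_1)
  qed
  have le: "(\<integral>\<^sup>+\<omega>. ennreal (exp (- (\<Sum>j\<le>k. Y j \<omega>))) \<partial>M) \<le> ennreal (\<theta> ^ k)" for k
  proof -
    have "(\<integral>\<^sup>+\<omega>. ennreal (exp (- (\<Sum>j\<le>k. Y j \<omega>))) \<partial>M) = (\<integral>\<^sup>+\<omega>. (\<Prod>j\<le>k. ennreal (exp (- Y j \<omega>))) \<partial>M)"
      by (simp add: prod_ennreal exp_sum flip: sum_negf)
    also have "\<dots> = (\<Prod>j\<le>k. \<integral>\<^sup>+\<omega>. ennreal (exp (- Y j \<omega>)) \<partial>M)"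
    proof (rule indep_vars_nn_integral)
      show "indep_vars (\<lambda>_. borel) (\<lambda>j \<omega>. ennreal (exp (- Y j \<omega>))) {..k}"
        by (rule indep_vars_compose2[OF indep_vars_subset[OF indep]]) simp_all
    qed simp_all
    also have "\<dots> = (\<integral>\<^sup>+\<omega>. ennreal (exp (- Y 0 \<omega>)) \<partial>M) * (\<Prod>j<k. ennreal \<theta>)"
      by (subst prod.atMost_shift) (simp add: \<theta>_eq)
    also have "\<dots> \<le> 1 * (\<Prod>j<k. ennreal \<theta>)"
      by (intro mult_right_mono le_1) simp
    finally show ?thesis
      using \<theta> by (simp add: ennreal_power)
  qed
  have "(\<integral>\<^sup>+\<omega>. (\<Sum>k. ennreal (exp (- (\<Sum>j\<le>k. Y j \<omega>)))) \<partial>M) = (\<Sum>k. \<integral>\<^sup>+\<omega>. ennreal (exp (- (\<Sum>j\<le>k. Y j \<omega>))) \<partial>M)"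
    by (rule nn_integral_suminf) simp
  also have "\<dots> \<le> (\<Sum>k. ennreal (\<theta> ^ k))"
    by (intro suminf_le le) auto
  also have "\<dots> < \<top>"
  proof -
    have "summable (\<lambda>k. \<theta> ^ k)"
      using \<theta> by (intro summable_geometric) simp
    then have "(\<Sum>k. ennreal (\<theta> ^ k)) \<noteq> \<top>"
      by (rule ennreal_suminf_neq_top) (use \<theta> in simp)
    then show ?thesis
      by (simp only: top.not_eq_extremum)
  qed
  finally have finite: "(\<integral>\<^sup>+\<omega>. (\<Sum>k. ennreal (exp (- (\<Sum>j\<le>k. Y j \<omega>)))) \<partial>M) < \<top>" .
  have "(\<lambda>\<omega>. \<Sum>k. ennreal (exp (- (\<Sum>j\<le>k. Y j \<omega>)))) \<in> borel_measurable M"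
    by measurable
  from nn_integral_PInf_AE[OF this] finite
  have "AE \<omega> in M. (\<Sum>k. ennreal (exp (- (\<Sum>j\<le>k. Y j \<omega>)))) \<noteq> \<infinity>"
    by simp
  then show ?thesis
  proof (rule AE_mp, intro AE_I2 impI allI)
    fix \<omega> t
    assume "(\<Sum>k. ennreal (exp (- (\<Sum>j\<le>k. Y j \<omega>)))) \<noteq> \<infinity>"
    then have "summable (\<lambda>k. exp (- (\<Sum>j\<le>k. Y j \<omega>)))"
      by (intro summable_suminf_not_top) auto
    then have "(\<lambda>k. exp (- (\<Sum>j\<le>k. Y j \<omega>))) \<longlonglongrightarrow> 0"
      by (rule summable_LIMSEQ_zero)
    then have "eventually (\<lambda>k. exp (- (\<Sum>j\<le>k. Y j \<omega>)) < exp (- t)) sequentially"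
      by (rule order_tendstoD) simp
    then obtain K where K: "\<And>k. K \<le> k \<Longrightarrow> t < (\<Sum>j\<le>k. Y j \<omega>)"
      by (auto simp: eventually_sequentially)
    have "{k. (\<Sum>j\<le>k. Y j \<omega>) \<le> t} \<subseteq> {..<K}"
      using K by (auto simp: not_le[symmetric])
    then show "finite {k. (\<Sum>j\<le>k. Y j \<omega>) \<le> t}"
      by (rule finite_subset) simp
  qed
qed

section \<open>The renewal processes\<close>

text \<open>Generating functions of independent counts multiply.\<close>

lemma (in prob_space) sum_indep_counts_gf:
  fixes X :: "'i \<Rightarrow> 'a \<Rightarrow> nat"
  assumes indep: "indep_vars (\<lambda>_. count_space UNIV) X I" and "finite I"
    and law: "\<And>i m. i \<in> I \<Longrightarrow> emeasure M {\<omega> \<in> space M. X i \<omega> = m} = p $ m"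
  shows "emeasure M {\<omega> \<in> space M. (\<Sum>i\<in>I. X i \<omega>) = m} = (p ^ card I) $ m"
  using \<open>finite I\<close> indep law
proof (induction I arbitrary: m)
  case empty
  show ?case
    by (cases "m = 0") (simp_all add: emeasure_space_1)
next
  case (insert i I)
  have X [measurable]: "X j \<in> M \<rightarrow>\<^sub>M count_space UNIV" if "j \<in> insert i I" for j
    using insert.prems(1) that by (auto simp: indep_vars_def)
  have IH: "emeasure M {\<omega> \<in> space M. (\<Sum>i\<in>I. X i \<omega>) = m} = (p ^ card I) $ m" for m
    using insert.prems by (intro insert.IH indep_vars_subset[OF insert.prems(1)]) auto
  have ind: "indep_var (count_space UNIV) (X i) (count_space UNIV) (\<lambda>\<omega>. \<Sum>i\<in>I. X i \<omega>)"
  proof -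
    have "indep_var (count_space UNIV) ((\<lambda>f. f i) \<circ> (\<lambda>\<omega>. restrict (\<lambda>i. X i \<omega>) {i}))
      (count_space UNIV) ((\<lambda>f. \<Sum>i\<in>I. f i) \<circ> (\<lambda>\<omega>. restrict (\<lambda>i. X i \<omega>) I))"
      using insert by (intro indep_var_compose[OF indep_var_restrict[OF insert.prems(1)]]) auto
    also have "(\<lambda>f. f i) \<circ> (\<lambda>\<omega>. restrict (\<lambda>i. X i \<omega>) {i}) = X i"
      by auto
    also have "(\<lambda>f. \<Sum>i\<in>I. f i) \<circ> (\<lambda>\<omega>. restrict (\<lambda>i. X i \<omega>) I) = (\<lambda>\<omega>. \<Sum>i\<in>I. X i \<omega>)"
      by (auto cong: rev_conj_cong)
    finally show ?thesis .
  qed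
  have [measurable]: "(\<lambda>\<omega>. \<Sum>i\<in>I. X i \<omega>) \<in> M \<rightarrow>\<^sub>M count_space UNIV"
    using ind by (rule indep_var_rv2)
  have joint: "emeasure M ({\<omega> \<in> space M. X i \<omega> = a} \<inter> {\<omega> \<in> space M. (\<Sum>i\<in>I. X i \<omega>) = b}) = p $ a * (p ^ card I) $ b" for a b
  proof -
    have "(\<lambda>\<omega>. (X i \<omega>, \<Sum>i\<in>I. X i \<omega>)) -` ({a} \<times> {b}) \<inter> space M =
        X i -` {a} \<inter> (\<lambda>\<omega>. \<Sum>i\<in>I. X i \<omega>) -` {b} \<inter> space M"
      by auto
    with indep_varD[OF ind, of "{a}" "{b}"]
    have "prob (X i -` {a} \<inter> (\<lambda>\<omega>. \<Sum>i\<in>I. X i \<omega>) -` {b} \<inter> space M) =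
        prob (X i -` {a} \<inter> space M) * prob ((\<lambda>\<omega>. \<Sum>i\<in>I. X i \<omega>) -` {b} \<inter> space M)"
      by simp
    then have "emeasure M (X i -` {a} \<inter> (\<lambda>\<omega>. \<Sum>i\<in>I. X i \<omega>) -` {b} \<inter> space M) =
        emeasure M (X i -` {a} \<inter> space M) * emeasure M ((\<lambda>\<omega>. \<Sum>i\<in>I. X i \<omega>) -` {b} \<inter> space M)"
      by (simp add: emeasure_eq_measure ennreal_mult)
    moreover have "X i -` {a} \<inter> (\<lambda>\<omega>. \<Sum>i\<in>I. X i \<omega>) -` {b} \<inter> space M =
        {\<omega> \<in> space M. X i \<omega> = a} \<inter> {\<omega> \<in> space M. (\<Sum>i\<in>I. X i \<omega>) = b}"
      by auto
    moreover have "X i -` {a} \<inter> space M = {\<omega> \<in> space M. X i \<omega> = a}"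
        "(\<lambda>\<omega>. \<Sum>i\<in>I. X i \<omega>) -` {b} \<inter> space M = {\<omega> \<in> space M. (\<Sum>i\<in>I. X i \<omega>) = b}"
      by auto
    ultimately show ?thesis
      using insert.prems(2) IH by simp
  qed
  have "{\<omega> \<in> space M. (\<Sum>i\<in>insert i I. X i \<omega>) = m} =
      (\<Union>a\<in>{0..m}. {\<omega> \<in> space M. X i \<omega> = a} \<inter> {\<omega> \<in> space M. (\<Sum>i\<in>I. X i \<omega>) = m - a})"
    using insert.hyps by auto
  also have "emeasure M \<dots> = (\<Sum>a=0..m. emeasure M ({\<omega> \<in> space M. X i \<omega> = a} \<inter> {\<omega> \<in> space M. (\<Sum>i\<in>I. X i \<omega>) = m - a}))"
    by (rule sum_emeasure[symmetric]) (auto simp: disjoint_family_on_def)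
  also have "\<dots> = (p ^ card (insert i I)) $ m"
    using insert.hyps by (simp add: joint fps_mult_nth)
  finally show ?case .
qed

text \<open>Functions of two disjoint groups of variables may take values in spaces of different
  types, so their independence is expressed as a product law.\<close>

lemma (in prob_space) distr_disjoint_groups:
  fixes X :: "'i \<Rightarrow> 'a \<Rightarrow> real"
  assumes indep: "indep_vars (\<lambda>_. borel) X UNIV" and AB: "A \<inter> B = {}"
    and f: "f \<in> PiM A (\<lambda>_. borel) \<rightarrow>\<^sub>M N1" and g: "g \<in> PiM B (\<lambda>_. borel) \<rightarrow>\<^sub>M N2"
  shows "distr M (N1 \<Otimes>\<^sub>M N2) (\<lambda>\<omega>. (f (\<lambda>i\<in>A. X i \<omega>), g (\<lambda>i\<in>B. X i \<omega>))) =
    distr M N1 (\<lambda>\<omega>. f (\<lambda>i\<in>A. X i \<omega>)) \<Otimes>\<^sub>M distr M N2 (\<lambda>\<omega>. g (\<lambda>i\<in>B. X i \<omega>))"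
proof -
  let ?A = "\<lambda>\<omega>. \<lambda>i\<in>A. X i \<omega>" and ?B = "\<lambda>\<omega>. \<lambda>i\<in>B. X i \<omega>"
  let ?PA = "PiM A (\<lambda>_. borel :: real measure)" and ?PB = "PiM B (\<lambda>_. borel :: real measure)"
  have "indep_var ?PA ?A ?PB ?B"
    by (rule indep_var_restrict[OF indep AB]) simp_all
  then have A: "?A \<in> M \<rightarrow>\<^sub>M ?PA" and B: "?B \<in> M \<rightarrow>\<^sub>M ?PB"
    and joint: "distr M ?PA ?A \<Otimes>\<^sub>M distr M ?PB ?B = distr M (?PA \<Otimes>\<^sub>M ?PB) (\<lambda>\<omega>. (?A \<omega>, ?B \<omega>))"
    unfolding indep_var_distribution_eq by auto
  interpret G: prob_space "distr (distr M ?PB ?B) N2 g"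
    using g B by (intro prob_space.prob_space_distr[OF prob_space_distr]) simp_all
  have fg: "(\<lambda>(x, y). (f x, g y)) \<in> ?PA \<Otimes>\<^sub>M ?PB \<rightarrow>\<^sub>M N1 \<Otimes>\<^sub>M N2"
    using f g by measurable
  have AB: "(\<lambda>\<omega>. (?A \<omega>, ?B \<omega>)) \<in> M \<rightarrow>\<^sub>M ?PA \<Otimes>\<^sub>M ?PB"
    using A B by measurable
  have "distr M N1 (\<lambda>\<omega>. f (?A \<omega>)) \<Otimes>\<^sub>M distr M N2 (\<lambda>\<omega>. g (?B \<omega>)) =
      distr (distr M ?PA ?A) N1 f \<Otimes>\<^sub>M distr (distr M ?PB ?B) N2 g"
    using f g A B by (simp add: distr_distr comp_def)
  also have "\<dots> = distr (distr M ?PA ?A \<Otimes>\<^sub>M distr M ?PB ?B) (N1 \<Otimes>\<^sub>M N2) (\<lambda>(x, y). (f x, g y))"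
    using f g by (intro pair_measure_distr) (simp_all, unfold_locales)
  also have "\<dots> = distr M (N1 \<Otimes>\<^sub>M N2) (\<lambda>\<omega>. (f (?A \<omega>), g (?B \<omega>)))"
    unfolding joint by (simp add: distr_distr[OF fg AB] comp_def)
  finally show ?thesis ..
qed

lemma (in prob_space) distr_head_tail:
  fixes Y :: "nat \<Rightarrow> 'a \<Rightarrow> real"
  assumes indep: "indep_vars (\<lambda>_. borel) Y UNIV" and law: "\<And>k. distr M borel (Y (Suc k)) = N"
  shows "distr M (borel \<Otimes>\<^sub>M iid borel) (\<lambda>\<omega>. (Y 0 \<omega>, \<lambda>k. Y (Suc k) \<omega>)) = distr M borel (Y 0) \<Otimes>\<^sub>M iid N"
proof -
  have f: "(\<lambda>x. x 0) \<in> PiM {0::nat} (\<lambda>_. borel) \<rightarrow>\<^sub>M (borel :: real measure)"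
    by (rule measurable_component_singleton) simp
  have g: "(\<lambda>x k. x (Suc k)) \<in> PiM (range Suc) (\<lambda>_. borel) \<rightarrow>\<^sub>M iid (borel :: real measure)"
    by (rule measurable_PiM_single') simp_all
  have "distr M (iid borel) (\<lambda>\<omega> k. Y (Suc k) \<omega>) = iid N"
    using distr_subfamily[OF indep, of Suc] by (simp add: law)
  then show ?thesis
    using distr_disjoint_groups[OF indep _ f g] by auto
qed

lemma equilibrium_renewal_law:
  assumes er: "equilibrium_renewal M N P X" and X: "positive_rv_with_rate P X \<mu>"
    and P: "prob_space P" "prob_space M" and s: "0 \<le> s"
  defines "\<sigma> \<equiv> distr P borel X"
  shows "emeasure M {\<omega> \<in> space M. N s \<omega> = m} =
    service_law.mean_count_gf \<sigma> s (service_law.residual_law \<sigma> \<mu>) $ m"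
proof -
  interpret M: prob_space M by fact
  interpret service_law \<sigma>
    unfolding \<sigma>_def by (rule service_law_distr[OF X P(1)])
  have N [measurable]: "N s \<in> M \<rightarrow>\<^sub>M count_space UNIV"
    using er s by (simp add: equilibrium_renewal_def)
  obtain Y where Y0: "residual_life M (Y 0) P X" and Y: "\<And>k. same_law M (Y (Suc k)) P X"
    and indep: "M.indep_vars (\<lambda>_. borel) Y UNIV"
    and count: "AE \<omega> in M. \<forall>t\<ge>0. N t \<omega> = event_count (\<lambda>k. Y k \<omega>) t"
    using er by (auto simp: equilibrium_renewal_def)
  have Y_m [measurable]: "Y k \<in> borel_measurable M" for k
    using indep by (auto simp: M.indep_vars_def)
  have law: "distr M borel (Y (Suc k)) = \<sigma>" for k
    using Y by (simp add: same_law_def \<sigma>_def)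
  have law_0: "distr M borel (Y 0) = residual_law \<mu>"
    unfolding \<sigma>_def by (rule distr_residual_life[OF Y0 X P])
  have pos: "AE w in \<sigma>. 0 < w"
    unfolding \<sigma>_def by (rule service_law_distr[OF X P(1)])
  have pos_Y: "AE \<omega> in M. 0 < Y k \<omega>" for k
  proof (cases k)
    case 0
    interpret D: prob_space "distr M borel (Y 0)"
      by (rule M.prob_space_distr) simp
    have "AE x in distr M borel (Y 0). 0 < x"
      using residual_life_positive[OF Y0 X P] D.AE_in_set_eq_1[of "{0<..}"]
      by (simp add: D.emeasure_eq_measure)
    with 0 show ?thesis
      using M.AE_positive_from_distr[of "Y 0"] by simp
  next
    case (Suc j)
    show ?thesis
      unfolding Suc
    proof (rule M.AE_positive_from_distr)
      show "AE w in distr M borel (Y (Suc j)). 0 < w"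
        unfolding law by (rule pos)
    qed simp
  qed
  have "AE \<omega> in M. \<forall>k. 0 < Y k \<omega>"
    using pos_Y by (subst AE_all_countable) simp
  moreover have "AE \<omega> in M. \<forall>t. finite {k. (\<Sum>j\<le>k. Y j \<omega>) \<le> t}"
    by (rule M.AE_finite_partial_sums[OF indep law pos pos_Y])
  ultimately have "AE \<omega> in M. N s \<omega> = m \<longleftrightarrow> has_count s m (Y 0 \<omega>) (\<lambda>k. Y (Suc k) \<omega>)"
    using count
  proof eventually_elim
    case (elim \<omega>)
    then have "N s \<omega> = event_count (\<lambda>k. Y k \<omega>) s"
      using s by simp
    moreover have "event_count (\<lambda>k. Y k \<omega>) s = m \<longleftrightarrow> has_count s m (Y 0 \<omega>) (\<lambda>k. Y (Suc k) \<omega>)"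
      using elim by (intro event_count_iff_has_count) (auto intro: less_imp_le)
    ultimately show ?case
      by simp
  qed
  then have "(\<integral>\<^sup>+\<omega>. indicator {\<omega> \<in> space M. N s \<omega> = m} \<omega> \<partial>M) =
      (\<integral>\<^sup>+\<omega>. of_bool (has_count s m (Y 0 \<omega>) (\<lambda>k. Y (Suc k) \<omega>)) \<partial>M)"
    by (intro nn_integral_cong_AE) (auto simp: indicator_def)
  also have "\<dots> = (\<integral>\<^sup>+z. of_bool (has_count s m (fst z) (snd z)) \<partial>distr M (borel \<Otimes>\<^sub>M iid borel) (\<lambda>\<omega>. (Y 0 \<omega>, \<lambda>k. Y (Suc k) \<omega>)))"
  proof (subst nn_integral_distr)
    show "(\<lambda>\<omega>. (Y 0 \<omega>, \<lambda>k. Y (Suc k) \<omega>)) \<in> M \<rightarrow>\<^sub>M borel \<Otimes>\<^sub>M iid borel"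
      by (intro measurable_Pair measurable_PiM_single') simp_all
    have [measurable]: "Measurable.pred (borel \<Otimes>\<^sub>M iid borel) (\<lambda>z. has_count s m (fst z) (snd z))"
      by (rule measurable_has_count) simp_all
    show "(\<lambda>z. of_bool (has_count s m (fst z) (snd z)) :: ennreal) \<in>
        borel_measurable (distr M (borel \<Otimes>\<^sub>M iid borel) (\<lambda>\<omega>. (Y 0 \<omega>, \<lambda>k. Y (Suc k) \<omega>)))"
      by simp
  qed simp
  also have "\<dots> = (\<integral>\<^sup>+r. \<integral>\<^sup>+w. of_bool (has_count s m r w) \<partial>iid \<sigma> \<partial>residual_law \<mu>)"
  proof -
    interpret W: prob_space "iid \<sigma>"
      by (rule prob_space_iid) unfold_locales
    have "Measurable.pred (residual_law \<mu> \<Otimes>\<^sub>M iid \<sigma>) (\<lambda>z. has_count s m (fst z) (snd z))"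
    proof (rule measurable_has_count)
      show "snd \<in> residual_law \<mu> \<Otimes>\<^sub>M iid \<sigma> \<rightarrow>\<^sub>M iid borel"
        by (rule measurable_compose[OF measurable_snd measurable_ident_sets[OF sets_iid_law]])
      show "fst \<in> borel_measurable (residual_law \<mu> \<Otimes>\<^sub>M iid \<sigma>)"
        by (rule measurable_compose[OF measurable_fst measurable_ident_sets]) simp
    qed
    then have "(\<lambda>z. of_bool (has_count s m (fst z) (snd z)) :: ennreal) \<in> borel_measurable (residual_law \<mu> \<Otimes>\<^sub>M iid \<sigma>)"
      by measurable
    then show ?thesis
      unfolding M.distr_head_tail[OF indep law] law_0 by (subst W.nn_integral_fst[symmetric]) simp_all
  qed
  also have "\<dots> = mean_count_gf s (residual_law \<mu>) $ m"
    by (simp add: nn_integral_has_count mean_count_gf_def)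
  finally show ?thesis
    by simp
qed

lemma equilibrium_poisson_law:
  assumes er: "equilibrium_renewal M N P A" and A: "positive_rv_with_rate P A l"
    and P: "prob_space P" "prob_space M" and s: "0 \<le> s"
    and exp: "distributed P lborel A (\<lambda>x. ennreal (exponential_density l x))"
  shows "distr M (count_space UNIV) (N s) = distr (iid (exp_law l)) (count_space UNIV) (\<lambda>u. event_count u s)"
proof -
  interpret M: prob_space M by fact
  have N [measurable]: "N s \<in> M \<rightarrow>\<^sub>M count_space UNIV"
    using er s by (simp add: equilibrium_renewal_def)
  obtain Y where Y0: "residual_life M (Y 0) P A" and Y: "\<And>k. same_law M (Y (Suc k)) P A"
    and indep: "M.indep_vars (\<lambda>_. borel) Y UNIV"
    and count: "AE \<omega> in M. \<forall>t\<ge>0. N t \<omega> = event_count (\<lambda>k. Y k \<omega>) t"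
    using er by (auto simp: equilibrium_renewal_def)
  have Y_m [measurable]: "Y k \<in> borel_measurable M" for k
    using indep by (auto simp: M.indep_vars_def)
  note law_A = distr_exponential[OF exp]
  have law: "distr M borel (Y k) = exp_law l" for k
    using Y distr_residual_life_exponential[OF Y0 A P exp] by (cases k) (simp_all add: same_law_def law_A)
  have seq: "(\<lambda>\<omega> k. Y k \<omega>) \<in> M \<rightarrow>\<^sub>M iid borel"
    by (rule measurable_PiM_single') simp_all
  have "distr M (count_space UNIV) (N s) = distr M (count_space UNIV) (\<lambda>\<omega>. event_count (\<lambda>k. Y k \<omega>) s)"
    using count s seq by (intro distr_cong_AE) auto
  also have "\<dots> = distr (distr M (iid borel) (\<lambda>\<omega> k. Y k \<omega>)) (count_space UNIV) (\<lambda>u. event_count u s)"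
    by (simp add: distr_distr seq comp_def)
  also have "distr M (iid borel) (\<lambda>\<omega> k. Y k \<omega>) = iid (exp_law l)"
    using M.distr_subfamily[OF indep, of id] by (simp add: law)
  finally show ?thesis .
qed

section \<open>The primitive data of the queue\<close>

text \<open>All primitive data except \<open>L\<close> become real random variables indexed by one
  type. The order \<open>L\<close> of the initial jobs can be left out because the lower bound on
  a sample path is the same for every order.\<close>

lemma queue_inputs_indep:
  assumes "prob_space M" and Q: "queue_inputs M n P A S Z L U V W"
  defines "X \<equiv> \<lambda>i \<omega>. case i of Initial_State \<Rightarrow> real (Z \<omega>) | Interarrival k \<Rightarrow> U k \<omega>
    | Initial_Processing k \<Rightarrow> V k \<omega> | Processing k \<Rightarrow> W k \<omega>"
  shows "prob_space.indep_vars M (\<lambda>_. borel) X UNIV"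
proof -
  interpret prob_space M by fact
  have Z: "Z \<in> M \<rightarrow>\<^sub>M count_space UNIV"
    and UVW: "\<And>k. U k \<in> borel_measurable M" "\<And>k. V k \<in> borel_measurable M" "\<And>k. W k \<in> borel_measurable M"
  proof -
    show "Z \<in> M \<rightarrow>\<^sub>M count_space UNIV" "\<And>k. V k \<in> borel_measurable M" "\<And>k. W k \<in> borel_measurable M"
      using Q by (simp_all add: queue_inputs_def residual_life_def same_law_def)
    show "U k \<in> borel_measurable M" for k
      using Q by (cases k) (simp_all add: queue_inputs_def residual_life_def same_law_def)
  qed
  have X_m: "X i \<in> borel_measurable M" for i
    unfolding X_def using Z UVW by (cases i) simp_all
  have "indep_sets (\<lambda>i. {X i -` B \<inter> space M | B. B \<in> sets borel}) UNIV"
  proof (rule indep_sets_mono_sets)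
    show "indep_sets (input_sigma M Z L U V W) UNIV"
      using Q by (simp add: queue_inputs_def)
    fix i
    show "{X i -` B \<inter> space M | B. B \<in> sets borel} \<subseteq> input_sigma M Z L U V W i"
    proof (cases i)
      case Initial_State
      have eq: "X i -` B \<inter> space M = (\<lambda>\<omega>. (Z \<omega>, L \<omega>)) -` {z. real (fst z) \<in> B} \<inter> space M" for B
        unfolding X_def Initial_State by auto
      have "X i -` B \<inter> space M \<in> input_sigma M Z L U V W i" for B
        unfolding eq unfolding Initial_State input_sigma.simps by (rule in_vimage_algebra) simp
      then show ?thesis
        by blast
    qed (auto simp: X_def intro!: in_vimage_algebra)
  qed
  then show ?thesis
    using X_m by (simp add: indep_vars_def2)
qed

lemma queue_inputs_law:
  assumes M: "prob_space M" and P: "prob_space P" and Q: "queue_inputs M n P A S Z L U V W"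
    and A: "positive_rv_with_rate P A l" and S: "positive_rv_with_rate P S \<mu>"
    and exp: "distributed P lborel A (\<lambda>x. ennreal (exponential_density l x))"
  defines "\<sigma> \<equiv> distr P borel S"
  shows "distr M (count_space UNIV \<Otimes>\<^sub>M iid borel \<Otimes>\<^sub>M iid borel \<Otimes>\<^sub>M iid borel)
      (\<lambda>\<omega>. (Z \<omega>, \<lambda>k. V k \<omega>, \<lambda>k. U k \<omega>, \<lambda>k. W k \<omega>)) =
      distr M (count_space UNIV) Z \<Otimes>\<^sub>M iid (service_law.residual_law \<sigma> \<mu>) \<Otimes>\<^sub>M iid (exp_law l) \<Otimes>\<^sub>M iid \<sigma>"
    and "AE \<omega> in M. (\<forall>k. 0 < U k \<omega>) \<and> (\<forall>k. 0 < W k \<omega>) \<and> (\<forall>t. finite {k. (\<Sum>j\<le>k. U j \<omega>) \<le> t})"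
proof -
  interpret M: prob_space M by fact
  define X where "X i \<omega> = (case i of Initial_State \<Rightarrow> real (Z \<omega>) | Interarrival k \<Rightarrow> U k \<omega>
    | Initial_Processing k \<Rightarrow> V k \<omega> | Processing k \<Rightarrow> W k \<omega>)" for i \<omega>
  have X_simps [simp]: "X Initial_State = (\<lambda>\<omega>. real (Z \<omega>))" "X (Interarrival k) = U k"
      "X (Initial_Processing k) = V k" "X (Processing k) = W k" for k
    by (simp_all add: X_def fun_eq_iff)
  have indep: "M.indep_vars (\<lambda>_. borel) X UNIV"
    using queue_inputs_indep[OF M Q] by (simp add: X_def[abs_def])
  have X_m: "X i \<in> borel_measurable M" for i
    using indep by (simp add: M.indep_vars_def)
  note law_A = distr_exponential[OF exp]
  have U: "distr M borel (U k) = exp_law l" for k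
    using Q distr_residual_life_exponential[of M "U 0", OF _ A P M exp]
    by (cases k) (simp_all add: queue_inputs_def same_law_def law_A)
  have V: "distr M borel (V k) = service_law.residual_law \<sigma> \<mu>" for k
    unfolding \<sigma>_def using Q by (intro distr_residual_life[OF _ S P M]) (simp add: queue_inputs_def)
  have W: "distr M borel (W k) = \<sigma>" for k
    using Q by (simp add: queue_inputs_def same_law_def \<sigma>_def)
  have inj: "inj Interarrival" "inj Initial_Processing" "inj Processing"
    by (simp_all add: inj_def)
  have U_iid: "distr M (iid borel) (\<lambda>\<omega> k. U k \<omega>) = iid (exp_law l)"
    using M.distr_subfamily[OF indep inj(1)] by (simp add: U)
  have V_iid: "distr M (iid borel) (\<lambda>\<omega> k. V k \<omega>) = iid (service_law.residual_law \<sigma> \<mu>)"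
    using M.distr_subfamily[OF indep inj(2)] by (simp add: V)
  have W_iid: "distr M (iid borel) (\<lambda>\<omega> k. W k \<omega>) = iid \<sigma>"
    using M.distr_subfamily[OF indep inj(3)] by (simp add: W)
  let ?B = "iid (borel :: real measure)"
  have proj: "(\<lambda>x k. x (f k)) \<in> PiM I (\<lambda>_. borel) \<rightarrow>\<^sub>M ?B" if "range f \<subseteq> I" for f :: "nat \<Rightarrow> queue_input" and I
    by (rule measurable_PiM_single') (use that in \<open>auto intro!: measurable_component_singleton\<close>)
  have UW: "distr M (?B \<Otimes>\<^sub>M ?B) (\<lambda>\<omega>. (\<lambda>k. U k \<omega>, \<lambda>k. W k \<omega>)) = iid (exp_law l) \<Otimes>\<^sub>M iid \<sigma>"
    using M.distr_disjoint_groups[OF indep, of "range Interarrival" "range Processing",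
        OF _ proj[of Interarrival] proj[of Processing]]
    by (auto simp: U_iid W_iid)
  have VUW: "distr M (?B \<Otimes>\<^sub>M ?B \<Otimes>\<^sub>M ?B) (\<lambda>\<omega>. (\<lambda>k. V k \<omega>, \<lambda>k. U k \<omega>, \<lambda>k. W k \<omega>)) =
      iid (service_law.residual_law \<sigma> \<mu>) \<Otimes>\<^sub>M iid (exp_law l) \<Otimes>\<^sub>M iid \<sigma>"
  proof -
    let ?J = "range Interarrival \<union> range Processing"
    have "(\<lambda>x. (\<lambda>k. x (Interarrival k), \<lambda>k. x (Processing k))) \<in> PiM ?J (\<lambda>_. borel) \<rightarrow>\<^sub>M ?B \<Otimes>\<^sub>M ?B"
      by (intro measurable_Pair proj) auto
    from M.distr_disjoint_groups[OF indep, of "range Initial_Processing" ?J,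
        OF _ proj[of Initial_Processing] this]
    show ?thesis
      by (auto simp: V_iid UW)
  qed
  show "distr M (count_space UNIV \<Otimes>\<^sub>M ?B \<Otimes>\<^sub>M ?B \<Otimes>\<^sub>M ?B)
      (\<lambda>\<omega>. (Z \<omega>, \<lambda>k. V k \<omega>, \<lambda>k. U k \<omega>, \<lambda>k. W k \<omega>)) =
      distr M (count_space UNIV) Z \<Otimes>\<^sub>M iid (service_law.residual_law \<sigma> \<mu>) \<Otimes>\<^sub>M iid (exp_law l) \<Otimes>\<^sub>M iid \<sigma>"
  proof -
    let ?J = "range Initial_Processing \<union> range Interarrival \<union> range Processing"
    have f: "(\<lambda>x. nat \<lfloor>x Initial_State\<rfloor>) \<in> PiM {Initial_State} (\<lambda>_. borel :: real measure) \<rightarrow>\<^sub>M count_space UNIV"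
    proof -
      have "(\<lambda>x. x Initial_State) \<in> borel_measurable (PiM {Initial_State} (\<lambda>_. borel :: real measure))"
        by (rule measurable_component_singleton) simp
      then show ?thesis
        by measurable
    qed
    have "(\<lambda>x. (\<lambda>k. x (Initial_Processing k), \<lambda>k. x (Interarrival k), \<lambda>k. x (Processing k)))
        \<in> PiM ?J (\<lambda>_. borel) \<rightarrow>\<^sub>M ?B \<Otimes>\<^sub>M ?B \<Otimes>\<^sub>M ?B"
      by (intro measurable_Pair proj) auto
    from M.distr_disjoint_groups[OF indep, of "{Initial_State}" ?J, OF _ f this]
    show ?thesis
      by (auto simp: VUW)
  qed
  have l: "0 < l"
    using A by (simp add: positive_rv_with_rate_def)
  have pos_exp: "AE x in exp_law l. 0 < x"
    unfolding law_A[symmetric] by (rule service_law_distr(3)[OF A P])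
  have pos_\<sigma>: "AE x in \<sigma>. 0 < x"
    unfolding \<sigma>_def by (rule service_law_distr(3)[OF S P])
  have pos_U: "AE \<omega> in M. 0 < U k \<omega>" for k
  proof (rule M.AE_positive_from_distr)
    show "AE x in distr M borel (U k). 0 < x"
      unfolding U by (rule pos_exp)
  qed (use X_m[of "Interarrival k"] in simp)
  have pos_W: "AE \<omega> in M. 0 < W k \<omega>" for k
  proof (rule M.AE_positive_from_distr)
    show "AE x in distr M borel (W k). 0 < x"
      unfolding W by (rule pos_\<sigma>)
  qed (use X_m[of "Processing k"] in simp)
  have "M.indep_vars (\<lambda>_. borel) U UNIV"
    using M.indep_vars_subfamily[OF indep inj(1)] by simp
  then have "AE \<omega> in M. \<forall>t. finite {k. (\<Sum>j\<le>k. U j \<omega>) \<le> t}"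
    by (rule M.AE_finite_partial_sums[OF _ U pos_exp pos_U])
  moreover have "AE \<omega> in M. (\<forall>k. 0 < U k \<omega>)" "AE \<omega> in M. (\<forall>k. 0 < W k \<omega>)"
    using pos_U pos_W by (simp_all add: AE_all_countable)
  ultimately show "AE \<omega> in M. (\<forall>k. 0 < U k \<omega>) \<and> (\<forall>k. 0 < W k \<omega>) \<and> (\<forall>t. finite {k. (\<Sum>j\<le>k. U j \<omega>) \<le> t})"
    by eventually_elim simp
qed

lemma arrivals_exceed_services:
  fixes Arr :: "real \<Rightarrow> 'b \<Rightarrow> nat"
  assumes P: "prob_space P" and M': "prob_space M'"
    and A: "positive_rv_with_rate P A l" and S: "positive_rv_with_rate P S \<mu>"
    and exp: "distributed P lborel A (\<lambda>x. ennreal (exponential_density l x))"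
    and Arr: "equilibrium_renewal M' Arr P A" and N: "\<And>i. i < n \<Longrightarrow> equilibrium_renewal M' (N i) P S"
    and indep: "indep_processes M' (case_option Arr N) (insert None (Some ` {..<n}))"
    and s: "0 \<le> s"
  shows "emeasure M' {\<omega> \<in> space M'. (\<Sum>i<n. N i s \<omega>) + Suc q \<le> Arr s \<omega>} =
    mgi_queue.overload_prob (distr P borel S) \<mu> l n q s"
proof -
  interpret M': prob_space M' by fact
  note S_law = service_law_distr[OF S P]
  interpret mgi_queue "distr P borel S" \<mu> l
    using S_law service_law_distr(5)[OF A P] by (simp add: mgi_queue_def mgi_queue_axioms_def)
  define X where "X i \<omega> = case_option Arr N i s \<omega>" for i \<omega>
  let ?I = "insert None (Some ` {..<n})"
  let ?C = "count_space UNIV :: nat measure"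
  have "(\<lambda>f. f s) \<in> PiM {0..} (\<lambda>_. ?C) \<rightarrow>\<^sub>M ?C"
    by (rule measurable_component_singleton) (use s in simp)
  then have "M'.indep_vars (\<lambda>_. ?C) (\<lambda>i \<omega>. path (case_option Arr N i) \<omega> s) ?I"
    by (intro M'.indep_vars_compose2[OF indep[unfolded indep_processes_def]])
  moreover have "(\<lambda>i \<omega>. path (case_option Arr N i) \<omega> s) = X"
    using s by (simp add: fun_eq_iff X_def path_def)
  ultimately have X: "M'.indep_vars (\<lambda>_. ?C) X ?I"
    by simp
  define D where "D \<omega> = (\<Sum>i<n. N i s \<omega>)" for \<omega>
  have D_eq: "(\<Sum>i\<in>Some ` {..<n}. X i \<omega>) = D \<omega>" for \<omega>
    by (simp add: sum.reindex X_def D_def)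
  have D_law: "emeasure M' {\<omega> \<in> space M'. D \<omega> = m} = (mean_count_gf s \<nu> ^ n) $ m" for m
  proof -
    have "emeasure M' {\<omega> \<in> space M'. (\<Sum>i\<in>Some ` {..<n}. X i \<omega>) = m} = (mean_count_gf s \<nu> ^ card (Some ` {..<n})) $ m"
    proof (rule M'.sum_indep_counts_gf)
      show "M'.indep_vars (\<lambda>_. ?C) X (Some ` {..<n})"
        using X by (rule M'.indep_vars_subset) auto
      show "emeasure M' {\<omega> \<in> space M'. X i \<omega> = m} = mean_count_gf s \<nu> $ m" if "i \<in> Some ` {..<n}" for i m
        using that equilibrium_renewal_law[OF N S P M' s] by (auto simp: X_def)
    qed simp
    then show ?thesis
      by (simp add: D_eq card_image)
  qed
  have ind: "M'.indep_var ?C (Arr s) ?C D"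
  proof -
    have "M'.indep_var ?C ((\<lambda>f. f None) \<circ> (\<lambda>\<omega>. restrict (\<lambda>i. X i \<omega>) {None}))
      ?C ((\<lambda>f. \<Sum>i\<in>Some ` {..<n}. f i) \<circ> (\<lambda>\<omega>. restrict (\<lambda>i. X i \<omega>) (Some ` {..<n})))"
      by (intro M'.indep_var_compose[OF M'.indep_var_restrict[OF X]]) auto
    also have "(\<lambda>f. f None) \<circ> (\<lambda>\<omega>. restrict (\<lambda>i. X i \<omega>) {None}) = Arr s"
      by (auto simp: X_def)
    also have "(\<lambda>f. \<Sum>i\<in>Some ` {..<n}. f i) \<circ> (\<lambda>\<omega>. restrict (\<lambda>i. X i \<omega>) (Some ` {..<n})) = D"
      by (auto simp: D_eq[symmetric] cong: rev_conj_cong)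
    finally show ?thesis .
  qed
  then have Arr_m: "Arr s \<in> M' \<rightarrow>\<^sub>M ?C" and D_m: "D \<in> M' \<rightarrow>\<^sub>M ?C"
    and joint: "distr M' ?C (Arr s) \<Otimes>\<^sub>M distr M' ?C D = distr M' (?C \<Otimes>\<^sub>M ?C) (\<lambda>\<omega>. (Arr s \<omega>, D \<omega>))"
    unfolding M'.indep_var_distribution_eq by auto
  interpret D: prob_space "distr M' ?C D"
    using D_m by (rule M'.prob_space_distr)
  define H where "H a = (if q < a then \<Sum>m\<le>a - q - 1. (mean_count_gf s \<nu> ^ n) $ m else 0)" for a
  have H: "emeasure (distr M' ?C D) {m. m + Suc q \<le> a} = H a" for a
  proof -
    have eq: "{m. m + Suc q \<le> a} = (if q < a then {..a - q - 1} else {})"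
      by auto
    have "emeasure (distr M' ?C D) {m} = (mean_count_gf s \<nu> ^ n) $ m" for m
    proof -
      have "emeasure (distr M' ?C D) {m} = emeasure M' (D -` {m} \<inter> space M')"
        using D_m by (rule emeasure_distr) simp
      also have "D -` {m} \<inter> space M' = {\<omega> \<in> space M'. D \<omega> = m}"
        by auto
      finally show ?thesis
        by (simp add: D_law)
    qed
    moreover have "emeasure (distr M' ?C D) {..b} = (\<Sum>m\<le>b. emeasure (distr M' ?C D) {m})" for b
      by (rule emeasure_eq_sum_singleton) simp_all
    ultimately show ?thesis
      unfolding eq H_def by simp
  qed
  let ?E = "{z :: nat \<times> nat. snd z + Suc q \<le> fst z}"
  have E: "?E \<in> sets (?C \<Otimes>\<^sub>M ?C)"
    unfolding pair_measure_countable[OF countableI_type countableI_type] by simp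
  have "{\<omega> \<in> space M'. (\<Sum>i<n. N i s \<omega>) + Suc q \<le> Arr s \<omega>} = (\<lambda>\<omega>. (Arr s \<omega>, D \<omega>)) -` ?E \<inter> space M'"
    by (auto simp: D_def)
  also have "emeasure M' \<dots> = emeasure (distr M' (?C \<Otimes>\<^sub>M ?C) (\<lambda>\<omega>. (Arr s \<omega>, D \<omega>))) ?E"
    by (rule emeasure_distr[symmetric]) (use E Arr_m D_m in simp_all)
  also have "\<dots> = (\<integral>\<^sup>+a. emeasure (distr M' ?C D) (Pair a -` ?E) \<partial>distr M' ?C (Arr s))"
    unfolding joint[symmetric] by (rule D.emeasure_pair_measure_alt) (use E in \<open>simp cong: sets_pair_measure_cong\<close>)
  also have "\<dots> = (\<integral>\<^sup>+a. H a \<partial>distr M' ?C (Arr s))"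
    by (simp only: vimage_def mem_Collect_eq fst_conv snd_conv H)
  also have "\<dots> = (\<integral>\<^sup>+u. H (event_count u s) \<partial>iid (exp_law l))"
  proof -
    have "(\<lambda>u. event_count u s) \<in> iid (exp_law l) \<rightarrow>\<^sub>M ?C"
      by (intro measurable_event_count measurable_iid_ident) simp
    then show ?thesis
      unfolding equilibrium_poisson_law[OF Arr A P M' s exp] by (rule nn_integral_distr) simp
  qed
  finally show ?thesis
    by (simp add: overload_prob_def H_def)
qed

section \<open>The lower bound\<close>

text \<open>The pathwise bound holds almost surely, and its expectation is that of a function of
  independent data, which \<open>nn_integral_queue\<close> evaluates.\<close>

lemma overload_lower_bound:
  assumes n: "1 \<le> n" and P: "prob_space P" and M: "prob_space M"
    and A: "positive_rv_with_rate P A l" and S: "positive_rv_with_rate P S \<mu>"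
    and exp: "distributed P lborel A (\<lambda>x. ennreal (exponential_density l x))"
    and Q: "queue_inputs M n P A S Z L U V W"
    and Z: "distr M (count_space UNIV) Z = measure_pmf (poisson_pmf (l / \<mu>))"
    and T: "0 \<le> T"
  shows "emeasure M {\<omega> \<in> space M. n \<le> Z \<omega>} * mgi_queue.overload_prob (distr P borel S) \<mu> l n q s \<le>
    emeasure M {\<omega> \<in> space M. n + Suc q \<le> queue_number n Z L U V W (s + T) \<omega>}"
proof -
  interpret M: prob_space M by fact
  note S_law = service_law_distr[OF S P]
  interpret mgi_queue "distr P borel S" \<mu> l
    using S_law service_law_distr(5)[OF A P] by (simp add: mgi_queue_def mgi_queue_axioms_def)
  let ?\<sigma> = "distr P borel S"
  have Z_m: "Z \<in> M \<rightarrow>\<^sub>M count_space UNIV" and L_m: "L \<in> M \<rightarrow>\<^sub>M count_space UNIV"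
    and V_m: "\<And>k. V k \<in> borel_measurable M" and W_m: "\<And>k. W k \<in> borel_measurable M"
    and L: "AE \<omega> in M. distinct (L \<omega>) \<and> set (L \<omega>) = {..<Z \<omega>}"
    using Q by (simp_all add: queue_inputs_def residual_life_def same_law_def)
  have U_m: "U k \<in> borel_measurable M" for k
    using Q by (cases k) (simp_all add: queue_inputs_def residual_life_def same_law_def)
  define f where "f = (\<lambda>(z, v, u, w). \<Sum>k. run_arrivals T (mean_overload n q T s) k 0 (map v (rev [0..<z])) u w)"
  let ?B = "iid (borel :: real measure)"
  let ?M3 = "?B \<Otimes>\<^sub>M ?B \<Otimes>\<^sub>M ?B"
  have f_m: "f \<in> borel_measurable (count_space UNIV \<Otimes>\<^sub>M ?M3)"
  proof -
    have "(\<lambda>x. \<Sum>k. run_arrivals T (mean_overload n q T s) k 0 (map (fst (snd x)) (rev [0..<z])) (fst (snd (snd x))) (snd (snd (snd x))))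
        \<in> borel_measurable (count_space UNIV \<Otimes>\<^sub>M ?M3)" for z :: nat
    proof (intro borel_measurable_suminf_order measurable_run_arrivals[OF measurable_mean_overload] measurable_map_list_space)
      show "(\<lambda>x. fst (snd x) i) \<in> borel_measurable (count_space UNIV \<Otimes>\<^sub>M ?M3)" for i
        by measurable
      show "(\<lambda>x. fst (snd (snd x))) \<in> count_space UNIV \<Otimes>\<^sub>M ?M3 \<rightarrow>\<^sub>M ?B"
        "(\<lambda>x. snd (snd (snd x))) \<in> count_space UNIV \<Otimes>\<^sub>M ?M3 \<rightarrow>\<^sub>M ?B"
        by measurable
      show "(\<lambda>x. 0) \<in> borel_measurable (count_space UNIV \<Otimes>\<^sub>M ?M3)"
        by (rule borel_measurable_const)
    qed
    then show ?thesis
      unfolding f_def case_prod_beta by (rule measurable_compose_countable[OF _ measurable_fst])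
  qed
  interpret Z: prob_space "distr M (count_space UNIV) Z"
    using Z_m by (rule M.prob_space_distr)
  interpret U: prob_space "iid (exp_law l)"
    by (rule prob_space_iid[OF prob_space_exp_law[OF l]])
  interpret W: prob_space "iid ?\<sigma>"
    by (rule prob_space_iid) unfold_locales
  interpret V: prob_space "iid \<nu>"
    by (rule prob_space_iid[OF residual_law_facts(2)])
  interpret UW: pair_prob_space "iid (exp_law l)" "iid ?\<sigma>" ..
  interpret VUW: pair_prob_space "iid \<nu>" "iid (exp_law l) \<Otimes>\<^sub>M iid ?\<sigma>" ..
  let ?R = "\<lambda>\<omega>. (Z \<omega>, \<lambda>k. V k \<omega>, \<lambda>k. U k \<omega>, \<lambda>k. W k \<omega>)"
  have seq: "(\<lambda>\<omega> k. V k \<omega>) \<in> M \<rightarrow>\<^sub>M ?B" "(\<lambda>\<omega> k. U k \<omega>) \<in> M \<rightarrow>\<^sub>M ?B" "(\<lambda>\<omega> k. W k \<omega>) \<in> M \<rightarrow>\<^sub>M ?B"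
    using V_m U_m W_m by (auto intro!: measurable_PiM_single')
  have R_m: "?R \<in> M \<rightarrow>\<^sub>M count_space UNIV \<Otimes>\<^sub>M ?M3"
    using Z_m seq by measurable
  have sets_3: "sets (iid \<nu> \<Otimes>\<^sub>M iid (exp_law l) \<Otimes>\<^sub>M iid ?\<sigma>) = sets ?M3"
    by (intro sets_pair_measure_cong sets_iid) simp_all
  have f_z: "(\<lambda>y. f (z, y)) \<in> borel_measurable (iid \<nu> \<Otimes>\<^sub>M iid (exp_law l) \<Otimes>\<^sub>M iid ?\<sigma>)" for z
    unfolding measurable_cong_sets[OF sets_3 refl]
    by (rule measurable_compose[OF measurable_Pair1' f_m]) simp
  have f_zv: "(\<lambda>y. f (z, v, y)) \<in> borel_measurable (iid (exp_law l) \<Otimes>\<^sub>M iid ?\<sigma>)" for z v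
    by (rule measurable_compose[OF measurable_Pair1' f_z]) (simp add: space_PiM)
  have "emeasure M {\<omega> \<in> space M. n \<le> Z \<omega>} * overload_prob n q s =
      emeasure (distr M (count_space UNIV) Z) {n..} * overload_prob n q s"
  proof -
    have "emeasure (distr M (count_space UNIV) Z) {n..} = emeasure M (Z -` {n..} \<inter> space M)"
      using Z_m by (rule emeasure_distr) simp
    also have "Z -` {n..} \<inter> space M = {\<omega> \<in> space M. n \<le> Z \<omega>}"
      by auto
    finally show ?thesis
      by simp
  qed
  also have "\<dots> = (\<Sum>z. ennreal (pmf (poisson_pmf (l / \<mu>)) z) *
      (\<integral>\<^sup>+v. \<integral>\<^sup>+u. \<integral>\<^sup>+w. f (z, v, u, w) \<partial>iid ?\<sigma> \<partial>iid (exp_law l) \<partial>iid \<nu>))"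
    unfolding Z f_def using nn_integral_queue[OF n T, of q s] by simp
  also have "\<dots> = (\<Sum>z. ennreal (pmf (poisson_pmf (l / \<mu>)) z) *
      (\<integral>\<^sup>+y. f (z, y) \<partial>(iid \<nu> \<Otimes>\<^sub>M iid (exp_law l) \<Otimes>\<^sub>M iid ?\<sigma>)))"
    by (simp add: UW.P.nn_integral_fst[OF f_z, symmetric] W.nn_integral_fst[OF f_zv])
  also have "\<dots> = (\<integral>\<^sup>+z. \<integral>\<^sup>+y. f (z, y) \<partial>(iid \<nu> \<Otimes>\<^sub>M iid (exp_law l) \<Otimes>\<^sub>M iid ?\<sigma>) \<partial>distr M (count_space UNIV) Z)"
    unfolding Z by (simp add: nn_integral_measure_pmf nn_integral_count_space_nat)
  also have "\<dots> = (\<integral>\<^sup>+x. f x \<partial>(distr M (count_space UNIV) Z \<Otimes>\<^sub>M iid \<nu> \<Otimes>\<^sub>M iid (exp_law l) \<Otimes>\<^sub>M iid ?\<sigma>))"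
  proof (rule VUW.P.nn_integral_fst)
    have "sets (distr M (count_space UNIV) Z \<Otimes>\<^sub>M iid \<nu> \<Otimes>\<^sub>M iid (exp_law l) \<Otimes>\<^sub>M iid ?\<sigma>) = sets (count_space UNIV \<Otimes>\<^sub>M ?M3)"
      by (intro sets_pair_measure_cong sets_3) simp
    then show "f \<in> borel_measurable (distr M (count_space UNIV) Z \<Otimes>\<^sub>M iid \<nu> \<Otimes>\<^sub>M iid (exp_law l) \<Otimes>\<^sub>M iid ?\<sigma>)"
      using f_m measurable_cong_sets by blast
  qed
  also have "\<dots> = (\<integral>\<^sup>+\<omega>. f (?R \<omega>) \<partial>M)"
    unfolding queue_inputs_law(1)[OF M P Q A S exp, symmetric] using R_m f_m by (intro nn_integral_distr) simp_all
  also have "\<dots> \<le> (\<integral>\<^sup>+\<omega>. indicator {\<omega> \<in> space M. n + Suc q \<le> queue_number n Z L U V W (s + T) \<omega>} \<omega> \<partial>M)"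
  proof (rule nn_integral_mono_AE)
    show "AE \<omega> in M. f (?R \<omega>) \<le> indicator {\<omega> \<in> space M. n + Suc q \<le> queue_number n Z L U V W (s + T) \<omega>} \<omega>"
      using L queue_inputs_law(2)[OF M P Q A S exp] AE_space
    proof eventually_elim
      case (elim \<omega>)
      have "f (?R \<omega>) \<le> of_bool (n + Suc q \<le> number_in_system n (job_arrival (Z \<omega>) (\<lambda>k. U k \<omega>))
          (job_processing (Z \<omega>) (L \<omega>) (\<lambda>k. V k \<omega>) (\<lambda>k. W k \<omega>)) (s + T))"
        unfolding f_def prod.case using elim by (intro run_arrivals_le_queue[OF n]) (auto intro: less_imp_le)
      then show ?case
        using elim by (simp add: queue_number_def indicator_def)
    qed
  qed
  also have "\<dots> = emeasure M {\<omega> \<in> space M. n + Suc q \<le> queue_number n Z L U V W (s + T) \<omega>}"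
  proof (rule nn_integral_indicator)
    have "queue_number n Z L U V W (s + T) \<in> M \<rightarrow>\<^sub>M count_space UNIV"
      by (rule measurable_queue_number[OF n Z_m L_m U_m V_m W_m])
    then show "{\<omega> \<in> space M. n + Suc q \<le> queue_number n Z L U V W (s + T) \<omega>} \<in> sets M"
      by measurable
  qed
  finally show ?thesis .
qed


theorem theorem4:
  fixes n :: nat and \<mu>\<^sub>A \<mu>\<^sub>S :: real
    and P :: "'p measure" and A S :: "'p \<Rightarrow> real"
    and M :: "'a measure" and Z :: "'a \<Rightarrow> nat" and L :: "'a \<Rightarrow> nat list"
    and U V W :: "nat \<Rightarrow> 'a \<Rightarrow> real" and Q\<^sub>2 :: "real \<Rightarrow> 'a \<Rightarrow> nat"
    and M' :: "'b measure" and Arr :: "real \<Rightarrow> 'b \<Rightarrow> nat" and N :: "nat \<Rightarrow> real \<Rightarrow> 'b \<Rightarrow> nat"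
    and Minf :: "'c measure" and Qinf :: "'c \<Rightarrow> real"
  assumes "1 \<le> n"
    and "prob_space P"
    and "positive_rv_with_rate P A \<mu>\<^sub>A" and "positive_rv_with_rate P S \<mu>\<^sub>S"
    and "distributed P lborel A (\<lambda>x. ennreal (exponential_density \<mu>\<^sub>A x))"
    and "prob_space M"
    and "queue_inputs M n P A S Z L U V W"
    and "distr M (count_space UNIV) Z = measure_pmf (poisson_pmf (\<mu>\<^sub>A / \<mu>\<^sub>S))"
    and "Q\<^sub>2 = queue_number n Z L U V W"
    and "prob_space M'"
    and "equilibrium_renewal M' Arr P A"
    and "\<And>i. i < n \<Longrightarrow> equilibrium_renewal M' (N i) P S"
    and "indep_processes M' (case_option Arr N) (insert None (Some ` {..<n}))"
  shows "(\<forall>x>0. \<forall>t\<ge>0.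
      measure M {\<omega> \<in> space M. max (real (Q\<^sub>2 t \<omega>) - real n) 0 > x} \<ge>
      measure M {\<omega> \<in> space M. Z \<omega> \<ge> n} *
      (SUP s\<in>{0..t}. measure M' {\<omega> \<in> space M'. real (Arr s \<omega>) - (\<Sum>i<n. real (N i s \<omega>)) > x})) \<and>
    (prob_space Minf \<and> Qinf \<in> borel_measurable Minf \<and>
      weak_conv_at_top (\<lambda>t. distr M borel (\<lambda>\<omega>. real (Q\<^sub>2 t \<omega>))) (distr Minf borel Qinf) \<longrightarrow>
      (\<forall>x>0.
      measure Minf {\<omega> \<in> space Minf. max (Qinf \<omega> - real n) 0 > x} \<ge>
      measure M {\<omega> \<in> space M. Z \<omega> \<ge> n} *
      (SUP t\<in>{0..}. measure M' {\<omega> \<in> space M'. real (Arr t \<omega>) - (\<Sum>i<n. real (N i t \<omega>)) > x})))"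
proof -
  interpret P: prob_space P by fact
  interpret M: prob_space M by fact
  interpret M': prob_space M' by fact
  note n = assms(1) and A = assms(3) and S = assms(4) and exp = assms(5) and Q = assms(7)
    and Z = assms(8) and Q\<^sub>2 = assms(9)
  have Q_m: "Q\<^sub>2 t \<in> M \<rightarrow>\<^sub>M count_space UNIV" for t
  proof -
    have "U k \<in> borel_measurable M" for k
      using Q by (cases k) (simp_all add: queue_inputs_def residual_life_def same_law_def)
    then show ?thesis
      unfolding Q\<^sub>2 using Q n
      by (intro measurable_queue_number) (simp_all add: queue_inputs_def residual_life_def same_law_def)
  qed
  let ?a = "measure M {\<omega> \<in> space M. Z \<omega> \<ge> n}"
  define g where "g x s = measure M' {\<omega> \<in> space M'. real (Arr s \<omega>) - (\<Sum>i<n. real (N i s \<omega>)) > x}" for x s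
  have g_eq: "g x s = measure M' {\<omega> \<in> space M'. (\<Sum>i<n. N i s \<omega>) + Suc (nat \<lfloor>x\<rfloor>) \<le> Arr s \<omega>}" if "0 < x" for x s
  proof -
    have "real a - real b > x \<longleftrightarrow> b + Suc (nat \<lfloor>x\<rfloor>) \<le> a" for a b :: nat
      using that by linarith
    from this[of _ "\<Sum>i<n. N i s _"] show ?thesis
      by (simp add: g_def)
  qed
  have bound: "?a * g x s \<le> measure M {\<omega> \<in> space M. real (Q\<^sub>2 t \<omega>) - real n > x}"
    if x: "0 < x" and s: "0 \<le> s" "s \<le> t" for x s t
  proof -
    let ?q = "nat \<lfloor>x\<rfloor>"
    have "real a - real n > x \<longleftrightarrow> n + Suc ?q \<le> a" for a :: nat
      using x by linarith
    then have Q_eq: "{\<omega> \<in> space M. real (Q\<^sub>2 t \<omega>) - real n > x} = {\<omega> \<in> space M. n + Suc ?q \<le> Q\<^sub>2 t \<omega>}"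
      by simp
    have "ennreal (?a * g x s) = emeasure M {\<omega> \<in> space M. n \<le> Z \<omega>} *
        emeasure M' {\<omega> \<in> space M'. (\<Sum>i<n. N i s \<omega>) + Suc ?q \<le> Arr s \<omega>}"
      by (simp add: g_eq[OF x] M.emeasure_eq_measure M'.emeasure_eq_measure ennreal_mult)
    also have "\<dots> \<le> emeasure M {\<omega> \<in> space M. n + Suc ?q \<le> queue_number n Z L U V W (s + (t - s)) \<omega>}"
      using overload_lower_bound[OF n assms(2,6) A S exp Q Z, of "t - s" ?q s] s
        arrivals_exceed_services[OF assms(2,10) A S exp assms(11-13) s(1)]
      by simp
    also have "\<dots> = ennreal (measure M {\<omega> \<in> space M. real (Q\<^sub>2 t \<omega>) - real n > x})"
      unfolding Q_eq by (simp add: Q\<^sub>2 M.emeasure_eq_measure)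
    finally show ?thesis
      by (simp add: measure_nonneg)
  qed
  have sup: "?a * (SUP s\<in>I. g x s) \<le> b" if "I \<noteq> {}" "\<And>s. s \<in> I \<Longrightarrow> ?a * g x s \<le> b" "0 \<le> b" for I x b
  proof (cases "?a = 0")
    case False
    then have a: "0 < ?a"
      by (simp add: zero_less_measure_iff)
    then have "(SUP s\<in>I. g x s) \<le> b / ?a"
      using that by (intro cSUP_least) (simp_all add: field_simps)
    with a show ?thesis
      by (simp add: field_simps)
  qed (use that in simp)
  show ?thesis
    unfolding g_def[symmetric]
  proof (intro conjI allI impI)
    fix x t :: real assume x: "0 < x" and t: "0 \<le> t"
    have "{\<omega> \<in> space M. max (real (Q\<^sub>2 t \<omega>) - real n) 0 > x} = {\<omega> \<in> space M. real (Q\<^sub>2 t \<omega>) - real n > x}"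
      using x by auto
    then show "?a * (SUP s\<in>{0..t}. g x s) \<le> measure M {\<omega> \<in> space M. max (real (Q\<^sub>2 t \<omega>) - real n) 0 > x}"
      using t bound[OF x] by (intro sup) auto
  next
    fix x :: real
    assume inf: "prob_space Minf \<and> Qinf \<in> borel_measurable Minf \<and>
        weak_conv_at_top (\<lambda>t. distr M borel (\<lambda>\<omega>. real (Q\<^sub>2 t \<omega>))) (distr Minf borel Qinf)"
      and x: "0 < x"
    interpret Minf: prob_space Minf
      using inf by simp
    have Qinf: "Qinf \<in> borel_measurable Minf"
      using inf by simp
    interpret D: real_distribution "distr Minf borel Qinf"
      using Qinf by (rule Minf.real_distribution_distr)
    \<comment> \<open>A continuity point \<open>y\<close> with no integer in \<open>(n + x, y]\<close>: exceeding \<open>y - n\<close> and exceeding \<open>x\<close> are the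
      same for integers, so the bound at finite times does not change.\<close>
    have "mono (cdf (distr Minf borel Qinf))"
      by (simp add: mono_def D.cdf_nondecreasing)
    note * = open_minus_countable[OF mono_ctble_discont[OF this], of "{real n + x<..<real n + real_of_int \<lfloor>x\<rfloor> + 1}"]
    obtain y where y: "real n + x < y" "y < real n + real_of_int \<lfloor>x\<rfloor> + 1" and cont: "isCont (cdf (distr Minf borel Qinf)) y"
    proof -
      have "x < real_of_int \<lfloor>x\<rfloor> + 1"
        by linarith
      with * that show ?thesis
        by force
    qed
    have cdf_eq: "cdf (distr K borel X) y = 1 - measure K {\<omega> \<in> space K. y < X \<omega>}"
      if "prob_space K" "X \<in> borel_measurable K" for K :: "'k measure" and X
    proof -
      interpret K: prob_space K by fact
      note [measurable] = that(2)
      have "cdf (distr K borel X) y = measure K (X -` {..y} \<inter> space K)"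
        unfolding cdf_def by (rule measure_distr) simp_all
      also have "X -` {..y} \<inter> space K = space K - {\<omega> \<in> space K. y < X \<omega>}"
        by auto
      also have "measure K \<dots> = 1 - measure K {\<omega> \<in> space K. y < X \<omega>}"
        by (rule K.prob_compl) simp
      finally show ?thesis .
    qed
    have "?a * g x s \<le> measure Minf {\<omega> \<in> space Minf. max (Qinf \<omega> - real n) 0 > x}" if s: "0 \<le> s" for s
    proof -
      have le: "\<forall>\<^sub>F t in at_top. cdf (distr M borel (\<lambda>\<omega>. real (Q\<^sub>2 t \<omega>))) y \<le> 1 - ?a * g x s"
        using eventually_ge_at_top[of s]
      proof eventually_elim
        case (elim t)
        have "\<lfloor>y - real n\<rfloor> = \<lfloor>x\<rfloor>"
          using y by linarith
        then have "g x s = g (y - real n) s"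
          using x y by (simp add: g_eq)
        then have "?a * g x s \<le> measure M {\<omega> \<in> space M. y < real (Q\<^sub>2 t \<omega>)}"
          using bound[of "y - real n" s t] x y s elim by simp
        then show ?case
          using Q_m[of t] by (subst cdf_eq) (simp_all add: M.prob_space_axioms)
      qed
      have "((\<lambda>t. cdf (distr M borel (\<lambda>\<omega>. real (Q\<^sub>2 t \<omega>))) y) \<longlongrightarrow> cdf (distr Minf borel Qinf) y) at_top"
        using inf cont by (simp add: weak_conv_at_top_def)
      from tendsto_upperbound[OF this le] have "cdf (distr Minf borel Qinf) y \<le> 1 - ?a * g x s"
        by simp
      then have "?a * g x s \<le> measure Minf {\<omega> \<in> space Minf. y < Qinf \<omega>}"
        using Qinf by (subst (asm) cdf_eq) (simp_all add: Minf.prob_space_axioms)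
      also have "\<dots> \<le> measure Minf {\<omega> \<in> space Minf. max (Qinf \<omega> - real n) 0 > x}"
        using Qinf y by (intro Minf.finite_measure_mono) auto
      finally show ?thesis .
    qed
    then show "?a * (SUP t\<in>{0..}. g x t) \<le> measure Minf {\<omega> \<in> space Minf. max (Qinf \<omega> - real n) 0 > x}"
      by (intro sup) auto
  qed
qed

end
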